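(* For any $N\geq 1$ and any $\gamma=\sum_{j=1}^N\xi_j\delta_{z_j}\in\Gamma$ (with $\xi_j\in\mathbb{R}\setminus\{0\}$ and $z_1,\dots,z_N\in\mathbb{R}^2$ pairwise distinct) there exist infinitely many point vortices solutions $(-\infty,+\infty)\ni t\mapsto\omega_t\in\Gamma$ of Euler's equations such that $\omega_0=\gamma$.
   Context: The configuration space is $\Gamma=\bigcup_{N\ge0}\Gamma_N$, where $$\Gamma_N=\Big\{\sum_{j=1}^N\xi_j\delta_{z_j}:\ \xi_j\in\mathbb{R}\setminus\{0\},\ z_j\in\mathbb{R}^2,\ z_j\ne z_k\text{ if }j\ne k\Big\},$$ regarded as a subset of the space $\mathcal{M}(\mathbb{R}^2)=C_0(\mathbb{R}^2)^*$ of finite signed measures with the weak* topology. For $\gamma=\sum_{j=1}^N\xi_j\delta_{z_j}\in\Gamma$ set $\gamma\diamond\gamma=\sum_{j\ne k}\xi_j\xi_k\delta_{(z_j,z_k)}$, a measure on $\mathbb{R}^2\times\mathbb{R}^2$. Let $K(x)=\frac1{2\pi}\frac{x^\perp}{|x|^2}$ with $(x_1,x_2)^\perp=(-x_2,x_1)$, and for $\phi\in C_c^\infty(\mathbb{R}^2)$ and $x\neq y$ let $$H_\phi(x,y)=\tfrac12\big(\nabla\phi(x)-\nabla\phi(y)\big)\cdot K(x-y).$$ $\langle\cdot,\cdot\rangle$ denotes integration of a function against a measure. Let $I$ be an open interval containing $0$ (possibly unbounded). A weakly* continuous curve $I\ni t\mapsto\omega_t\in\Gamma$ is a point vortices solution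 of Euler's equations if for all $\phi\in C^\infty_c(\mathbb{R}^2)$ and all $t\in I$ $$\langle\phi,\omega_t\rangle-\langle\phi,\omega_0\rangle=\int_0^t\langle H_\phi,\omega_s\diamond\omega_s\rangle\,ds.$$ *)

theory Defs
  imports "HOL-Analysis.Analysis"
begin

section \<open>Finite signed Borel measures\<close>

text \<open>
  A signed measure is a real-valued set function. Requiring the value 0 off the Borel sets makes
  equality of set functions the same as equality of measures.
\<close>

definition signed_measures :: "('a::topological_space set \<Rightarrow> real) set" where
  "signed_measures = {\<mu>. (\<forall>A. A \<notin> sets borel \<longrightarrow> \<mu> A = 0) \<and>
     (\<forall>A. range A \<subseteq> sets borel \<longrightarrow> disjoint_family A \<longrightarrow>
        (\<lambda>n::nat. \<mu> (A n)) sums \<mu> (\<Union>n. A n))}"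

definition dirac :: "'a::topological_space \<Rightarrow> 'a set \<Rightarrow> real" where
  "dirac z = (\<lambda>A. if A \<in> sets borel then indicator A z else 0)"

text \<open>
  The positive part of the Jordan decomposition; the negative part is the positive part of the
  opposite measure. (\<^const>\<open>ennreal\<close> maps negative numbers to 0, which does not affect
  the supremum, since the empty set is among the competitors.)
\<close>

definition positive_part :: "('a::topological_space set \<Rightarrow> real) \<Rightarrow> 'a measure" where
  "positive_part \<mu> =
     measure_of UNIV (sets borel) (\<lambda>A. SUP B\<in>{B \<in> sets borel. B \<subseteq> A}. ennreal (\<mu> B))"

definition pairing :: "('a::topological_space \<Rightarrow> real) \<Rightarrow> ('a set \<Rightarrow> real) \<Rightarrow> real" where
  "pairing f \<mu> =
     integral\<^sup>L (positive_part \<mu>) f - integral\<^sup>L (positive_part (\<lambda>A. - \<mu> A)) f"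

definition C0 :: "('a::real_normed_vector \<Rightarrow> real) set" where
  "C0 = {f. continuous_on UNIV f \<and> (f \<longlongrightarrow> 0) at_infinity}"

text \<open>The coarsest topology for which all pairings with functions in \<^const>\<open>C0\<close> are continuous.\<close>

definition weak_star :: "('a::real_normed_vector set \<Rightarrow> real) topology" where
  "weak_star = pullback_topology signed_measures (\<lambda>\<mu>. \<lambda>f\<in>C0. pairing f \<mu>)
     (product_topology (\<lambda>_. euclideanreal) C0)"


section \<open>Configurations of point vortices\<close>

definition vortex_config :: "nat \<Rightarrow> (nat \<Rightarrow> real) \<Rightarrow> (nat \<Rightarrow> real^2) \<Rightarrow> (real^2) set \<Rightarrow> real" where
  "vortex_config N \<xi> z = (\<lambda>A. \<Sum>j=1..N. \<xi> j * dirac (z j) A)"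

definition configs_N :: "nat \<Rightarrow> ((real^2) set \<Rightarrow> real) set" where
  "configs_N N = {vortex_config N \<xi> z | \<xi> z. (\<forall>j\<in>{1..N}. \<xi> j \<noteq> 0) \<and> inj_on z {1..N}}"

definition configs :: "((real^2) set \<Rightarrow> real) set" where
  "configs = (\<Union>N. configs_N N)"

text \<open>
  The measure \<open>\<gamma> \<diamond> \<gamma>\<close>, written in terms of the atoms of \<open>\<gamma>\<close> so as not to depend on the
  labelling of the vortices; see \<open>diamond_vortex_config\<close> below for the formula with labels.
\<close>

definition diamond :: "((real^2) set \<Rightarrow> real) \<Rightarrow> ((real^2) \<times> (real^2)) set \<Rightarrow> real" where
  "diamond \<gamma> = (\<lambda>A. \<Sum>(x, y) | \<gamma> {x} \<noteq> 0 \<and> \<gamma> {y} \<noteq> 0 \<and> x \<noteq> y. \<gamma> {x} * \<gamma> {y} * dirac (x, y) A)"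


section \<open>Point vortices solutions of Euler's equations\<close>

definition partial :: "2 \<Rightarrow> (real^2 \<Rightarrow> real) \<Rightarrow> real^2 \<Rightarrow> real" where
  "partial i f x = frechet_derivative f (at x) (axis i 1)"

definition gradient :: "(real^2 \<Rightarrow> real) \<Rightarrow> real^2 \<Rightarrow> real^2" where
  "gradient f x = (\<chi> i. partial i f x)"

primrec Ck :: "nat \<Rightarrow> (real^2 \<Rightarrow> real) \<Rightarrow> bool" where
  "Ck 0 f \<longleftrightarrow> continuous_on UNIV f"
| "Ck (Suc k) f \<longleftrightarrow> (\<forall>x. f differentiable (at x)) \<and> (\<forall>i. Ck k (partial i f))"

definition test_functions :: "(real^2 \<Rightarrow> real) set" where
  "test_functions = {\<phi>. (\<forall>k. Ck k \<phi>) \<and> compact (closure {x. \<phi> x \<noteq> 0})}"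

definition perp :: "real^2 \<Rightarrow> real^2" where
  "perp x = vector [- (x $ 2), x $ 1]"

definition biot_savart :: "real^2 \<Rightarrow> real^2" where
  "biot_savart x = (1 / (2 * pi)) *\<^sub>R (perp x /\<^sub>R (norm x)\<^sup>2)"

text \<open>On the diagonal, which \<^const>\<open>diamond\<close> never charges, this takes the value 0.\<close>

definition H_fun :: "(real^2 \<Rightarrow> real) \<Rightarrow> (real^2) \<times> (real^2) \<Rightarrow> real" where
  "H_fun \<phi> = (\<lambda>(x, y). 1/2 * ((gradient \<phi> x - gradient \<phi> y) \<bullet> biot_savart (x - y)))"

text \<open>
  Lebesgue integrability of the right-hand side has to be stated, as the library integral of a
  non-integrable function is 0. For \<open>t < 0\<close> the interval integral is the oriented one.
\<close>

definition point_vortices_solution :: "real set \<Rightarrow> (real \<Rightarrow> (real^2) set \<Rightarrow> real) \<Rightarrow> bool" where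
  "point_vortices_solution I \<omega> \<longleftrightarrow>
     open I \<and> is_interval I \<and> 0 \<in> I \<and>
     continuous_map (top_of_set I) (subtopology weak_star configs) \<omega> \<and>
     (\<forall>\<phi>\<in>test_functions. \<forall>t\<in>I.
        interval_lebesgue_integrable lborel (ereal 0) (ereal t) (\<lambda>s. pairing (H_fun \<phi>) (diamond (\<omega> s))) \<and>
        pairing \<phi> (\<omega> t) - pairing \<phi> (\<omega> 0)
          = (LBINT s=ereal 0..ereal t. pairing (H_fun \<phi>) (diamond (\<omega> s))))"


section \<open>Consistency of the definitions\<close>

lemma dirac_signed_measure: "dirac z \<in> signed_measures"
proof -
  have "(\<lambda>n::nat. dirac z (A n)) sums dirac z (\<Union>n. A n)"
    if A: "range A \<subseteq> sets borel" "disjoint_family A" for A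
  proof (cases "z \<in> (\<Union>n. A n)")
    case True
    then obtain m where m: "z \<in> A m" by auto
    have "z \<notin> A n" if "n \<noteq> m" for n
      using A(2) m that by (auto simp: disjoint_family_on_def)
    hence "(\<lambda>n. dirac z (A n)) = (\<lambda>n. if n = m then 1 else 0)"
      using A(1) m by (auto simp: dirac_def fun_eq_iff)
    moreover have "dirac z (\<Union>n. A n) = 1"
      using A(1) True by (auto simp: dirac_def)
    ultimately show ?thesis using sums_single[of m "\<lambda>_. 1::real"] by simp
  next
    case False
    hence "(\<lambda>n. dirac z (A n)) = (\<lambda>n. 0)" "dirac z (\<Union>n. A n) = 0"
      by (auto simp: dirac_def fun_eq_iff)
    thus ?thesis by simp
  qed
  thus ?thesis by (auto simp: signed_measures_def dirac_def)
qed

lemma sum_dirac_signed_measure: "(\<lambda>A. \<Sum>j\<in>S. c j * dirac (z j) A) \<in> signed_measures"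
proof -
  have "(\<lambda>n::nat. \<Sum>j\<in>S. c j * dirac (z j) (A n)) sums (\<Sum>j\<in>S. c j * dirac (z j) (\<Union>n. A n))"
    if "range A \<subseteq> sets borel" "disjoint_family A" for A
  proof (intro sums_sum sums_mult)
    fix j
    show "(\<lambda>n. dirac (z j) (A n)) sums dirac (z j) (\<Union>n. A n)"
      using dirac_signed_measure[of "z j"] that unfolding signed_measures_def by blast
  qed
  moreover have "(\<Sum>j\<in>S. c j * dirac (z j) A) = 0" if "A \<notin> sets borel" for A
    using that by (simp add: dirac_def)
  ultimately show ?thesis unfolding signed_measures_def by blast
qed

lemma configs_subset_signed_measures: "configs \<subseteq> signed_measures"
  by (auto simp: configs_def configs_N_def vortex_config_def sum_dirac_signed_measure)

lemma sets_positive_part [simp]: "sets (positive_part \<mu>) = sets borel"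
  using sets.sigma_sets_eq[of borel] by (simp add: positive_part_def sets_measure_of_conv)

lemma emeasure_positive_part_sum_dirac:
  fixes z :: "'b \<Rightarrow> 'a::t1_space"
  assumes S: "finite S" "inj_on z S" and A: "A \<in> sets borel"
  shows "emeasure (positive_part (\<lambda>A. \<Sum>j\<in>S. c j * dirac (z j) A)) A
    = (\<Sum>j\<in>S. ennreal (c j) * indicator A (z j))"
proof -
  let ?\<mu> = "\<lambda>A. \<Sum>j\<in>S. c j * dirac (z j) A"
  let ?F = "\<lambda>A. \<Sum>j\<in>S. ennreal (c j) * indicator A (z j)"
  let ?G = "\<lambda>A. SUP B\<in>{B \<in> sets borel. B \<subseteq> A}. ennreal (?\<mu> B)"
  have G: "?G A = ?F A" if A: "A \<in> sets borel" for A
  proof (rule antisym)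
    show "?G A \<le> ?F A"
    proof (rule SUP_least)
      fix B assume "B \<in> {B \<in> sets borel. B \<subseteq> A}"
      hence B: "B \<in> sets borel" "B \<subseteq> A" by auto
      have "ennreal (?\<mu> B) \<le> ennreal (\<Sum>j\<in>S. max 0 (c j) * indicator A (z j))"
        using B by (intro ennreal_leI sum_mono) (auto simp: dirac_def indicator_def)
      also have "\<dots> = (\<Sum>j\<in>S. ennreal (max 0 (c j) * indicator A (z j)))"
        by (simp add: sum_ennreal)
      also have "\<dots> = ?F A"
        by (intro sum.cong) (auto simp: indicator_def max_def ennreal_neg)
      finally show "ennreal (?\<mu> B) \<le> ?F A" .
    qed
  next
    define P where "P = {j \<in> S. c j > 0 \<and> z j \<in> A}"
    have P: "finite (z ` P)" using S by (auto simp: P_def)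
    hence borel: "z ` P \<in> sets borel"
      by (intro borel_closed finite_imp_closed)
    have "?F A = (\<Sum>j\<in>S. ennreal (max 0 (c j) * indicator A (z j)))"
      by (intro sum.cong) (auto simp: indicator_def max_def ennreal_neg)
    also have "\<dots> = ennreal (\<Sum>j\<in>S. max 0 (c j) * indicator A (z j))"
      by (simp add: sum_ennreal)
    also have "(\<Sum>j\<in>S. max 0 (c j) * indicator A (z j)) = ?\<mu> (z ` P)"
    proof (intro sum.cong refl)
      fix j assume j: "j \<in> S"
      have "z j \<in> z ` P \<longleftrightarrow> j \<in> P"
        using S(2) j by (auto simp: P_def inj_on_def)
      thus "max 0 (c j) * indicator A (z j) = c j * dirac (z j) (z ` P)"
        using borel j by (auto simp: dirac_def indicator_def P_def max_def)
    qed
    also have "ennreal (?\<mu> (z ` P)) \<le> ?G A"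
      using borel by (intro SUP_upper) (auto simp: P_def)
    finally show "?F A \<le> ?G A" .
  qed
  show ?thesis
  proof (subst emeasure_measure_of[OF positive_part_def])
    show "positive (sets (positive_part ?\<mu>)) ?G"
      using G[of "{}"] by (simp add: positive_def)
    show "countably_additive (sets (positive_part ?\<mu>)) ?G"
      unfolding countably_additive_def sets_positive_part
    proof (intro allI impI)
      fix B :: "nat \<Rightarrow> 'a set"
      assume B: "range B \<subseteq> sets borel" "disjoint_family B" "(\<Union>i. B i) \<in> sets borel"
      have "(\<Sum>i. ?G (B i)) = (\<Sum>i. ?F (B i))"
        using B(1) by (intro suminf_cong G) auto
      also have "\<dots> = (\<Sum>j\<in>S. \<Sum>i. ennreal (c j) * indicator (B i) (z j))"
        by (rule suminf_sum) auto
      also have "\<dots> = ?F (\<Union>i. B i)"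
        using B(2) by (simp add: suminf_indicator)
      also have "\<dots> = ?G (\<Union>i. B i)" using G[OF B(3)] by simp
      finally show "(\<Sum>i. ?G (B i)) = ?G (\<Union>i. B i)" .
    qed
    show "A \<in> sets (positive_part ?\<mu>)" using A by simp
  qed (use G[OF A] in auto)
qed

lemma integral_positive_part_sum_dirac:
  fixes z :: "'b \<Rightarrow> 'a::t1_space"
  assumes S: "finite S" "inj_on z S" and f: "f \<in> borel_measurable borel"
  shows "integral\<^sup>L (positive_part (\<lambda>A. \<Sum>j\<in>S. c j * dirac (z j) A)) f
    = (\<Sum>j\<in>S. max 0 (c j) * f (z j))"
proof -
  let ?M = "point_measure S (\<lambda>j. ennreal (max 0 (c j)))"
  have z: "z \<in> measurable ?M borel"
    by (simp add: measurable_point_measure_eq1)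
  have "positive_part (\<lambda>A. \<Sum>j\<in>S. c j * dirac (z j) A) = distr ?M borel z"
  proof (rule measure_eqI)
    fix A assume "A \<in> sets (positive_part (\<lambda>A. \<Sum>j\<in>S. c j * dirac (z j) A))"
    hence A: "A \<in> sets borel" by simp
    have "emeasure (distr ?M borel z) A = emeasure ?M (z -` A \<inter> S)"
      by (simp add: emeasure_distr[OF z A] space_point_measure)
    also have "\<dots> = (\<Sum>j\<in>z -` A \<inter> S. ennreal (max 0 (c j)))"
      using S by (intro emeasure_point_measure_finite) auto
    also have "\<dots> = (\<Sum>j\<in>S. ennreal (c j) * indicator A (z j))"
      using S by (intro sum.mono_neutral_cong_left)
        (auto simp: max_def ennreal_neg split: split_indicator_asm)
    finally show "emeasure (positive_part (\<lambda>A. \<Sum>j\<in>S. c j * dirac (z j) A)) A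
        = emeasure (distr ?M borel z) A"
      using emeasure_positive_part_sum_dirac[OF S A] by simp
  qed simp
  thus ?thesis
    using S f by (simp add: integral_distr[OF z] lebesgue_integral_point_measure_finite)
qed

lemma pairing_sum_dirac:
  fixes z :: "'b \<Rightarrow> 'a::t1_space"
  assumes S: "finite S" "inj_on z S" and f: "f \<in> borel_measurable borel"
  shows "pairing f (\<lambda>A. \<Sum>j\<in>S. c j * dirac (z j) A) = (\<Sum>j\<in>S. c j * f (z j))"
proof -
  have "(\<lambda>A. - (\<Sum>j\<in>S. c j * dirac (z j) A)) = (\<lambda>A. \<Sum>j\<in>S. - c j * dirac (z j) A)"
    by (simp add: sum_negf)
  hence "pairing f (\<lambda>A. \<Sum>j\<in>S. c j * dirac (z j) A)
      = (\<Sum>j\<in>S. max 0 (c j) * f (z j)) - (\<Sum>j\<in>S. max 0 (- c j) * f (z j))"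
    by (simp only: pairing_def integral_positive_part_sum_dirac[OF S f])
  also have "\<dots> = (\<Sum>j\<in>S. c j * f (z j))"
    unfolding sum_subtractf[symmetric] by (intro sum.cong) (auto simp: max_def)
  finally show ?thesis .
qed

lemma vortex_config_singleton:
  "vortex_config N \<xi> z {x} = (\<Sum>j | j \<in> {1..N} \<and> z j = x. \<xi> j)"
proof -
  have "{x} \<in> sets borel" by simp
  hence "vortex_config N \<xi> z {x} = (\<Sum>j\<in>{1..N}. if z j = x then \<xi> j else 0)"
    unfolding vortex_config_def dirac_def by (intro sum.cong) (simp_all add: indicator_def)
  also have "\<dots> = (\<Sum>j | j \<in> {1..N} \<and> z j = x. \<xi> j)"
    by (simp only: sum.inter_filter[OF finite_atLeastAtMost])
  finally show ?thesis .
qed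

lemma diamond_vortex_config:
  assumes \<xi>: "\<forall>j\<in>{1..N}. \<xi> j \<noteq> 0" and z: "inj_on z {1..N}"
  shows "diamond (vortex_config N \<xi> z) =
    (\<lambda>A. \<Sum>(j, k) | j \<in> {1..N} \<and> k \<in> {1..N} \<and> j \<noteq> k. \<xi> j * \<xi> k * dirac (z j, z k) A)"
proof
  fix A
  let ?\<gamma> = "vortex_config N \<xi> z"
  let ?J = "{(j, k). j \<in> {1..N} \<and> k \<in> {1..N} \<and> j \<noteq> k}"
  have at: "?\<gamma> {z j} = \<xi> j" if "j \<in> {1..N}" for j
  proof -
    have "{i. i \<in> {1..N} \<and> z i = z j} = {j}"
      using inj_onD[OF z] that by blast
    thus ?thesis using vortex_config_singleton by simp
  qed
  have off: "x \<in> z ` {1..N}" if "?\<gamma> {x} \<noteq> 0" for x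
  proof (rule ccontr)
    assume "x \<notin> z ` {1..N}"
    hence "{i. i \<in> {1..N} \<and> z i = x} = {}" by blast
    hence "?\<gamma> {x} = 0" unfolding vortex_config_singleton by (simp only: sum.empty)
    thus False using that by simp
  qed
  have bij: "bij_betw (\<lambda>(j, k). (z j, z k)) ?J {(x, y). ?\<gamma> {x} \<noteq> 0 \<and> ?\<gamma> {y} \<noteq> 0 \<and> x \<noteq> y}"
    unfolding bij_betw_def
  proof
    show "inj_on (\<lambda>(j, k). (z j, z k)) ?J"
    proof (rule inj_onI)
      fix p q assume "p \<in> ?J" "q \<in> ?J" "(\<lambda>(j, k). (z j, z k)) p = (\<lambda>(j, k). (z j, z k)) q"
      thus "p = q"
        using inj_onD[OF z, of "fst p" "fst q"] inj_onD[OF z, of "snd p" "snd q"]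
        by (simp add: case_prod_unfold prod_eq_iff)
    qed
    show "(\<lambda>(j, k). (z j, z k)) ` ?J = {(x, y). ?\<gamma> {x} \<noteq> 0 \<and> ?\<gamma> {y} \<noteq> 0 \<and> x \<noteq> y}"
    proof (intro equalityI subsetI)
      fix p assume "p \<in> (\<lambda>(j, k). (z j, z k)) ` ?J"
      then obtain j k where jk: "p = (z j, z k)" "j \<in> {1..N}" "k \<in> {1..N}" "j \<noteq> k"
        by (auto simp del: atLeastAtMost_iff)
      moreover have "z j \<noteq> z k" using inj_onD[OF z _ jk(2,3)] jk(4) by blast
      ultimately show "p \<in> {(x, y). ?\<gamma> {x} \<noteq> 0 \<and> ?\<gamma> {y} \<noteq> 0 \<and> x \<noteq> y}"
        using \<xi> at[OF jk(2)] at[OF jk(3)] by simp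
    next
      fix p assume p: "p \<in> {(x, y). ?\<gamma> {x} \<noteq> 0 \<and> ?\<gamma> {y} \<noteq> 0 \<and> x \<noteq> y}"
      then obtain x y where xy: "p = (x, y)" "?\<gamma> {x} \<noteq> 0" "?\<gamma> {y} \<noteq> 0" "x \<noteq> y" by auto
      obtain j k where "j \<in> {1..N}" "k \<in> {1..N}" "x = z j" "y = z k"
        using off[OF xy(2)] off[OF xy(3)] by blast
      with xy show "p \<in> (\<lambda>(j, k). (z j, z k)) ` ?J"
        by (intro image_eqI[of _ _ "(j, k)"]) auto
    qed
  qed
  have "diamond ?\<gamma> A = (\<Sum>(j, k)\<in>?J. ?\<gamma> {z j} * ?\<gamma> {z k} * dirac (z j, z k) A)"
    unfolding diamond_def
    using sum.reindex_bij_betw[OF bij, of "\<lambda>(x, y). ?\<gamma> {x} * ?\<gamma> {y} * dirac (x, y) A"]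
    by (simp add: case_prod_unfold)
  also have "\<dots> = (\<Sum>(j, k)\<in>?J. \<xi> j * \<xi> k * dirac (z j, z k) A)"
    by (intro sum.cong) (auto simp: at simp del: atLeastAtMost_iff)
  finally show "diamond ?\<gamma> A = (\<Sum>(j, k)\<in>?J. \<xi> j * \<xi> k * dirac (z j, z k) A)" .
qed

lemma continuous_map_weak_star_iff:
  fixes \<omega> :: "'b \<Rightarrow> (real^2) set \<Rightarrow> real"
  shows "continuous_map T (subtopology weak_star configs) \<omega> \<longleftrightarrow>
    (\<forall>t\<in>topspace T. \<omega> t \<in> configs) \<and>
    (\<forall>f\<in>C0. continuous_map T euclideanreal (\<lambda>t. pairing f (\<omega> t)))"
    (is "?L \<longleftrightarrow> ?R")
proof
  let ?p = "\<lambda>\<mu>::(real^2) set \<Rightarrow> real. \<lambda>f\<in>C0. pairing f \<mu>"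
  {
    assume ?L
    hence c: "continuous_map T weak_star \<omega>" and G: "\<forall>t\<in>topspace T. \<omega> t \<in> configs"
      by (auto simp: continuous_map_in_subtopology)
    have "continuous_map T (product_topology (\<lambda>_. euclideanreal) C0) (?p \<circ> \<omega>)"
      by (rule continuous_map_compose[OF c])
         (use continuous_map_pullback[OF continuous_map_id, where A = signed_measures and f = ?p]
           in \<open>simp add: weak_star_def\<close>)
    hence "continuous_map T euclideanreal (\<lambda>t. ?p (\<omega> t) f)" if "f \<in> C0" for f
      using that by (auto simp: continuous_map_componentwise o_def)
    with G show ?R by auto
  next
    assume R: ?R
    have "continuous_map T (product_topology (\<lambda>_. euclideanreal) C0) (?p \<circ> \<omega>)"
      using R by (auto simp: continuous_map_componentwise o_def)
    hence "continuous_map T weak_star \<omega>"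
      unfolding weak_star_def
      by (rule continuous_map_pullback') (use R configs_subset_signed_measures in auto)
    thus ?L using R by (auto simp: continuous_map_in_subtopology)
  }
qed

end

theory Submission
  imports Defs
begin

text \<open>
  Starting from a configuration of \<open>N\<close> vortices, solve the vortex equations up to the first time at which
  the smallest distance between vortices degenerates. As \<open>H\<^sub>\<phi>\<close> is bounded, \<open>\<langle>\<phi>, \<omega>\<^sub>t\<rangle>\<close> is Lipschitz in time, so
  the configurations converge weakly* at that time, to a configuration in which some vortices have merged,
  cancelled or been lost at infinity. The number of vortices has dropped, so finitely many restarts give a
  solution for all positive times; replacing \<open>\<omega>\<^sub>t\<close> by \<open>- \<omega>\<^bsub>-t\<^esub>\<close> gives negative times.

  Non-uniqueness comes from bursts. A vortex of intensity \<open>3k\<close> may split into vortices of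
  intensities \<open>2k, 2k, -k\<close>: since \<open>(2k)(2k) + 2 (2k)(-k) = 0\<close>, these have an expanding self-similar motion of
  size \<open>\<surd>t\<close> starting from a point. In the presence of other vortices this motion is perturbed. In
  the time variable \<open>s = ln t\<close> the perturbation decays as \<open>s \<rightarrow> -\<infinity>\<close> like \<open>exp (s/2)\<close>, while the linearisation at the
  self-similar motion only has the eigenvalues \<open>0\<close> and \<open>-1\<close>, so a contraction argument gives a true motion
  asymptotic to the self-similar one. A burst may be inserted at any time of a regular motion, and different
  burst times give different solutions.
\<close>


section \<open>Bounded solutions of relaxation equations\<close>

text \<open>Two vortices keep their distance, so a vortex cannot burst into two. Conservation of
  energy forces the sum of the products of the intensities to vanish in an expanding self-similar
  motion, and three is the first number for which this is possible. In the variable s an external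
  velocity acquires the factor exp s; relative to the triple, whose size is proportional to exp
  (s/2), it counts as exp (s/2). Decay at this rate singles out one solution: for lam \<le> 0 the
  equation w' = lam w + O(exp (s/2)) is solved by integrating from minus infinity, and the
  homogeneous solutions exp (lam s) do not decay there. So the eigenvalues 0 and -1 leave no
  constant to be adjusted. The same fixed point lemma yields the ordinary motion between collisions,
  with the initial data placed at minus infinity. What tells the solutions apart is intrinsic: a
  measure determines its number of vortices, and this number jumps from N to N + 2 right after the
  burst time.\<close>

text \<open>
  The bounded solution of \<open>h' = g - \<mu> h\<close>: the integral of \<open>exp (\<mu> (r - s)) g r\<close> over \<open>r < s\<close>,
  turned into an integral over a bounded interval by \<open>q = exp (\<mu> r)\<close>.
\<close>

definition relax :: "real \<Rightarrow> (real \<Rightarrow> complex) \<Rightarrow> real \<Rightarrow> complex" where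
  "relax \<mu> g s = exp (- \<mu> * s) *\<^sub>R (integral {0..exp (\<mu> * s)} (\<lambda>q. g (ln q / \<mu>)) /\<^sub>R \<mu>)"

context
  fixes \<mu> M :: real and g :: "real \<Rightarrow> complex"
  assumes \<mu>: "\<mu> > 0" and g: "continuous_on UNIV g" and M: "\<And>s. norm (g s) \<le> M"
begin

text \<open>The integrand is bounded, but continuous only for q > 0: at q = 0 the logarithm has a
  default value unrelated to any limit. The left endpoint is dropped as a null set.\<close>

lemma relax_integrable: "(\<lambda>q. g (ln q / \<mu>)) integrable_on {a..b}" if "0 \<le> a"
proof -
  have "(\<lambda>q. g (ln q / \<mu>)) integrable_on {a<..b}"
  proof (rule measurable_bounded_by_integrable_imp_integrable)
    have "continuous_on {a<..b} (\<lambda>q. g (ln q / \<mu>))"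
      using that \<mu> by (intro continuous_on_compose2[OF g] continuous_intros) auto
    thus "(\<lambda>q. g (ln q / \<mu>)) \<in> borel_measurable (lebesgue_on {a<..b})"
      by (rule continuous_imp_measurable_on_sets_lebesgue) auto
    show "(\<lambda>_. M) integrable_on {a<..b}"
      by (rule integrable_spike_set[OF integrable_const_ivl[of M a b]])
         (auto intro: negligible_subset[of "{a}"])
  qed (use M in auto)
  thus ?thesis
    by (rule integrable_spike_set) (auto intro: negligible_subset[of "{a}"])
qed

lemma relax_norm_le: "norm (relax \<mu> g s) \<le> M / \<mu>"
proof -
  have "norm (integral {0..exp (\<mu> * s)} (\<lambda>q. g (ln q / \<mu>))) \<le> integral {0..exp (\<mu> * s)} (\<lambda>q. M)"
    using M relax_integrable by (intro integral_norm_bound_integral) auto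
  hence *: "norm (integral {0..exp (\<mu> * s)} (\<lambda>q. g (ln q / \<mu>))) \<le> exp (\<mu> * s) * M"
    by simp
  have "norm (relax \<mu> g s) \<le> exp (- \<mu> * s) * ((exp (\<mu> * s) * M) / \<mu>)"
    unfolding relax_def using * \<mu> by (simp add: field_simps)
  also have "\<dots> = M / \<mu>" by (simp add: exp_minus field_simps)
  finally show ?thesis .
qed

lemma relax_has_vector_derivative:
  "(relax \<mu> g has_vector_derivative g s - \<mu> *\<^sub>R relax \<mu> g s) (at s)"
proof -
  define K where "K x = integral {0..x} (\<lambda>q. g (ln q / \<mu>))" for x
  have K: "(K has_vector_derivative g (ln x / \<mu>)) (at x)" if "x > 0" for x
  proof -
    \<comment> \<open>Continuity may fail at q = 0, so the fundamental theorem is applied from x/2,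
      and the integral over {0..x/2} enters as a constant.\<close>
    have "continuous_on {x/2..x+1} (\<lambda>q. g (ln q / \<mu>))"
      using that \<mu> by (intro continuous_on_compose2[OF g] continuous_intros) auto
    hence "((\<lambda>u. integral {x/2..u} (\<lambda>q. g (ln q / \<mu>))) has_vector_derivative g (ln x / \<mu>)) (at x within {x/2..x+1})"
      using that by (intro integral_has_vector_derivative) auto
    moreover have "at x within {x/2..x+1} = at x"
      using that by (intro at_within_interior) (auto simp: interior_atLeastAtMost_real)
    ultimately have der: "((\<lambda>u. K (x/2) + integral {x/2..u} (\<lambda>q. g (ln q / \<mu>))) has_vector_derivative 0 + g (ln x / \<mu>)) (at x)"
      by (intro derivative_intros) auto
    have eq: "K (x/2) + integral {x/2..u} (\<lambda>q. g (ln q / \<mu>)) = K u" if "u \<in> {x/2<..}" for u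
      unfolding K_def using that \<open>x > 0\<close> by (intro Henstock_Kurzweil_Integration.integral_combine relax_integrable) auto
    have "(K has_vector_derivative 0 + g (ln x / \<mu>)) (at x)"
      by (rule has_vector_derivative_transform_within_open[OF der, where S = "{x/2<..}"]) (use that eq in auto)
    thus ?thesis by simp
  qed
  have e: "((\<lambda>s. exp (\<mu> * s)) has_vector_derivative \<mu> * exp (\<mu> * s)) (at s)"
    by (auto intro!: derivative_eq_intros simp: has_real_derivative_iff_has_vector_derivative[symmetric])
  have "((K \<circ> (\<lambda>s. exp (\<mu> * s))) has_vector_derivative (\<mu> * exp (\<mu> * s)) *\<^sub>R g (ln (exp (\<mu> * s)) / \<mu>)) (at s)"
    by (rule vector_diff_chain_at[OF e K]) simp
  hence 1: "((\<lambda>s. K (exp (\<mu> * s)) /\<^sub>R \<mu>) has_vector_derivative ((\<mu> * exp (\<mu> * s)) *\<^sub>R g s) /\<^sub>R \<mu>) (at s)"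
    using \<mu> by (auto simp: o_def intro!: derivative_eq_intros)
  have 2: "((\<lambda>s. exp (- \<mu> * s)) has_vector_derivative - \<mu> * exp (- \<mu> * s)) (at s)"
    by (auto intro!: derivative_eq_intros simp: has_real_derivative_iff_has_vector_derivative[symmetric])
  have "((\<lambda>s. exp (- \<mu> * s) *\<^sub>R (K (exp (\<mu> * s)) /\<^sub>R \<mu>)) has_vector_derivative
      exp (- \<mu> * s) *\<^sub>R (((\<mu> * exp (\<mu> * s)) *\<^sub>R g s) /\<^sub>R \<mu>) + (- \<mu> * exp (- \<mu> * s)) *\<^sub>R (K (exp (\<mu> * s)) /\<^sub>R \<mu>)) (at s)"
    by (rule has_vector_derivative_scaleR[OF _ 1]) (use 2 in \<open>simp add: has_real_derivative_iff_has_vector_derivative\<close>)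
  moreover have "exp (- \<mu> * s) *\<^sub>R (((\<mu> * exp (\<mu> * s)) *\<^sub>R g s) /\<^sub>R \<mu>) = g s"
    using \<mu> by (simp add: exp_minus field_simps)
  moreover have "relax \<mu> g = (\<lambda>s. exp (- \<mu> * s) *\<^sub>R (K (exp (\<mu> * s)) /\<^sub>R \<mu>))"
    by (simp add: relax_def K_def fun_eq_iff)
  ultimately show ?thesis by (simp add: mult.assoc)
qed

lemma relax_continuous: "continuous_on UNIV (relax \<mu> g)"
  using relax_has_vector_derivative has_vector_derivative_continuous
  by (metis continuous_at_imp_continuous_on)

end

lemma relax_diff:
  assumes \<mu>: "\<mu> > 0"
    and g: "continuous_on UNIV g" "\<And>s. norm (g s) \<le> M"
    and h: "continuous_on UNIV h" "\<And>s. norm (h s) \<le> M"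
  shows "relax \<mu> (\<lambda>s. g s - h s) s = relax \<mu> g s - relax \<mu> h s"
  using relax_integrable[OF \<mu> g] relax_integrable[OF \<mu> h]
  by (simp add: relax_def Henstock_Kurzweil_Integration.integral_diff scaleR_diff_right)

text \<open>The slices {j} x UNIV are open. This turns a family of continuous functions of time,
  without any uniformity in j, into one continuous function.\<close>

lemma continuous_on_discrete_Times:
  fixes f :: "nat \<times> 'a::topological_space \<Rightarrow> 'b::topological_space"
  assumes "\<And>j. continuous_on UNIV (\<lambda>s. f (j, s))"
  shows "continuous_on UNIV f"
proof -
  have "continuous_on (\<Union>j. {j} \<times> UNIV) f"
  proof (rule continuous_on_open_UN)
    fix j :: nat
    show "open ({j} \<times> (UNIV :: 'a set))" by (intro open_Times open_discrete open_UNIV)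
    have "continuous_on ({j} \<times> UNIV) (\<lambda>p. f (j, snd p))"
      by (rule continuous_on_compose2[OF assms]) (auto intro: continuous_intros)
    thus "continuous_on ({j} \<times> UNIV) f"
      by (rule continuous_on_eq) auto
  qed
  moreover have "(\<Union>j. {j} \<times> UNIV) = (UNIV :: (nat \<times> 'a) set)" by auto
  ultimately show ?thesis by simp
qed

lemma complete_UNIV_bcontfun:
  "complete (UNIV :: ('a::topological_space \<Rightarrow>\<^sub>C 'b::complete_space) set)"
  unfolding complete_def
proof safe
  fix f :: "nat \<Rightarrow> 'a \<Rightarrow>\<^sub>C 'b"
  assume "Cauchy f"
  hence "uniformly_Cauchy_on UNIV (\<lambda>n. apply_bcontfun (f n))"
    unfolding Cauchy_def uniformly_Cauchy_on_def by (metis dist_fun_lt_imp_dist_val_lt)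
  then obtain g where "uniform_limit UNIV (\<lambda>n. apply_bcontfun (f n)) g sequentially"
    using Cauchy_uniformly_convergent uniformly_convergent_on_def by blast
  from uniform_limit_bcontfunE[OF this sequentially_bot]
  show "\<exists>l\<in>UNIV. f \<longlonglongrightarrow> l" by (metis UNIV_I)
qed

text \<open>
  The unknowns form one bounded continuous function on \<open>nat \<times> real\<close>, so that their number need not be
  the cardinality of a type.
\<close>

lemma relaxation_ode:
  fixes G :: "real \<Rightarrow> (nat \<Rightarrow> complex) \<Rightarrow> nat \<Rightarrow> complex" and \<mu> :: "nat \<Rightarrow> real"
  assumes R: "R \<ge> 0" and L: "0 \<le> L" "L < m" and bound: "B + L * R \<le> m * R"
    and \<mu>: "\<And>j. j \<in> J \<Longrightarrow> m \<le> \<mu> j"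
    and cont: "\<And>V j. (\<And>i. i \<in> J \<Longrightarrow> continuous_on UNIV (V i)) \<Longrightarrow> (\<And>i s. i \<in> J \<Longrightarrow> norm (V i s) \<le> R) \<Longrightarrow>
      j \<in> J \<Longrightarrow> continuous_on UNIV (\<lambda>s. G s (\<lambda>i. V i s) j)"
    and lip: "\<And>s u v j \<delta>. (\<And>i. i \<in> J \<Longrightarrow> norm (u i) \<le> R) \<Longrightarrow> (\<And>i. i \<in> J \<Longrightarrow> norm (v i) \<le> R) \<Longrightarrow>
      (\<And>i. i \<in> J \<Longrightarrow> norm (u i - v i) \<le> \<delta>) \<Longrightarrow> j \<in> J \<Longrightarrow> norm (G s u j - G s v j) \<le> L * \<delta>"
    and zero: "\<And>s j. j \<in> J \<Longrightarrow> norm (G s (\<lambda>_. 0) j) \<le> B"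
  shows "\<exists>V. \<forall>j\<in>J. \<forall>s. norm (V j s) \<le> R \<and>
    (V j has_vector_derivative G s (\<lambda>i. V i s) j - \<mu> j *\<^sub>R V j s) (at s)"
proof -
  have m: "m > 0" using L by simp
  let ?X = "cball 0 R :: ((nat \<times> real) \<Rightarrow>\<^sub>C complex) set"
  define g where "g W j s = G s (\<lambda>i. apply_bcontfun W (i, s)) j" for W :: "(nat \<times> real) \<Rightarrow>\<^sub>C complex" and j s
  \<comment> \<open>Each component solves its relaxation equation with the right-hand side frozen at
    \<open>W\<close>; components outside \<open>J\<close> are set to 0.\<close>
  define T0 where "T0 W = (\<lambda>(j, s). if j \<in> J then relax (\<mu> j) (g W j) s else 0)" for W
  have W: "norm (apply_bcontfun W p) \<le> R" if "W \<in> ?X" for W p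
    using norm_bounded[of W p] that by (auto simp: dist_norm)
  \<comment> \<open>The hypothesis B + L * R \<le> m * R keeps the ball of radius R invariant,
    because \<open>relax\<close> divides by at least m.\<close>
  have gb: "norm (g W j s) \<le> m * R" if "W \<in> ?X" "j \<in> J" for W j s
  proof -
    have "norm (G s (\<lambda>i. apply_bcontfun W (i, s)) j - G s (\<lambda>_. 0) j) \<le> L * R"
      using that W R by (intro lip) auto
    moreover have "norm (G s (\<lambda>_. 0) j) \<le> B" using zero that by auto
    ultimately have "norm (G s (\<lambda>i. apply_bcontfun W (i, s)) j) \<le> B + L * R"
      by (smt (verit) norm_triangle_ineq2)
    thus ?thesis using bound by (simp add: g_def)
  qed
  have gc: "continuous_on UNIV (g W j)" if "W \<in> ?X" "j \<in> J" for W j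
    unfolding g_def
    by (rule cont) (use that W in \<open>auto intro!: continuous_on_compose2[OF continuous_on_apply_bcontfun[of UNIV W]] continuous_intros\<close>)
  have mu: "\<mu> j > 0" if "j \<in> J" for j using \<mu>[OF that] m by simp
  have le: "c / \<mu> j \<le> c / m" if "j \<in> J" "c \<ge> 0" for j c
    using \<mu>[OF that(1)] m that by (intro divide_left_mono) auto
  have T0b: "norm (T0 W p) \<le> R" if "W \<in> ?X" for W p
  proof -
    obtain j s where p: "p = (j, s)" by force
    show ?thesis
    proof (cases "j \<in> J")
      case True
      have "norm (relax (\<mu> j) (g W j) s) \<le> m * R / \<mu> j"
        using True that by (intro relax_norm_le mu gb gc) auto
      also have "\<dots> \<le> m * R / m" using True R m by (intro le) auto
      finally show ?thesis using True m by (simp add: p T0_def)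
    qed (use R in \<open>auto simp: p T0_def\<close>)
  qed
  have T0c: "T0 W \<in> bcontfun" if "W \<in> ?X" for W
  proof -
    have "continuous_on UNIV (T0 W)"
    proof (rule continuous_on_discrete_Times)
      fix j
      show "continuous_on UNIV (\<lambda>s. T0 W (j, s))"
        using relax_continuous[OF mu gc gb] that by (cases "j \<in> J") (auto simp: T0_def)
    qed
    moreover have "bounded (range (T0 W))"
      using T0b[OF that] by (auto simp: bounded_iff)
    ultimately show ?thesis by (simp add: bcontfun_def)
  qed
  define T where "T W = Bcontfun (T0 W)" for W
  have T: "apply_bcontfun (T W) = T0 W" if "W \<in> ?X" for W
    using T0c[OF that] by (simp add: T_def Bcontfun_inverse)
  have "\<exists>!W. W \<in> ?X \<and> T W = W"
  \<comment> \<open>L comes from the right-hand side, 1 / m from \<open>relax\<close>.\<close>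
  proof (rule Banach_fix[where c = "L / m"])
    show "complete ?X" by (rule complete_closed_subset[OF _ _ complete_UNIV_bcontfun]) auto
    show "?X \<noteq> {}" using R by simp
    show "0 \<le> L / m" "L / m < 1" using L m by auto
    show "T ` ?X \<subseteq> ?X"
    proof safe
      fix W assume "W \<in> ?X"
      hence "dist (T W) 0 \<le> R"
        by (intro dist_bound) (auto simp: T T0b)
      thus "T W \<in> ?X" by (simp add: dist_commute)
    qed
  next
    fix W W' assume W1: "W \<in> ?X" and W2: "W' \<in> ?X"
    have "dist (T0 W p) (T0 W' p) \<le> L / m * dist W W'" for p
    proof -
      obtain j s where p: "p = (j, s)" by force
      show ?thesis
      proof (cases "j \<in> J")
        case True
        have "norm (relax (\<mu> j) (\<lambda>s. g W j s - g W' j s) s) \<le> L * dist W W' / \<mu> j"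
        proof (rule relax_norm_le)
          show "continuous_on UNIV (\<lambda>s. g W j s - g W' j s)"
            using True W1 W2 by (intro continuous_intros gc) auto
          show "norm (g W j s - g W' j s) \<le> L * dist W W'" for s
            unfolding g_def using True W W1 W2 dist_bounded[of W _ W']
            by (intro lip) (auto simp: dist_norm)
        qed (use mu True in auto)
        also have "\<dots> \<le> L * dist W W' / m" using True L by (intro le) auto
        also have "relax (\<mu> j) (\<lambda>s. g W j s - g W' j s) s = relax (\<mu> j) (g W j) s - relax (\<mu> j) (g W' j) s"
          using True W1 W2 by (intro relax_diff[where M = "m * R"] mu gb gc) auto
        finally show ?thesis using True by (simp add: p T0_def dist_norm)
      qed (use L m in \<open>auto simp: p T0_def\<close>)
    qed
    thus "dist (T W) (T W') \<le> L / m * dist W W'"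
      using W1 W2 by (intro dist_bound) (simp add: T)
  qed
  then obtain W0 where W0: "W0 \<in> ?X" "T W0 = W0" by blast
  \<comment> \<open>A fixed point is an image under \<open>relax\<close>, and this is what makes it
    differentiable.\<close>
  have eq: "(\<lambda>s. apply_bcontfun W0 (j, s)) = relax (\<mu> j) (g W0 j)" if "j \<in> J" for j
  proof
    fix s
    have "apply_bcontfun W0 (j, s) = apply_bcontfun (T W0) (j, s)" by (simp add: W0)
    also have "\<dots> = relax (\<mu> j) (g W0 j) s" unfolding T[OF W0(1)] using that by (simp add: T0_def)
    finally show "apply_bcontfun W0 (j, s) = relax (\<mu> j) (g W0 j) s" .
  qed
  show ?thesis
  proof (intro exI[of _ "\<lambda>j s. apply_bcontfun W0 (j, s)"] ballI allI conjI)
    fix j s assume j: "j \<in> J"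
    show "norm (apply_bcontfun W0 (j, s)) \<le> R" using W W0 by blast
    have gj: "g W0 j = (\<lambda>s. G s (\<lambda>i. apply_bcontfun W0 (i, s)) j)" by (simp add: g_def fun_eq_iff)
    show "((\<lambda>s. apply_bcontfun W0 (j, s)) has_vector_derivative
        G s (\<lambda>i. apply_bcontfun W0 (i, s)) j - \<mu> j *\<^sub>R apply_bcontfun W0 (j, s)) (at s)"
      using relax_has_vector_derivative[OF mu gc gb, OF j W0(1) j W0(1) j, of s]
      unfolding eq[OF j] fun_cong[OF eq[OF j], symmetric, of s] by (simp add: gj)
  qed
qed

text \<open>The function \<open>c\<close> clamps the time to the interval \<open>I\<close> on which the equation is to be solved.\<close>

lemma weighted_ode:
  fixes F :: "real \<Rightarrow> (nat \<Rightarrow> complex) \<Rightarrow> nat \<Rightarrow> complex" and lam :: "nat \<Rightarrow> real"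
  assumes c: "continuous_on UNIV c" "\<And>s. s \<in> I \<Longrightarrow> c s = s"
    and R: "R \<ge> 0" and L: "0 \<le> L" "L < m" and bound: "B + L * R \<le> m * R"
    and lam: "\<And>j. j \<in> J \<Longrightarrow> m \<le> \<beta> - lam j"
    and cont: "\<And>u j. (\<And>i. i \<in> J \<Longrightarrow> continuous_on UNIV (u i)) \<Longrightarrow>
      (\<And>i s. i \<in> J \<Longrightarrow> norm (u i s) \<le> R * exp (\<beta> * c s)) \<Longrightarrow>
      j \<in> J \<Longrightarrow> continuous_on UNIV (\<lambda>s. F (c s) (\<lambda>i. u i s) j)"
    and lip: "\<And>s u v j \<delta>. (\<And>i. i \<in> J \<Longrightarrow> norm (u i) \<le> R * exp (\<beta> * c s)) \<Longrightarrow>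
      (\<And>i. i \<in> J \<Longrightarrow> norm (v i) \<le> R * exp (\<beta> * c s)) \<Longrightarrow>
      (\<And>i. i \<in> J \<Longrightarrow> norm (u i - v i) \<le> \<delta>) \<Longrightarrow> j \<in> J \<Longrightarrow>
      norm (F (c s) u j - F (c s) v j) \<le> L * \<delta>"
    and zero: "\<And>s j. j \<in> J \<Longrightarrow> norm (F (c s) (\<lambda>_. 0) j) \<le> B * exp (\<beta> * c s)"
  shows "\<exists>u. \<forall>j\<in>J. \<forall>s\<in>I. norm (u j s) \<le> R * exp (\<beta> * s) \<and>
    (u j has_vector_derivative lam j *\<^sub>R u j s + F s (\<lambda>i. u i s) j) (at s)"
proof -
  \<comment> \<open>The weight uses the clamped time: the hypotheses are available at
    \<open>c s\<close> for every real s.\<close>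
  define E where "E s = exp (\<beta> * c s)" for s
  have E: "E s > 0" for s by (simp add: E_def)
  \<comment> \<open>Substituting u = exp (\<beta> s) V turns the linear term lam u into the
    relaxation rate \<beta> - lam, which is at least m > 0.\<close>
  define G where "G s V j = F (c s) (\<lambda>i. E s *\<^sub>R V i) j /\<^sub>R E s" for s V j
  have "\<exists>V. \<forall>j\<in>J. \<forall>s. norm (V j s) \<le> R \<and>
    (V j has_vector_derivative G s (\<lambda>i. V i s) j - (\<beta> - lam j) *\<^sub>R V j s) (at s)"
  proof (rule relaxation_ode[OF R L bound lam])
    fix V :: "nat \<Rightarrow> real \<Rightarrow> complex" and j
    assume V: "\<And>i. i \<in> J \<Longrightarrow> continuous_on UNIV (V i)" "\<And>i s. i \<in> J \<Longrightarrow> norm (V i s) \<le> R" and j: "j \<in> J"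
    have "continuous_on UNIV E" unfolding E_def by (intro continuous_intros c)
    moreover have "continuous_on UNIV (\<lambda>s. F (c s) (\<lambda>i. (\<lambda>i s. E s *\<^sub>R V i s) i s) j)"
      using V j E
      by (intro cont) (auto intro!: continuous_intros \<open>continuous_on UNIV E\<close> simp: E_def[symmetric] mult.commute less_imp_le)
    ultimately show "continuous_on UNIV (\<lambda>s. G s (\<lambda>i. V i s) j)"
      unfolding G_def using E by (intro continuous_intros) (auto simp: less_imp_neq[symmetric])
  next
    fix s j \<delta> and u v :: "nat \<Rightarrow> complex"
    assume u: "\<And>i. i \<in> J \<Longrightarrow> norm (u i) \<le> R" and v: "\<And>i. i \<in> J \<Longrightarrow> norm (v i) \<le> R"
      and uv: "\<And>i. i \<in> J \<Longrightarrow> norm (u i - v i) \<le> \<delta>" and j: "j \<in> J"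
    have "norm (F (c s) (\<lambda>i. E s *\<^sub>R u i) j - F (c s) (\<lambda>i. E s *\<^sub>R v i) j) \<le> L * (E s * \<delta>)"
      using u v uv j E[of s]
      by (intro lip) (auto simp: E_def[symmetric] scaleR_diff_right[symmetric] mult.commute[of R])
    hence "norm (F (c s) (\<lambda>i. E s *\<^sub>R u i) j - F (c s) (\<lambda>i. E s *\<^sub>R v i) j) / E s \<le> L * (E s * \<delta>) / E s"
      by (rule divide_right_mono) (use E[of s] in simp)
    moreover have "norm (G s u j - G s v j) = norm (F (c s) (\<lambda>i. E s *\<^sub>R u i) j - F (c s) (\<lambda>i. E s *\<^sub>R v i) j) / E s"
      using E[of s] unfolding G_def scaleR_diff_right[symmetric] by (simp add: divide_inverse)
    ultimately show "norm (G s u j - G s v j) \<le> L * \<delta>"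
      using E[of s] by simp
  next
    fix s j assume "j \<in> J"
    from zero[OF this, of s] show "norm (G s (\<lambda>_. 0) j) \<le> B"
      using E[of s] by (simp add: G_def E_def[symmetric] field_simps)
  qed
  then obtain V where V: "\<And>j s. j \<in> J \<Longrightarrow> norm (V j s) \<le> R"
    "\<And>j s. j \<in> J \<Longrightarrow> (V j has_vector_derivative G s (\<lambda>i. V i s) j - (\<beta> - lam j) *\<^sub>R V j s) (at s)"
    by blast
  show ?thesis
  proof (intro exI[of _ "\<lambda>j s. exp (\<beta> * s) *\<^sub>R V j s"] ballI conjI)
    fix j s assume j: "j \<in> J" and s: "s \<in> I"
    show "norm (exp (\<beta> * s) *\<^sub>R V j s) \<le> R * exp (\<beta> * s)" using V(1)[OF j, of s] by simp
    have "((\<lambda>s. exp (\<beta> * s)) has_real_derivative \<beta> * exp (\<beta> * s)) (at s)"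
      by (auto intro!: derivative_eq_intros)
    from has_vector_derivative_scaleR[OF this V(2)[OF j]]
    have "((\<lambda>s. exp (\<beta> * s) *\<^sub>R V j s) has_vector_derivative
      exp (\<beta> * s) *\<^sub>R (G s (\<lambda>i. V i s) j - (\<beta> - lam j) *\<^sub>R V j s) + (\<beta> * exp (\<beta> * s)) *\<^sub>R V j s) (at s)" .
    moreover have "exp (\<beta> * s) *\<^sub>R (G s (\<lambda>i. V i s) j - (\<beta> - lam j) *\<^sub>R V j s) + (\<beta> * exp (\<beta> * s)) *\<^sub>R V j s
      = lam j *\<^sub>R exp (\<beta> * s) *\<^sub>R V j s + F s (\<lambda>i. exp (\<beta> * s) *\<^sub>R V i s) j"
      using E[of s] c(2)[OF s] by (simp add: G_def E_def algebra_simps)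
    ultimately show "((\<lambda>s. exp (\<beta> * s) *\<^sub>R V j s) has_vector_derivative
      lam j *\<^sub>R exp (\<beta> * s) *\<^sub>R V j s + F s (\<lambda>i. exp (\<beta> * s) *\<^sub>R V i s) j) (at s)" by simp
  qed
qed


section \<open>Weak solutions\<close>

lemma biot_savart_minus: "biot_savart (- x) = - biot_savart x"
  by (simp add: biot_savart_def perp_def vec_eq_iff forall_2 vector_2)

lemma biot_savart_0 [simp]: "biot_savart 0 = 0"
  by (simp add: biot_savart_def)

lemma norm_biot_savart: "norm (biot_savart x) = 1 / (2 * pi * norm x)"
proof -
  have "norm (perp x) = norm x"
    by (simp add: perp_def norm_vec_def L2_set_def sum_2 vector_2 add.commute)
  thus ?thesis by (cases "x = 0") (auto simp: biot_savart_def power2_eq_square field_simps)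
qed

lemma borel_measurable_biot_savart [measurable]: "biot_savart \<in> borel_measurable borel"
proof -
  have "perp = (\<lambda>x. vec_lambda (\<lambda>i. if i = 1 then - (x $ 2) else x $ 1))"
    by (auto simp: perp_def fun_eq_iff vec_eq_iff forall_2 vector_2)
  moreover have "continuous_on UNIV (\<lambda>x::real^2. \<chi> i::2. if i = 1 then - (x $ 2) else x $ 1)"
  proof (rule continuous_on_vec_lambda)
    fix i :: 2
    show "continuous_on UNIV (\<lambda>x::real^2. if i = 1 then - (x $ 2) else x $ 1)"
      by (cases "i = 1") (auto intro!: continuous_intros)
  qed
  ultimately have "continuous_on UNIV perp" by (simp only:)
  hence [measurable]: "perp \<in> borel_measurable borel"
    by (rule borel_measurable_continuous_onI)
  show ?thesis unfolding biot_savart_def[abs_def] by measurable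
qed

text \<open>
  A Lipschitz gradient is all that boundedness of \<open>H\<^sub>\<phi>\<close> requires. Unlike smooth test functions,
  functions of this class that separate points can be written down explicitly.
\<close>

definition C11 :: "(real^2 \<Rightarrow> real) set" where
  "C11 = {\<phi> \<in> C0. (\<forall>x. (\<phi> has_derivative (\<lambda>h. gradient \<phi> x \<bullet> h)) (at x)) \<and>
     (\<exists>L. L-lipschitz_on UNIV (gradient \<phi>))}"

lemma C11_continuous_gradient: "\<phi> \<in> C11 \<Longrightarrow> continuous_on UNIV (gradient \<phi>)"
  unfolding C11_def by (auto dest: lipschitz_on_continuous_on)

lemma borel_measurable_H_fun:
  assumes "\<phi> \<in> C11"
  shows "H_fun \<phi> \<in> borel_measurable borel"
proof -
  have [measurable]: "gradient \<phi> \<in> borel_measurable borel"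
    using C11_continuous_gradient[OF assms] by (rule borel_measurable_continuous_onI)
  have "(\<lambda>p. H_fun \<phi> p) \<in> borel_measurable (borel \<Otimes>\<^sub>M borel)"
    unfolding H_fun_def by measurable
  thus ?thesis by (simp add: borel_prod)
qed

text \<open>The Lipschitz bound on the gradient supplies a factor |x - y|, which cancels the
  singularity 1 / |x - y| of the kernel.\<close>

lemma H_fun_bounded:
  assumes "\<phi> \<in> C11"
  obtains L where "L \<ge> 0" "\<And>p. \<bar>H_fun \<phi> p\<bar> \<le> L"
proof -
  obtain L where L: "L-lipschitz_on UNIV (gradient \<phi>)" using assms by (auto simp: C11_def)
  have L0: "L \<ge> 0" using L by (rule lipschitz_on_nonneg)
  have "\<bar>H_fun \<phi> (x, y)\<bar> \<le> L" for x y
  proof (cases "x = y")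
    case False
    have "\<bar>(gradient \<phi> x - gradient \<phi> y) \<bullet> biot_savart (x - y)\<bar> \<le> norm (gradient \<phi> x - gradient \<phi> y) * norm (biot_savart (x - y))"
      by (rule Cauchy_Schwarz_ineq2)
    also have "\<dots> \<le> (L * norm (x - y)) * norm (biot_savart (x - y))"
      using lipschitz_onD[OF L, of x y] by (intro mult_right_mono) (auto simp: dist_norm)
    also have "\<dots> = L / (2 * pi)" using False by (simp add: norm_biot_savart)
    also have "\<dots> \<le> L / 1" using L0 pi_gt3 by (intro divide_left_mono) auto
    finally show ?thesis using L0 by (simp add: H_fun_def abs_mult)
  qed (use L0 in \<open>simp add: H_fun_def\<close>)
  with L0 that show ?thesis by (metis surj_pair)
qed

lemma C0_borel_measurable: "f \<in> C0 \<Longrightarrow> f \<in> borel_measurable borel"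
  by (auto simp: C0_def intro: borel_measurable_continuous_onI)

lemma pairing_vortex_config:
  assumes "inj_on x {1..N}" "f \<in> C0"
  shows "pairing f (vortex_config N \<xi> x) = (\<Sum>j=1..N. \<xi> j * f (x j))"
  unfolding vortex_config_def using assms by (intro pairing_sum_dirac C0_borel_measurable) auto

abbreviation interaction :: "(real^2 \<Rightarrow> real) \<Rightarrow> ((real^2) set \<Rightarrow> real) \<Rightarrow> real" where
  "interaction \<phi> \<gamma> \<equiv> pairing (H_fun \<phi>) (diamond \<gamma>)"

lemma pairing_diamond:
  assumes \<xi>: "\<forall>j\<in>{1..N}. \<xi> j \<noteq> 0" and x: "inj_on x {1..N}" and \<phi>: "\<phi> \<in> C11"
  shows "interaction \<phi> (vortex_config N \<xi> x)
    = (\<Sum>j=1..N. \<Sum>k=1..N. \<xi> j * \<xi> k * H_fun \<phi> (x j, x k))"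
proof -
  let ?J = "{(j, k). j \<in> {1..N} \<and> k \<in> {1..N} \<and> j \<noteq> k}"
  have sub: "?J \<subseteq> {1..N} \<times> {1..N}" by auto
  have fin: "finite ?J" by (rule finite_subset[OF sub]) auto
  have inj: "inj_on (\<lambda>(j, k). (x j, x k)) ?J"
  proof (rule inj_onI)
    fix p q assume "p \<in> ?J" "q \<in> ?J" "(\<lambda>(j, k). (x j, x k)) p = (\<lambda>(j, k). (x j, x k)) q"
    thus "p = q"
      using inj_onD[OF x, of "fst p" "fst q"] inj_onD[OF x, of "snd p" "snd q"]
      by (simp add: case_prod_unfold prod_eq_iff)
  qed
  have "interaction \<phi> (vortex_config N \<xi> x)
    = (\<Sum>p\<in>?J. (\<lambda>(j, k). \<xi> j * \<xi> k) p * H_fun \<phi> ((\<lambda>(j, k). (x j, x k)) p))"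
    unfolding diamond_vortex_config[OF \<xi> x]
    using pairing_sum_dirac[OF fin inj borel_measurable_H_fun[OF \<phi>], of "\<lambda>(j, k). \<xi> j * \<xi> k"]
    by (simp add: case_prod_unfold)
  \<comment> \<open>\<open>H_fun\<close> is 0 on the diagonal, so the pairs (j, j) may be
    added.\<close>
  also have "\<dots> = (\<Sum>p\<in>{1..N} \<times> {1..N}. (\<lambda>(j, k). \<xi> j * \<xi> k) p * H_fun \<phi> ((\<lambda>(j, k). (x j, x k)) p))"
    by (rule sum.mono_neutral_left) (auto simp: H_fun_def)
  finally show ?thesis by (simp add: sum.cartesian_product case_prod_unfold)
qed

text \<open>The term k = j contributes nothing because \<open>biot_savart 0 = 0\<close>, so it is
  not excluded from the sum.\<close>

definition velocity :: "nat \<Rightarrow> (nat \<Rightarrow> real) \<Rightarrow> (nat \<Rightarrow> real^2) \<Rightarrow> nat \<Rightarrow> real^2" where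
  "velocity N \<xi> x j = (\<Sum>k=1..N. \<xi> k *\<^sub>R biot_savart (x j - x k))"

text \<open>The kernel is odd, so exchanging j and k merges the two halves of the integrand: the
  symmetrisation built into \<open>H_fun\<close> is undone.\<close>

lemma sum_H_fun_velocity:
  "(\<Sum>j=1..N. \<Sum>k=1..N. \<xi> j * \<xi> k * H_fun \<phi> (x j, x k))
    = (\<Sum>j=1..N. \<xi> j * (gradient \<phi> (x j) \<bullet> velocity N \<xi> x j))"
proof -
  define a where "a j k = \<xi> j * \<xi> k * (gradient \<phi> (x j) \<bullet> biot_savart (x j - x k))" for j k
  have "\<xi> j * \<xi> k * H_fun \<phi> (x j, x k) = (a j k + a k j) / 2" for j k
    using biot_savart_minus[of "x j - x k"]
    by (simp add: a_def H_fun_def inner_diff_left algebra_simps)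
  hence "(\<Sum>j=1..N. \<Sum>k=1..N. \<xi> j * \<xi> k * H_fun \<phi> (x j, x k))
      = ((\<Sum>j=1..N. \<Sum>k=1..N. a j k) + (\<Sum>j=1..N. \<Sum>k=1..N. a k j)) / 2"
    by (simp add: sum.distrib add_divide_distrib sum_divide_distrib)
  also have "(\<Sum>j=1..N. \<Sum>k=1..N. a k j) = (\<Sum>j=1..N. \<Sum>k=1..N. a j k)"
    by (rule sum.swap)
  also have "((\<Sum>j=1..N. \<Sum>k=1..N. a j k) + (\<Sum>j=1..N. \<Sum>k=1..N. a j k)) / 2 = (\<Sum>j=1..N. \<Sum>k=1..N. a j k)"
    by simp
  also have "\<dots> = (\<Sum>j=1..N. \<xi> j * (gradient \<phi> (x j) \<bullet> velocity N \<xi> x j))"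
    by (simp add: a_def velocity_def inner_sum_right sum_distrib_left mult.assoc)
  finally show ?thesis .
qed

lemma has_vector_derivative_pairing:
  assumes \<xi>: "\<forall>j\<in>{1..N}. \<xi> j \<noteq> 0" and x: "inj_on (x t) {1..N}" and \<phi>: "\<phi> \<in> C11"
    and D: "\<And>j. j \<in> {1..N} \<Longrightarrow> ((\<lambda>s. x s j) has_vector_derivative velocity N \<xi> (x t) j) (at t)"
  shows "((\<lambda>s. \<Sum>j=1..N. \<xi> j * \<phi> (x s j)) has_vector_derivative
    interaction \<phi> (vortex_config N \<xi> (x t))) (at t)"
  unfolding pairing_diamond[OF \<xi> x \<phi>] sum_H_fun_velocity
proof (intro has_vector_derivative_sum)
  fix j assume j: "j \<in> {1..N}"
  have "(\<phi> has_derivative (\<lambda>h. gradient \<phi> (x t j) \<bullet> h)) (at (x t j))"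
    using \<phi> by (auto simp: C11_def)
  from vector_derivative_diff_chain_within[OF D[OF j] has_derivative_at_withinI[OF this]]
  have "((\<lambda>s. \<phi> (x s j)) has_vector_derivative gradient \<phi> (x t j) \<bullet> velocity N \<xi> (x t) j) (at t)"
    by (simp add: o_def)
  thus "((\<lambda>s. \<xi> j * \<phi> (x s j)) has_vector_derivative \<xi> j * (gradient \<phi> (x t j) \<bullet> velocity N \<xi> (x t) j)) (at t)"
    by (rule has_vector_derivative_mult_right)
qed

text \<open>The bound depends on the intensities and on \<phi> but not on the positions, so it
  survives the approach to a collision.\<close>

lemma pairing_diamond_bounded:
  assumes "\<phi> \<in> C11"
  obtains B where "B \<ge> 0" "\<And>x. inj_on x {1..N} \<Longrightarrow> \<forall>j\<in>{1..N}. \<xi> j \<noteq> 0 \<Longrightarrow>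
    \<bar>interaction \<phi> (vortex_config N \<xi> x)\<bar> \<le> B"
proof -
  obtain L where L: "L \<ge> 0" "\<And>p. \<bar>H_fun \<phi> p\<bar> \<le> L" using H_fun_bounded[OF assms] by blast
  let ?B = "\<Sum>j=1..N. \<Sum>k=1..N. \<bar>\<xi> j * \<xi> k\<bar> * L"
  show ?thesis
  proof (rule that)
    show "?B \<ge> 0" using L by (intro sum_nonneg) auto
    fix x :: "nat \<Rightarrow> real^2" assume "inj_on x {1..N}" "\<forall>j\<in>{1..N}. \<xi> j \<noteq> 0"
    hence "\<bar>interaction \<phi> (vortex_config N \<xi> x)\<bar> = \<bar>\<Sum>j=1..N. \<Sum>k=1..N. \<xi> j * \<xi> k * H_fun \<phi> (x j, x k)\<bar>"
      by (simp add: pairing_diamond[OF _ _ assms])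
    also have "\<dots> \<le> ?B"
      using L by (intro order_trans[OF sum_abs] sum_mono) (auto simp: abs_mult intro: mult_left_mono)
    finally show "\<bar>interaction \<phi> (vortex_config N \<xi> x)\<bar> \<le> ?B" .
  qed
qed

section \<open>Weak solutions on arbitrary sets of times\<close>

abbreviation weak_identity :: "(real^2 \<Rightarrow> real) \<Rightarrow> (real \<Rightarrow> (real^2) set \<Rightarrow> real) \<Rightarrow> real \<Rightarrow> real \<Rightarrow> bool" where
  "weak_identity \<phi> \<omega> a b \<equiv> set_integrable lborel {a..b} (\<lambda>s. interaction \<phi> (\<omega> s)) \<and>
    ((\<lambda>s. interaction \<phi> (\<omega> s)) has_integral pairing \<phi> (\<omega> b) - pairing \<phi> (\<omega> a)) {a..b}"

text \<open>The identity is required between any two times of an arbitrary set instead of from time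
  0 on an open interval. In this form it restricts, shifts, reflects and glues.\<close>

definition weak_solution :: "real set \<Rightarrow> (real \<Rightarrow> (real^2) set \<Rightarrow> real) \<Rightarrow> bool" where
  "weak_solution I \<omega> \<longleftrightarrow> (\<forall>t\<in>I. \<omega> t \<in> configs) \<and> (\<forall>f\<in>C0. continuous_on I (\<lambda>t. pairing f (\<omega> t))) \<and>
     (\<forall>\<phi>\<in>test_functions. \<forall>a\<in>I. \<forall>b\<in>I. a \<le> b \<longrightarrow> weak_identity \<phi> \<omega> a b)"

lemma weak_solution_subset: "weak_solution I \<omega> \<Longrightarrow> J \<subseteq> I \<Longrightarrow> weak_solution J \<omega>"
  unfolding weak_solution_def by (meson continuous_on_subset subsetD)

lemma weak_solution_imp_point_vortices_solution:
  assumes "weak_solution UNIV \<omega>"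
  shows "point_vortices_solution UNIV \<omega>"
  unfolding point_vortices_solution_def continuous_map_weak_star_iff
proof (intro conjI ballI)
  fix f :: "real^2 \<Rightarrow> real" assume "f \<in> C0"
  thus "continuous_map (top_of_set UNIV) euclideanreal (\<lambda>t. pairing f (\<omega> t))"
    using assms by (auto simp: weak_solution_def)
next
  fix \<phi> t assume \<phi>: "\<phi> \<in> test_functions"
  let ?h = "\<lambda>s. interaction \<phi> (\<omega> s)"
  have I: "set_integrable lborel {a..b} ?h" "(?h has_integral pairing \<phi> (\<omega> b) - pairing \<phi> (\<omega> a)) {a..b}"
    if "a \<le> b" for a b
    using assms \<phi> that by (auto simp: weak_solution_def)
  have L: "(LBINT s=ereal a..ereal b. ?h s) = pairing \<phi> (\<omega> b) - pairing \<phi> (\<omega> a)" if "a \<le> b" for a b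
    using interval_integral_eq_integral[OF that I(1)[OF that]] integral_unique[OF I(2)[OF that]] by simp
  have O: "set_integrable lborel {a<..<b} ?h" if "a \<le> b" for a b
    by (rule set_integrable_subset[OF I(1)[OF that]]) auto
  show "interval_lebesgue_integrable lborel (ereal 0) (ereal t) ?h"
    using O[of 0 t] O[of t 0] by (cases "t \<ge> 0") (auto simp: interval_lebesgue_integrable_def)
  show "pairing \<phi> (\<omega> t) - pairing \<phi> (\<omega> 0) = (LBINT s=ereal 0..ereal t. ?h s)"
  proof (cases "t \<ge> 0")
    case True
    thus ?thesis using L[of 0 t] by simp
  next
    case False
    thus ?thesis using L[of t 0]
      by (subst interval_integral_endpoints_reverse) simp
  qed
qed (use assms in \<open>auto simp: weak_solution_def\<close>)

lemma weak_identity_cong: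
  fixes a b :: real
  assumes "\<And>t. t \<in> {a..b} \<Longrightarrow> \<omega> t = \<omega>' t" "a \<le> b"
    and "weak_identity \<phi> \<omega>' a b"
  shows "weak_identity \<phi> \<omega> a b"
proof
  have "set_integrable lborel {a..b} (\<lambda>s. interaction \<phi> (\<omega> s))
      = set_integrable lborel {a..b} (\<lambda>s. interaction \<phi> (\<omega>' s))"
    by (rule set_integrable_cong) (use assms(1) in auto)
  thus "set_integrable lborel {a..b} (\<lambda>s. interaction \<phi> (\<omega> s))" using assms(3) by simp
  have "\<omega> a = \<omega>' a" "\<omega> b = \<omega>' b" using assms(1)[of a] assms(1)[of b] assms(2) by auto
  with assms(3) have "((\<lambda>s. interaction \<phi> (\<omega>' s)) has_integral pairing \<phi> (\<omega> b) - pairing \<phi> (\<omega> a)) {a..b}"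
    by simp
  thus "((\<lambda>s. interaction \<phi> (\<omega> s)) has_integral pairing \<phi> (\<omega> b) - pairing \<phi> (\<omega> a)) {a..b}"
    by (rule has_integral_eq[rotated]) (use assms(1) in auto)
qed

lemma weak_solution_glue:
  assumes 1: "weak_solution I1 \<omega>1" "I1 \<subseteq> {..b}" "b \<in> I1" and 2: "weak_solution I2 \<omega>2" "I2 \<subseteq> {b..}" "b \<in> I2"
    and eq: "\<omega>1 b = \<omega>2 b"
  shows "weak_solution (I1 \<union> I2) (\<lambda>t. if t \<le> b then \<omega>1 t else \<omega>2 t)"
proof -
  let ?\<omega> = "\<lambda>t. if t \<le> b then \<omega>1 t else \<omega>2 t"
  have o1: "?\<omega> t = \<omega>1 t" if "t \<le> b" for t using that by simp
  have o2: "?\<omega> t = \<omega>2 t" if "b \<le> t" for t using that eq by (cases "t = b") auto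
  show ?thesis
    unfolding weak_solution_def
  proof (intro conjI ballI impI)
    fix t assume "t \<in> I1 \<union> I2"
    thus "?\<omega> t \<in> configs" using 1 2 o1 o2 by (auto simp: weak_solution_def)
  next
    fix f :: "real^2 \<Rightarrow> real" assume f: "f \<in> C0"
    have "continuous_on (I1 \<union> I2) (\<lambda>t. if t \<le> b then pairing f (\<omega>1 t) else pairing f (\<omega>2 t))"
    proof (rule continuous_on_cases_local)
      have "I1 = (I1 \<union> I2) \<inter> {..b}" "I2 = (I1 \<union> I2) \<inter> {b..}" using 1 2 by auto
      thus "closedin (top_of_set (I1 \<union> I2)) I1" "closedin (top_of_set (I1 \<union> I2)) I2"
        by (metis closedin_closed_Int closed_atMost, metis closedin_closed_Int closed_atLeast)
    next
      fix t assume t: "t \<in> I1 \<and> \<not> t \<le> b \<or> t \<in> I2 \<and> t \<le> b"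
      hence "t = b" using 1 2 by force
      thus "pairing f (\<omega>1 t) = pairing f (\<omega>2 t)" using eq by simp
    qed (use f 1 2 in \<open>auto simp: weak_solution_def\<close>)
    thus "continuous_on (I1 \<union> I2) (\<lambda>t. pairing f (?\<omega> t))"
      by (rule continuous_on_eq) auto
  next
    fix \<phi> c d assume \<phi>: "\<phi> \<in> test_functions" and c: "c \<in> I1 \<union> I2" and d: "d \<in> I1 \<union> I2" and cd: "c \<le> d"
    let ?h = "\<lambda>\<omega> s. interaction \<phi> (\<omega> s)"
    have L: "weak_identity \<phi> ?\<omega> c d"
      if "c \<in> I1" "d \<in> I1" "c \<le> d" for c d
    proof (rule weak_identity_cong[where \<omega>' = \<omega>1])
      have "d \<le> b" using that 1 by auto
      thus "?\<omega> t = \<omega>1 t" if "t \<in> {c..d}" for t using that by simp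
    qed (use that 1 \<phi> in \<open>auto simp: weak_solution_def\<close>)
    have R: "weak_identity \<phi> ?\<omega> c d"
      if "c \<in> I2" "d \<in> I2" "c \<le> d" for c d
    proof (rule weak_identity_cong[where \<omega>' = \<omega>2])
      have "b \<le> c" using that 2 by auto
      thus "?\<omega> t = \<omega>2 t" if "t \<in> {c..d}" for t using that o2[of t] by simp
    qed (use that 2 \<phi> in \<open>auto simp: weak_solution_def\<close>)
    have X: "weak_identity \<phi> ?\<omega> c d"
    proof -
      consider "c \<in> I1" "d \<in> I1" | "c \<in> I2" "d \<in> I2" | "c \<in> I1" "d \<in> I2" | "c \<in> I2" "d \<in> I1"
        using c d by blast
      thus ?thesis
      proof cases
        case 3
        have cb: "c \<le> b" "b \<le> d" using 3 1 2 by auto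
        note l = L[OF \<open>c \<in> I1\<close> \<open>b \<in> I1\<close> cb(1)] and r = R[OF \<open>b \<in> I2\<close> \<open>d \<in> I2\<close> cb(2)]
        have "set_integrable lborel ({c..b} \<union> {b..d}) (?h ?\<omega>)"
          using l r by (intro set_integrable_Un) auto
        moreover have "{c..b} \<union> {b..d} = {c..d}" using cb by auto
        moreover have "(?h ?\<omega> has_integral (pairing \<phi> (?\<omega> b) - pairing \<phi> (?\<omega> c)) + (pairing \<phi> (?\<omega> d) - pairing \<phi> (?\<omega> b))) {c..d}"
          using l r by (intro has_integral_combine[OF cb]) auto
        ultimately show ?thesis by (simp add: algebra_simps)
      next
        case 4
        hence "c = b" "d = b" using 1 2 cd by force+
        thus ?thesis using L[of b b] 1 by simp
      qed (use L R cd in blast)+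
    qed
    thus "set_integrable lborel {c..d} (?h ?\<omega>)"
      "(?h ?\<omega> has_integral pairing \<phi> (?\<omega> d) - pairing \<phi> (?\<omega> c)) {c..d}" by blast+
  qed
qed

lemma pairing_uminus: "pairing f (\<lambda>A. - \<mu> A) = - pairing f \<mu>"
  by (simp add: pairing_def)

lemma diamond_uminus: "diamond (\<lambda>A. - \<gamma> A) = diamond \<gamma>"
  by (simp add: diamond_def)

lemma vortex_config_uminus: "(\<lambda>A. - vortex_config N \<xi> x A) = vortex_config N (\<lambda>j. - \<xi> j) x"
  by (simp add: vortex_config_def sum_negf)

lemma configs_uminus: "\<gamma> \<in> configs \<Longrightarrow> (\<lambda>A. - \<gamma> A) \<in> configs"
  unfolding configs_def configs_N_def
  by (auto simp: vortex_config_uminus) (metis neg_equal_0_iff_equal)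

text \<open>The interaction is quadratic in the configuration and keeps its value under the sign
  change; the pairing changes sign, which compensates the reversed orientation of time.\<close>

lemma weak_solution_reverse:
  assumes "weak_solution {0..} \<omega>"
  shows "weak_solution {..0} (\<lambda>t A. - \<omega> (- t) A)"
  unfolding weak_solution_def
proof (intro conjI ballI impI)
  fix t :: real assume "t \<in> {..0}"
  thus "(\<lambda>A. - \<omega> (- t) A) \<in> configs" using assms by (intro configs_uminus) (auto simp: weak_solution_def)
next
  fix f :: "real^2 \<Rightarrow> real" assume "f \<in> C0"
  hence "continuous_on {0..} (\<lambda>t. pairing f (\<omega> t))" using assms by (auto simp: weak_solution_def)
  hence "continuous_on {..0} (\<lambda>t. - pairing f (\<omega> (- t)))"
    by (intro continuous_intros continuous_on_compose2[of "{0..}" _ "{..0}" uminus]) (auto simp: continuous_on_minus)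
  thus "continuous_on {..0} (\<lambda>t. pairing f (\<lambda>A. - \<omega> (- t) A))" by (simp add: pairing_uminus)
next
  fix \<phi> and a b :: real assume \<phi>: "\<phi> \<in> test_functions" and ab: "a \<in> {..0}" "b \<in> {..0}" "a \<le> b"
  let ?h = "\<lambda>s. interaction \<phi> (\<omega> s)"
  have h: "set_integrable lborel {-b..-a} ?h" "(?h has_integral pairing \<phi> (\<omega> (-a)) - pairing \<phi> (\<omega> (-b))) {-b..-a}"
    using assms \<phi> ab by (auto simp: weak_solution_def)
  have "integrable lborel (\<lambda>s. indicator {-b..-a} (0 + (-1) * s) *\<^sub>R ?h (0 + (-1) * s))"
    using h(1) unfolding set_integrable_def by (subst lborel_integrable_real_affine_iff) auto
  also have "(\<lambda>s. indicator {-b..-a} (0 + (-1) * s) *\<^sub>R ?h (0 + (-1) * s)) = (\<lambda>s. indicator {a..b} s *\<^sub>R ?h (- s))"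
    by (auto simp: fun_eq_iff indicator_def)
  finally show "set_integrable lborel {a..b} (\<lambda>s. interaction \<phi> (\<lambda>A. - \<omega> (- s) A))"
    by (simp add: set_integrable_def diamond_uminus)
  have "((\<lambda>s. ?h (- s)) has_integral pairing \<phi> (\<omega> (-a)) - pairing \<phi> (\<omega> (-b))) {a..b}"
    using h(2) by (subst has_integral_reflect_real[symmetric]) auto
  thus "((\<lambda>s. interaction \<phi> (\<lambda>A. - \<omega> (- s) A)) has_integral
      pairing \<phi> (\<lambda>A. - \<omega> (- b) A) - pairing \<phi> (\<lambda>A. - \<omega> (- a) A)) {a..b}"
    by (simp add: diamond_uminus pairing_uminus)
qed


text \<open>The equations of motion are needed at interior times only. At an endpoint weak*
  continuity is enough, because the fundamental theorem asks for the derivative only inside; this is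
  how collisions and bursts are crossed.\<close>

lemma weak_solution_smooth:
  assumes I: "is_interval I" and \<xi>: "\<forall>j\<in>{1..N}. \<xi> j \<noteq> 0"
    and \<omega>: "\<And>t. t \<in> I \<Longrightarrow> \<omega> t \<in> configs" "\<And>f. f \<in> C0 \<Longrightarrow> continuous_on I (\<lambda>t. pairing f (\<omega> t))"
    and C11: "test_functions \<subseteq> C11"
    and x: "\<And>t. t \<in> interior I \<Longrightarrow> \<omega> t = vortex_config N \<xi> (x t)" "\<And>t. t \<in> interior I \<Longrightarrow> inj_on (x t) {1..N}"
      "\<And>t j. t \<in> interior I \<Longrightarrow> j \<in> {1..N} \<Longrightarrow> ((\<lambda>s. x s j) has_vector_derivative velocity N \<xi> (x t) j) (at t)"
  shows "weak_solution I \<omega>"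
  unfolding weak_solution_def
proof (intro conjI ballI impI \<omega>)
  fix \<phi> a b assume "\<phi> \<in> test_functions" and ab: "a \<in> I" "b \<in> I" "a \<le> b"
  hence \<phi>: "\<phi> \<in> C11" using C11 by auto
  let ?h = "\<lambda>s. interaction \<phi> (\<omega> s)"
  have int: "{a<..<b} \<subseteq> interior I"
  proof (rule interior_maximal)
    show "{a<..<b} \<subseteq> I"
    proof
      fix t assume "t \<in> {a<..<b}"
      thus "t \<in> I" using mem_is_interval_1_I[OF I ab(1,2), of t] by simp
    qed
  qed auto
  have D: "((\<lambda>s. pairing \<phi> (\<omega> s)) has_vector_derivative ?h t) (at t)" if t: "t \<in> {a<..<b}" for t
  proof -
    have t': "t \<in> interior I" using t int by auto
    have "((\<lambda>s. \<Sum>j=1..N. \<xi> j * \<phi> (x s j)) has_vector_derivative ?h t) (at t)"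
      unfolding x(1)[OF t'] by (rule has_vector_derivative_pairing[OF \<xi> x(2)[OF t'] \<phi> x(3)[OF t']])
    thus ?thesis
    proof (rule has_vector_derivative_transform_within_open[OF _ open_interior t'])
      fix s assume s: "s \<in> interior I"
      show "(\<Sum>j=1..N. \<xi> j * \<phi> (x s j)) = pairing \<phi> (\<omega> s)"
        unfolding x(1)[OF s] using \<phi> by (subst pairing_vortex_config[OF x(2)[OF s]]) (auto simp: C11_def)
    qed
  qed
  have "continuous_on {a..b} (\<lambda>s. pairing \<phi> (\<omega> s))"
  proof (rule continuous_on_subset)
    show "continuous_on I (\<lambda>s. pairing \<phi> (\<omega> s))" using \<phi> by (intro \<omega>) (auto simp: C11_def)
    show "{a..b} \<subseteq> I" using mem_is_interval_1_I[OF I ab(1,2)] by auto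
  qed
  from fundamental_theorem_of_calculus_interior[OF ab(3) this D]
  show "(?h has_integral pairing \<phi> (\<omega> b) - pairing \<phi> (\<omega> a)) {a..b}" by simp
  obtain B where B: "B \<ge> 0" "\<And>x. inj_on x {1..N} \<Longrightarrow> \<forall>j\<in>{1..N}. \<xi> j \<noteq> 0 \<Longrightarrow>
    \<bar>interaction \<phi> (vortex_config N \<xi> x)\<bar> \<le> B"
    using pairing_diamond_bounded[OF \<phi>] by blast
  \<comment> \<open>The positions carry information only at interior times, so they are cut off to
    become globally measurable functions.\<close>
  define y where "y j s = indicator {a<..<b} s *\<^sub>R x s j" for j s
  have [measurable]: "y j \<in> borel_measurable borel" if "j \<in> {1..N}" for j
    unfolding y_def
  proof (rule borel_measurable_continuous_on_indicator)
    show "continuous_on {a<..<b} (\<lambda>s. x s j)"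
    proof (intro continuous_at_imp_continuous_on ballI)
      fix s assume "s \<in> {a<..<b}"
      hence "s \<in> interior I" using int by blast
      from has_vector_derivative_continuous[OF x(3)[OF this that]] show "isCont (\<lambda>s. x s j) s" .
    qed
  qed auto
  have [measurable]: "H_fun \<phi> \<in> borel_measurable (borel \<Otimes>\<^sub>M borel)"
    using borel_measurable_H_fun[OF \<phi>] by (simp add: borel_prod)
  have "(\<lambda>s. indicator {a<..<b} s *\<^sub>R (\<Sum>j=1..N. \<Sum>k=1..N. \<xi> j * \<xi> k * H_fun \<phi> (y j s, y k s))) \<in> borel_measurable borel"
    by measurable
  also have "(\<lambda>s. indicator {a<..<b} s *\<^sub>R (\<Sum>j=1..N. \<Sum>k=1..N. \<xi> j * \<xi> k * H_fun \<phi> (y j s, y k s)))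
      = (\<lambda>s. indicator {a<..<b} s *\<^sub>R ?h s)"
  proof
    fix s
    show "indicator {a<..<b} s *\<^sub>R (\<Sum>j=1..N. \<Sum>k=1..N. \<xi> j * \<xi> k * H_fun \<phi> (y j s, y k s)) = indicator {a<..<b} s *\<^sub>R ?h s"
    proof (cases "s \<in> {a<..<b}")
      case True
      hence s: "s \<in> interior I" using int by auto
      show ?thesis unfolding x(1)[OF s] pairing_diamond[OF \<xi> x(2)[OF s] \<phi>] using True by (simp add: y_def)
    qed simp
  qed
  finally have m: "(\<lambda>s. indicator {a<..<b} s *\<^sub>R ?h s) \<in> borel_measurable borel" .
  have "set_integrable lborel {a<..<b} ?h"
    unfolding set_integrable_def
  proof (rule integrableI_bounded_set)
    show "{a<..<b} \<in> sets lborel" "emeasure lborel {a<..<b} < \<infinity>" by (auto simp: ab)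
    show "AE s in lborel. s \<notin> {a<..<b} \<longrightarrow> indicator {a<..<b} s *\<^sub>R ?h s = 0"
      by (auto simp: indicator_def)
    show "AE s in lborel. s \<in> {a<..<b} \<longrightarrow> norm (indicator {a<..<b} s *\<^sub>R ?h s) \<le> B"
    proof (intro AE_I2 impI)
      fix s assume s: "s \<in> {a<..<b}"
      hence s': "s \<in> interior I" using int by auto
      show "norm (indicator {a<..<b} s *\<^sub>R ?h s) \<le> B"
        using s B(2)[OF x(2)[OF s'] \<xi>] by (simp add: x(1)[OF s'])
    qed
  qed (use m in auto)
  \<comment> \<open>At the endpoints the configuration may be of a different kind, outside the reach
    of the bound B. Two points form a null set, so any finite bound will do.\<close>
  moreover have "set_integrable lborel {a, b} ?h"
    unfolding set_integrable_def
  proof (rule integrableI_bounded_set[where A = "{a, b}" and B = "\<bar>?h a\<bar> + \<bar>?h b\<bar>"])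
    have "(\<lambda>s. indicator {a, b} s *\<^sub>R ?h s) = (\<lambda>s. if s = a then ?h a else if s = b then ?h b else 0)"
      by (auto simp: fun_eq_iff)
    thus "(\<lambda>s. indicator {a, b} s *\<^sub>R ?h s) \<in> borel_measurable lborel" by simp
  qed (auto simp: indicator_def emeasure_lborel_countable)
  ultimately have "set_integrable lborel ({a<..<b} \<union> {a, b}) ?h"
    by (rule set_integrable_Un) auto
  moreover have "{a<..<b} \<union> {a, b} = {a..b}" using ab by auto
  ultimately show "set_integrable lborel {a..b} ?h" by simp
qed

section \<open>Functions with Lipschitz gradient\<close>

lemma C11I:
  assumes "\<phi> \<in> C0" "\<And>x. (\<phi> has_derivative (\<lambda>h. G x \<bullet> h)) (at x)" "L-lipschitz_on UNIV G"
  shows "\<phi> \<in> C11"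
proof -
  have "gradient \<phi> x = G x" for x
  proof -
    have "frechet_derivative \<phi> (at x) = (\<lambda>h. G x \<bullet> h)"
      by (rule frechet_derivative_at[OF assms(2), symmetric])
    thus ?thesis by (simp add: gradient_def partial_def vec_eq_iff inner_axis)
  qed
  hence "gradient \<phi> = G" by auto
  thus ?thesis using assms by (auto simp: C11_def)
qed

lemma has_derivative_gradient:
  assumes "\<phi> differentiable (at x)"
  shows "(\<phi> has_derivative (\<lambda>h. gradient \<phi> x \<bullet> h)) (at x)"
proof -
  let ?D = "frechet_derivative \<phi> (at x)"
  have D: "(\<phi> has_derivative ?D) (at x)" using assms by (simp add: frechet_derivative_works)
  hence lin: "linear ?D" by (rule has_derivative_linear)
  have "?D h = gradient \<phi> x \<bullet> h" for h
  proof -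
    have "?D h = ?D (\<Sum>i\<in>UNIV. h $ i *\<^sub>R axis i 1)" by (simp add: basis_expansion scalar_mult_eq_scaleR[symmetric])
    also have "\<dots> = (\<Sum>i\<in>UNIV. h $ i * ?D (axis i 1))"
      using lin by (simp add: linear_sum linear_cmul)
    also have "\<dots> = gradient \<phi> x \<bullet> h"
      by (simp add: gradient_def partial_def inner_vec_def mult.commute)
    finally show ?thesis .
  qed
  hence "?D = (\<lambda>h. gradient \<phi> x \<bullet> h)" by (rule ext)
  with D show ?thesis by (simp only:)
qed

lemma C0_compact_support:
  fixes f :: "'a::real_normed_vector \<Rightarrow> real"
  assumes "continuous_on UNIV f" "bounded {x. f x \<noteq> 0}"
  shows "f \<in> C0"
proof -
  obtain b where b: "\<And>x. f x \<noteq> 0 \<Longrightarrow> norm x \<le> b" using assms(2) by (auto simp: bounded_iff)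
  have "eventually (\<lambda>x. f x = 0) at_infinity"
    unfolding eventually_at_infinity by (rule exI[of _ "b + 1"]) (use b in force)
  hence "(f \<longlongrightarrow> 0) at_infinity" by (rule tendsto_eventually)
  thus ?thesis using assms by (simp add: C0_def)
qed

lemma bounded_compact_support:
  fixes g :: "real^2 \<Rightarrow> real"
  assumes "continuous_on UNIV g" "compact K" "\<And>x. x \<notin> K \<Longrightarrow> g x = 0"
  obtains B where "B \<ge> 0" "\<And>x. \<bar>g x\<bar> \<le> B"
proof -
  have "compact (g ` K)" using assms by (intro compact_continuous_image) (auto intro: continuous_on_subset)
  then obtain B where "\<forall>x\<in>K. \<bar>g x\<bar> \<le> B"
    by (auto dest!: compact_imp_bounded simp: bounded_iff)
  hence "\<bar>g x\<bar> \<le> max 0 B" for x using assms(3)[of x] by (cases "x \<in> K") (auto simp: max_def intro: order_trans)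
  thus ?thesis using that[of "max 0 B"] by simp
qed

lemma partial_eq_0_outside:
  assumes "closed K" "\<And>x. x \<notin> K \<Longrightarrow> g x = 0" "x \<notin> K"
  shows "partial i g x = 0"
proof -
  have "((\<lambda>_. 0) has_derivative (\<lambda>_. 0)) (at x)" by simp
  hence "(g has_derivative (\<lambda>_. 0)) (at x)"
    by (rule has_derivative_transform_within_open[of _ _ _ _ "- K"]) (use assms in auto)
  from fun_cong[OF frechet_derivative_at[OF this], of "axis i 1"] show ?thesis by (simp add: partial_def)
qed

text \<open>The second partial derivatives are continuous with compact support, hence bounded, and
  the mean value inequality makes the first ones Lipschitz.\<close>

lemma test_functions_subset_C11: "test_functions \<subseteq> C11"
proof
  fix \<phi> assume "\<phi> \<in> test_functions"
  hence C: "\<And>k. Ck k \<phi>" and K: "compact (closure {x. \<phi> x \<noteq> 0})" by (auto simp: test_functions_def)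
  let ?K = "closure {x. \<phi> x \<noteq> 0}"
  have cK: "closed ?K" by simp
  have 0: "\<phi> x = 0" if "x \<notin> ?K" for x using that closure_subset[of "{x. \<phi> x \<noteq> 0}"] by auto
  have p0: "partial i \<phi> x = 0" if "x \<notin> ?K" for i x by (rule partial_eq_0_outside[OF cK 0 that])
  have pp0: "partial j (partial i \<phi>) x = 0" if "x \<notin> ?K" for i j x by (rule partial_eq_0_outside[OF cK p0 that])
  have C2: "partial i \<phi> differentiable (at x)" "continuous_on UNIV (partial j (partial i \<phi>))" for i j x
    using C[of "Suc (Suc 0)"] by auto
  have "\<exists>B. B \<ge> 0 \<and> (\<forall>x. \<bar>partial j (partial i \<phi>) x\<bar> \<le> B)" for i j
    using bounded_compact_support[OF C2(2) K pp0] by metis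
  hence "\<forall>i j. \<exists>B\<ge>0. \<forall>x. \<bar>partial j (partial i \<phi>) x\<bar> \<le> B" by blast
  then obtain B where "\<forall>i j. B i j \<ge> 0 \<and> (\<forall>x. \<bar>partial j (partial i \<phi>) x\<bar> \<le> B i j)"
    unfolding choice_iff by blast
  hence B: "\<And>i j. B i j \<ge> 0" "\<And>i j x. \<bar>partial j (partial i \<phi>) x\<bar> \<le> B i j" by auto
  define B' where "B' i = (\<Sum>j\<in>UNIV. B i j)" for i :: 2
  have lip: "\<bar>partial i \<phi> x - partial i \<phi> y\<bar> \<le> B' i * norm (x - y)" for i x y
  proof -
    have "norm (partial i \<phi> x - partial i \<phi> y) \<le> B' i * norm (x - y)"
    proof (rule differentiable_bound[OF convex_UNIV])
      fix z
      show "(partial i \<phi> has_derivative (\<lambda>h. gradient (partial i \<phi>) z \<bullet> h)) (at z within UNIV)"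
        using has_derivative_gradient[OF C2(1)] by simp
      have "norm (gradient (partial i \<phi>) z) \<le> (\<Sum>j\<in>UNIV. \<bar>gradient (partial i \<phi>) z $ j\<bar>)"
        by (rule norm_le_l1_cart)
      also have "\<dots> \<le> B' i" unfolding B'_def by (intro sum_mono) (simp add: gradient_def B)
      finally have n: "norm (gradient (partial i \<phi>) z) \<le> B' i" .
      show "onorm (\<lambda>h. gradient (partial i \<phi>) z \<bullet> h) \<le> B' i"
      proof (rule onorm_bound)
        show "B' i \<ge> 0" unfolding B'_def by (intro sum_nonneg B)
        fix h show "norm (gradient (partial i \<phi>) z \<bullet> h) \<le> B' i * norm h"
          using Cauchy_Schwarz_ineq2[of "gradient (partial i \<phi>) z" h] mult_right_mono[OF n norm_ge_zero[of h]] by simp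
      qed
    qed auto
    thus ?thesis by simp
  qed
  have "(\<Sum>i\<in>UNIV. B' i)-lipschitz_on UNIV (gradient \<phi>)"
  proof (rule lipschitz_onI)
    fix x y
    have "norm (gradient \<phi> x - gradient \<phi> y) \<le> (\<Sum>i\<in>UNIV. \<bar>(gradient \<phi> x - gradient \<phi> y) $ i\<bar>)"
      by (rule norm_le_l1_cart)
    also have "\<dots> \<le> (\<Sum>i\<in>UNIV. B' i * norm (x - y))"
      using lip by (intro sum_mono) (simp add: gradient_def)
    finally show "dist (gradient \<phi> x) (gradient \<phi> y) \<le> (\<Sum>i\<in>UNIV. B' i) * dist x y"
      by (simp add: dist_norm sum_distrib_right)
  qed (auto simp: B'_def intro!: sum_nonneg B)
  moreover have d: "\<phi> differentiable (at x)" for x using C[of "Suc 0"] by auto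
  have "\<phi> \<in> C0"
  proof (rule C0_compact_support)
    show "continuous_on UNIV \<phi>" using C[of 0] by simp
    show "bounded {x. \<phi> x \<noteq> 0}" using compact_imp_bounded[OF K] closure_subset bounded_subset by blast
  qed
  ultimately show "\<phi> \<in> C11"
    using has_derivative_gradient[OF d] by (auto simp: C11_def)
qed

text \<open>The positive part is squared so that the gradient is continuous, and even Lipschitz,
  across the boundary of the ball of radius r.\<close>

definition bump :: "real^2 \<Rightarrow> real \<Rightarrow> real^2 \<Rightarrow> real" where
  "bump p r x = (max 0 (r\<^sup>2 - (norm (x - p))\<^sup>2))\<^sup>2"

lemma bump_C11: "r > 0 \<Longrightarrow> bump p r \<in> C11"
proof (rule C11I)
  assume r: "r > 0"
  let ?m = "\<lambda>x. max 0 (r\<^sup>2 - (norm (x - p))\<^sup>2)"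
  show "bump p r \<in> C0"
  proof (rule C0_compact_support)
    show "continuous_on UNIV (bump p r)" unfolding bump_def by (intro continuous_intros)
    show "bounded {x. bump p r x \<noteq> 0}"
    proof (rule bounded_subset[OF bounded_cball])
      show "{x. bump p r x \<noteq> 0} \<subseteq> cball p r"
      proof
        fix x assume "x \<in> {x. bump p r x \<noteq> 0}"
        hence "(norm (x - p))\<^sup>2 < r\<^sup>2" by (auto simp: bump_def max_def split: if_splits)
        hence "norm (x - p) < r" using r by (simp add: power2_less_imp_less)
        thus "x \<in> cball p r" by (simp add: dist_norm norm_minus_commute)
      qed
    qed
  qed
  have sq: "((\<lambda>u::real. (max 0 u)\<^sup>2) has_real_derivative 2 * max 0 u) (at u)" for u
  proof (cases u "0::real" rule: linorder_cases)
    case less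
    have "((\<lambda>u::real. 0) has_real_derivative 0) (at u)" by simp
    hence "((\<lambda>u::real. (max 0 u)\<^sup>2) has_real_derivative 0) (at u)"
      by (rule has_field_derivative_transform_within_open[where S = "{..<0}"]) (use less in auto)
    thus ?thesis using less by simp
  next
    case greater
    have "((\<lambda>u::real. u\<^sup>2) has_real_derivative 2 * u) (at u)" by (auto intro!: derivative_eq_intros)
    hence "((\<lambda>u::real. (max 0 u)\<^sup>2) has_real_derivative 2 * u) (at u)"
      by (rule has_field_derivative_transform_within_open[where S = "{0<..}"]) (use greater in auto)
    thus ?thesis using greater by simp
  next
    case equal
    \<comment> \<open>At the kink the difference quotient is at most |h|.\<close>
    have "((\<lambda>h::real. (max 0 h)\<^sup>2 / h) \<longlongrightarrow> 0) (at 0)"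
    proof (rule Lim_null_comparison)
      show "\<forall>\<^sub>F h::real in at 0. norm ((max 0 h)\<^sup>2 / h) \<le> \<bar>h\<bar>"
        by (rule always_eventually) (auto simp: max_def power2_eq_square)
      show "((\<lambda>h::real. \<bar>h\<bar>) \<longlongrightarrow> 0) (at 0)" by (rule tendsto_rabs_zero) (rule tendsto_ident_at)
    qed
    thus ?thesis using equal by (simp add: DERIV_def)
  qed
  show "(bump p r has_derivative (\<lambda>h. (- 4 * ?m x) *\<^sub>R (x - p) \<bullet> h)) (at x)" for x
  proof -
    have "((\<lambda>x. r\<^sup>2 - (x - p) \<bullet> (x - p)) has_derivative (\<lambda>h. - 2 * ((x - p) \<bullet> h))) (at x)"
      by (auto intro!: derivative_eq_intros simp: inner_commute)
    from has_derivative_compose[OF this sq[unfolded has_field_derivative_def]]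
    show ?thesis by (simp add: bump_def[abs_def] power2_norm_eq_inner mult.assoc inner_commute)
  qed
  \<comment> \<open>12 r^2 is 4 times 2 r * r + r^2: on the ball \<open>?m\<close> varies at rate at
    most 2 r while |x - p| \<le> r, and \<open>?m\<close> itself is at most r^2.\<close>
  show "(12 * r\<^sup>2)-lipschitz_on UNIV (\<lambda>x. (- 4 * ?m x) *\<^sub>R (x - p))"
  proof (rule lipschitz_onI)
    fix x y
    \<comment> \<open>By symmetry x may be taken as the point closer to p; if it lies outside the
      ball, both terms vanish.\<close>
    have one: "norm (?m x *\<^sub>R (x - p) - ?m y *\<^sub>R (y - p)) \<le> 3 * r\<^sup>2 * norm (x - y)" 
      if le: "norm (x - p) \<le> norm (y - p)" for x y
    proof (cases "norm (x - p) \<le> r")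
      case True
      have mx: "?m x = r\<^sup>2 - (norm (x - p))\<^sup>2" using power_mono[OF True, of 2] by simp
      have m1: "?m y \<le> r\<^sup>2" "?m y \<ge> 0" by auto
      have d: "\<bar>norm (x - p) - norm (y - p)\<bar> \<le> norm (x - y)"
        using norm_triangle_ineq3[of "x - p" "y - p"] by simp
      have mm: "\<bar>?m x - ?m y\<bar> \<le> 2 * r * norm (x - y)"
      proof (cases "norm (y - p) \<le> r")
        case y: True
        have my: "?m y = r\<^sup>2 - (norm (y - p))\<^sup>2" using power_mono[OF y, of 2] by simp
        have "\<bar>?m x - ?m y\<bar> = \<bar>(norm (y - p) - norm (x - p)) * (norm (y - p) + norm (x - p))\<bar>"
          unfolding mx my by (simp add: algebra_simps power2_eq_square)
        also have "\<dots> \<le> norm (x - y) * (2 * r)"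
          unfolding abs_mult using True y d by (intro mult_mono) auto
        finally show ?thesis by (simp add: mult_ac)
      next
        case y: False
        hence my: "?m y = 0" using r power_mono[of r "norm (y - p)" 2] by simp
        have "\<bar>?m x - ?m y\<bar> = r\<^sup>2 - (norm (x - p))\<^sup>2"
          unfolding mx my using power_mono[OF True, of 2] by simp
        also have "\<dots> = (r - norm (x - p)) * (r + norm (x - p))"
          by (simp add: algebra_simps power2_eq_square)
        also have "\<dots> \<le> norm (x - y) * (2 * r)"
          using True y d r by (intro mult_mono) (auto intro: add_nonneg_nonneg)
        finally show ?thesis by (simp add: mult_ac)
      qed
      have "?m x *\<^sub>R (x - p) - ?m y *\<^sub>R (y - p) = (?m x - ?m y) *\<^sub>R (x - p) + ?m y *\<^sub>R (x - y)"
        by (simp add: algebra_simps)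
      hence "norm (?m x *\<^sub>R (x - p) - ?m y *\<^sub>R (y - p)) \<le> \<bar>?m x - ?m y\<bar> * norm (x - p) + \<bar>?m y\<bar> * norm (x - y)"
        by (metis norm_triangle_ineq norm_scaleR)
      also have "\<dots> \<le> (2 * r * norm (x - y)) * r + r\<^sup>2 * norm (x - y)"
        using mm True m1 r by (intro add_mono mult_mono) auto
      finally show ?thesis by (simp add: power2_eq_square algebra_simps)
    next
      case False
      hence "r\<^sup>2 \<le> (norm (x - p))\<^sup>2" "r\<^sup>2 \<le> (norm (y - p))\<^sup>2" using r le by (auto intro!: power_mono)
      thus ?thesis by simp
    qed
    have "norm (?m x *\<^sub>R (x - p) - ?m y *\<^sub>R (y - p)) \<le> 3 * r\<^sup>2 * norm (x - y)"
      using one[of x y] one[of y x] by (cases "norm (x - p) \<le> norm (y - p)") (auto simp: norm_minus_commute)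
    moreover have "(- 4 * ?m x) *\<^sub>R (x - p) - (- 4 * ?m y) *\<^sub>R (y - p) = (-4) *\<^sub>R (?m x *\<^sub>R (x - p) - ?m y *\<^sub>R (y - p))"
      by (simp add: scaleR_diff_right)
    ultimately show "dist ((- 4 * ?m x) *\<^sub>R (x - p)) ((- 4 * ?m y) *\<^sub>R (y - p)) \<le> 12 * r\<^sup>2 * dist x y"
      by (simp only: dist_norm norm_scaleR)
  qed simp
qed


section \<open>Weak limits at a collision\<close>

text \<open>Compactness of the one-point compactification. Escape to infinity is harmless later on,
  since functions in \<open>C0\<close> tend to 0 there.\<close>

lemma subsequence_converges_or_diverges:
  fixes X :: "nat \<Rightarrow> 'a::euclidean_space"
  obtains r :: "nat \<Rightarrow> nat" where "strict_mono r"
    "(\<exists>l. (\<lambda>n. X (r n)) \<longlonglongrightarrow> l) \<or> filterlim (\<lambda>n. X (r n)) at_infinity sequentially"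
proof (cases "filterlim X at_infinity sequentially")
  case True
  thus ?thesis using that[of id] by (simp add: strict_mono_def)
next
  case False
  then obtain b where "\<not> (\<forall>\<^sub>F n in sequentially. b \<le> norm (X n))"
    using filterlim_at_infinity[of 0 X sequentially] by auto
  hence "\<exists>\<^sub>F n in sequentially. norm (X n) < b" by (simp add: frequently_def not_less)
  hence "infinite {n. norm (X n) < b}"
    by (simp add: INFM_iff_infinite cofinite_eq_sequentially[symmetric])
  then obtain r :: "nat \<Rightarrow> nat" where r: "strict_mono r" "\<And>n. r n \<in> {n. norm (X n) < b}"
    using infinite_enumerate by blast
  have "\<forall>n. X (r n) \<in> cball 0 b" using r(2) by (auto simp: less_imp_le)
  then obtain l r' where "strict_mono (r' :: nat \<Rightarrow> nat)" "((\<lambda>n. X (r n)) \<circ> r') \<longlonglongrightarrow> l"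
    using compact_cball[of "0::'a" b, unfolded compact_def, rule_format, of "\<lambda>n. X (r n)"] by blast
  thus ?thesis using that[of "\<lambda>n. r (r' n)"] strict_mono_o[OF r(1), of r'] by (auto simp: o_def)
qed

lemma subsequence_converges_or_diverges_finite:
  fixes X :: "nat \<Rightarrow> 'b \<Rightarrow> 'a::euclidean_space"
  assumes "finite J"
  shows "\<exists>r :: nat \<Rightarrow> nat. strict_mono r \<and> (\<forall>j\<in>J.
    (\<exists>l. (\<lambda>n. X (r n) j) \<longlonglongrightarrow> l) \<or> filterlim (\<lambda>n. X (r n) j) at_infinity sequentially)"
  using assms
proof induction
  case empty
  show ?case by (rule exI[of _ id]) (simp add: strict_mono_def)
next
  case (insert i J)
  then obtain r :: "nat \<Rightarrow> nat" where r: "strict_mono r" "\<And>j. j \<in> J \<Longrightarrow>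
    (\<exists>l. (\<lambda>n. X (r n) j) \<longlonglongrightarrow> l) \<or> filterlim (\<lambda>n. X (r n) j) at_infinity sequentially" by blast
  obtain r' :: "nat \<Rightarrow> nat" where r': "strict_mono r'"
    "(\<exists>l. (\<lambda>n. X (r (r' n)) i) \<longlonglongrightarrow> l) \<or> filterlim (\<lambda>n. X (r (r' n)) i) at_infinity sequentially"
    using subsequence_converges_or_diverges[of "\<lambda>n. X (r n) i"] by blast
  have "(\<exists>l. (\<lambda>n. X (r (r' n)) j) \<longlonglongrightarrow> l) \<or> filterlim (\<lambda>n. X (r (r' n)) j) at_infinity sequentially"
    if "j \<in> J" for j
    using r(2)[OF that] LIMSEQ_subseq_LIMSEQ[OF _ r'(1), of "\<lambda>n. X (r n) j"]
      filterlim_compose[OF _ filterlim_subseq[OF r'(1)], of "\<lambda>n. X (r n) j"] by (auto simp: o_def)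
  with r r' strict_mono_o[OF r(1) r'(1), unfolded o_def] show ?case by (intro exI[of _ "\<lambda>n. r (r' n)"]) auto
qed

text \<open>Atoms are indexed by their positions and may have weight zero: vortices with the same
  limit are grouped, and their intensities may cancel.\<close>

definition weighted_config :: "(real^2) set \<Rightarrow> (real^2 \<Rightarrow> real) \<Rightarrow> (real^2) set \<Rightarrow> real" where
  "weighted_config P w = (\<lambda>A. \<Sum>p\<in>P. w p * dirac p A)"

lemma weighted_config_in_configs_N:
  assumes "finite P"
  shows "weighted_config P w \<in> configs_N (card {p \<in> P. w p \<noteq> 0})"
proof -
  let ?Q = "{p \<in> P. w p \<noteq> 0}"
  have "finite ?Q" using assms by simp
  then obtain z where z: "bij_betw z {1..card ?Q} ?Q"
    using ex_bij_betw_nat_finite_1 by blast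
  have "weighted_config P w A = vortex_config (card ?Q) (\<lambda>j. w (z j)) z A" for A
  proof -
    have "weighted_config P w A = (\<Sum>p\<in>?Q. w p * dirac p A)"
      unfolding weighted_config_def using assms by (intro sum.mono_neutral_right) auto
    also have "\<dots> = (\<Sum>j=1..card ?Q. w (z j) * dirac (z j) A)"
      by (rule sum.reindex_bij_betw[OF z, symmetric])
    finally show ?thesis by (simp add: vortex_config_def)
  qed
  moreover have "w (z j) \<noteq> 0" if "j \<in> {1..card ?Q}" for j
    using z that unfolding bij_betw_def by blast
  ultimately show ?thesis
    using z unfolding configs_N_def bij_betw_def by (intro CollectI exI[of _ "\<lambda>j. w (z j)"] exI[of _ z]) auto
qed

lemma pairing_weighted_config:
  "finite P \<Longrightarrow> f \<in> C0 \<Longrightarrow> pairing f (weighted_config P w) = (\<Sum>p\<in>P. w p * f p)"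
  unfolding weighted_config_def by (intro pairing_sum_dirac[where z = "\<lambda>p. p"] C0_borel_measurable) auto

text \<open>A radius not exceeding the distance from q to the other points makes the bump at q see q
  alone.\<close>

lemma bump_separates:
  assumes P: "finite P" and 0: "\<And>q r. r > 0 \<Longrightarrow> (\<Sum>p\<in>P. w p * bump q r p) = 0" and q: "q \<in> P"
  shows "w q = 0"
proof -
  have "\<exists>r>0. \<forall>p\<in>P. p \<noteq> q \<longrightarrow> r \<le> dist q p" using finite_set_avoid[OF P, of q] by (auto simp: dist_commute)
  then obtain r where r: "r > 0" "\<And>p. p \<in> P \<Longrightarrow> p \<noteq> q \<Longrightarrow> r \<le> norm (p - q)"
    by (auto simp: dist_norm norm_minus_commute)
  have "bump q r p = 0" if "p \<in> P" "p \<noteq> q" for p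
    using power_mono[OF r(2)[OF that], of 2] r(1) by (simp add: bump_def max_def)
  hence "(\<Sum>p\<in>P. w p * bump q r p) = w q * bump q r q"
    using P q by (subst sum.remove[OF P q]) (auto intro: sum.neutral)
  moreover have "bump q r q > 0" using r(1) by (simp add: bump_def)
  ultimately show ?thesis using 0[OF r(1), of q] by simp
qed

text \<open>Limits along different sequences can be compared directly only for C11 functions, where
  pairings are Lipschitz in time. This transfers the agreement to all functions.\<close>

lemma weighted_sums_eq:
  assumes P: "finite P" "finite P'"
    and eq: "\<And>q r. r > 0 \<Longrightarrow> (\<Sum>p\<in>P. w p * bump q r p) = (\<Sum>p\<in>P'. w' p * bump q r p)"
  shows "(\<Sum>p\<in>P. w p * f p) = (\<Sum>p\<in>P'. w' p * f p)"
proof -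
  define v where "v p = (if p \<in> P then w p else 0) - (if p \<in> P' then w' p else 0)" for p
  have s: "(\<Sum>p\<in>P. w p * f p) - (\<Sum>p\<in>P'. w' p * f p) = (\<Sum>p\<in>P \<union> P'. v p * f p)" for f
  proof -
    have "(\<Sum>p\<in>P. w p * f p) = (\<Sum>p\<in>P \<union> P'. (if p \<in> P then w p else 0) * f p)"
      using P by (intro sum.mono_neutral_cong_left) auto
    moreover have "(\<Sum>p\<in>P'. w' p * f p) = (\<Sum>p\<in>P \<union> P'. (if p \<in> P' then w' p else 0) * f p)"
      using P by (intro sum.mono_neutral_cong_left) auto
    ultimately show ?thesis by (simp add: v_def left_diff_distrib sum_subtractf)
  qed
  have "v p = 0" if "p \<in> P \<union> P'" for p
    by (rule bump_separates[OF _ _ that]) (use P eq s[symmetric] in auto)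
  hence "(\<Sum>p\<in>P \<union> P'. v p * f p) = 0" by (intro sum.neutral) auto
  thus ?thesis using s[of f] by simp
qed

text \<open>The lower limit of the smallest distance at T is 0. No particular pair is asked to meet,
  and the positions need not converge.\<close>

abbreviation collides :: "nat \<Rightarrow> real \<Rightarrow> (real \<Rightarrow> nat \<Rightarrow> real^2) \<Rightarrow> bool" where
  "collides N T x \<equiv> \<forall>\<eta>>0. \<forall>\<tau><T.
    \<exists>t i j. \<tau> < t \<and> 0 < t \<and> t < T \<and> i \<in> {1..N} \<and> j \<in> {1..N} \<and> i \<noteq> j \<and> norm (x t i - x t j) < \<eta>"

text \<open>Positions may oscillate near T, but pairings with C11 functions are uniformly Lipschitz
  in time. One sequence of times with vanishing smallest distance therefore determines the limit,
  and along it some limit positions coincide or are lost.\<close>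

lemma collision_limit:
  fixes x :: "real \<Rightarrow> nat \<Rightarrow> real^2"
  assumes \<xi>: "\<forall>j\<in>{1..N}. \<xi> j \<noteq> 0" and T: "T > 0"
    and x: "\<And>t. t \<in> {0<..<T} \<Longrightarrow> inj_on (x t) {1..N}"
      "\<And>t j. t \<in> {0<..<T} \<Longrightarrow> j \<in> {1..N} \<Longrightarrow> ((\<lambda>s. x s j) has_vector_derivative velocity N \<xi> (x t) j) (at t)"
    and coll: "collides N T x"
  shows "\<exists>M<N. \<exists>\<mu>\<in>configs_N M. \<forall>f\<in>C0. ((\<lambda>t. pairing f (vortex_config N \<xi> (x t))) \<longlongrightarrow> pairing f \<mu>) (at_left T)"
proof -
  define S where "S f t = (\<Sum>j=1..N. \<xi> j * f (x t j))" for f t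
  have "\<exists>B\<ge>0. \<forall>s\<in>{0<..<T}. \<forall>t\<in>{0<..<T}. \<bar>S \<phi> s - S \<phi> t\<bar> \<le> B * \<bar>s - t\<bar>" if \<phi>: "\<phi> \<in> C11" for \<phi>
  proof -
    obtain B where B: "B \<ge> 0" "\<And>x. inj_on x {1..N} \<Longrightarrow> \<forall>j\<in>{1..N}. \<xi> j \<noteq> 0 \<Longrightarrow>
      \<bar>interaction \<phi> (vortex_config N \<xi> x)\<bar> \<le> B"
      using pairing_diamond_bounded[OF \<phi>] by blast
    have "norm (S \<phi> s - S \<phi> t) \<le> B * norm (s - t)" if "s \<in> {0<..<T}" "t \<in> {0<..<T}" for s t
    proof (rule field_differentiable_bound[of "{0<..<T}" "S \<phi>" "\<lambda>t. interaction \<phi> (vortex_config N \<xi> (x t))"])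
      fix u assume u: "u \<in> {0<..<T}"
      have "(S \<phi> has_vector_derivative interaction \<phi> (vortex_config N \<xi> (x u))) (at u)"
        unfolding S_def by (rule has_vector_derivative_pairing[OF \<xi> x(1)[OF u] \<phi> x(2)[OF u]])
      thus "(S \<phi> has_field_derivative interaction \<phi> (vortex_config N \<xi> (x u))) (at u within {0<..<T})"
        by (simp add: has_real_derivative_iff_has_vector_derivative has_vector_derivative_at_within)
      show "norm (interaction \<phi> (vortex_config N \<xi> (x u))) \<le> B"
        using B(2)[OF x(1)[OF u] \<xi>] by simp
    qed (use that in auto)
    thus ?thesis using B(1) by auto
  qed
  hence Lip: "(\<lambda>n. S \<phi> (s n) - S \<phi> (s' n)) \<longlonglongrightarrow> 0"
    if \<phi>: "\<phi> \<in> C11" and s: "\<And>n. s n \<in> {0<..<T}" "\<And>n. s' n \<in> {0<..<T}" "s \<longlonglongrightarrow> T" "s' \<longlonglongrightarrow> T" for \<phi> s s'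
  proof -
    obtain B where B: "\<And>s t. s \<in> {0<..<T} \<Longrightarrow> t \<in> {0<..<T} \<Longrightarrow> \<bar>S \<phi> s - S \<phi> t\<bar> \<le> B * \<bar>s - t\<bar>"
      using \<open>\<And>\<phi>. \<phi> \<in> C11 \<Longrightarrow> _\<close>[OF \<phi>] by blast
    have "(\<lambda>n. B * \<bar>s n - s' n\<bar>) \<longlonglongrightarrow> B * \<bar>T - T\<bar>" by (intro tendsto_intros s)
    hence "(\<lambda>n. B * \<bar>s n - s' n\<bar>) \<longlonglongrightarrow> 0" by simp
    thus ?thesis by (rule Lim_null_comparison[rotated]) (use B s in auto)
  qed
  \<comment> \<open>Along a subsequence every vortex settles or escapes. \<open>A\<close> collects
    those that settle, and grouping them by limit point gives the limit measure.\<close>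
  have sub: "\<exists>(r :: nat \<Rightarrow> nat) A \<zeta>. strict_mono r \<and> A \<subseteq> {1..N} \<and> (\<forall>j\<in>A. (\<lambda>n. x (s (r n)) j) \<longlonglongrightarrow> \<zeta> j) \<and>
      (\<forall>f\<in>C0. (\<lambda>n. S f (s (r n))) \<longlonglongrightarrow> (\<Sum>p\<in>\<zeta> ` A. (\<Sum>j | j \<in> A \<and> \<zeta> j = p. \<xi> j) * f p))" for s
  proof -
    obtain r :: "nat \<Rightarrow> nat" where r: "strict_mono r" "\<And>j. j \<in> {1..N} \<Longrightarrow>
      (\<exists>l. (\<lambda>n. x (s (r n)) j) \<longlonglongrightarrow> l) \<or> filterlim (\<lambda>n. x (s (r n)) j) at_infinity sequentially"
      using subsequence_converges_or_diverges_finite[of "{1..N}" "\<lambda>n. x (s n)"] by auto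
    define A where "A = {j \<in> {1..N}. \<exists>l. (\<lambda>n. x (s (r n)) j) \<longlonglongrightarrow> l}"
    define \<zeta> where "\<zeta> j = lim (\<lambda>n. x (s (r n)) j)" for j
    have \<zeta>: "(\<lambda>n. x (s (r n)) j) \<longlonglongrightarrow> \<zeta> j" if "j \<in> A" for j
      using that by (auto simp: A_def \<zeta>_def limI)
    have fA: "finite A" by (simp add: A_def)
    have "(\<lambda>n. S f (s (r n))) \<longlonglongrightarrow> (\<Sum>p\<in>\<zeta> ` A. (\<Sum>j | j \<in> A \<and> \<zeta> j = p. \<xi> j) * f p)" if f: "f \<in> C0" for f
    proof -
      have "(\<lambda>n. f (x (s (r n)) j)) \<longlonglongrightarrow> (if j \<in> A then f (\<zeta> j) else 0)" if j: "j \<in> {1..N}" for j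
      proof (cases "j \<in> A")
        case True
        have "isCont f (\<zeta> j)" using f by (auto simp: C0_def continuous_on_eq_continuous_at)
        from isCont_tendsto_compose[OF this \<zeta>[OF True]] True show ?thesis by simp
      next
        case False
        hence "filterlim (\<lambda>n. x (s (r n)) j) at_infinity sequentially" using r(2)[OF j] j by (auto simp: A_def)
        moreover have "(f \<longlongrightarrow> 0) at_infinity" using f by (simp add: C0_def)
        ultimately show ?thesis using False filterlim_compose[of f "nhds 0" at_infinity] by simp
      qed
      hence "(\<lambda>n. S f (s (r n))) \<longlonglongrightarrow> (\<Sum>j=1..N. \<xi> j * (if j \<in> A then f (\<zeta> j) else 0))"
        unfolding S_def by (intro tendsto_sum tendsto_mult_left) auto
      also have "(\<Sum>j=1..N. \<xi> j * (if j \<in> A then f (\<zeta> j) else 0)) = (\<Sum>j\<in>A. \<xi> j * f (\<zeta> j))"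
        by (rule sum.mono_neutral_cong_right) (auto simp: A_def)
      also have "\<dots> = (\<Sum>p\<in>\<zeta> ` A. \<Sum>j | j \<in> A \<and> \<zeta> j = p. \<xi> j * f (\<zeta> j))"
        by (rule sum.image_gen[OF fA])
      also have "\<dots> = (\<Sum>p\<in>\<zeta> ` A. (\<Sum>j | j \<in> A \<and> \<zeta> j = p. \<xi> j) * f p)"
        by (intro sum.cong refl) (auto simp: sum_distrib_right intro: sum.cong)
      finally show ?thesis .
    qed
    moreover have "A \<subseteq> {1..N}" by (auto simp: A_def)
    ultimately show ?thesis using r(1) \<zeta> by blast
  qed
  have "\<exists>t. t \<in> {0<..<T} \<and> T - 1 / Suc n < t \<and>
      (\<exists>i j. i \<in> {1..N} \<and> j \<in> {1..N} \<and> i \<noteq> j \<and> norm (x t i - x t j) < 1 / Suc n)" for n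
    using coll[rule_format, of "1 / Suc n" "T - 1 / Suc n"] by (auto simp: greaterThanLessThan_iff)
  then obtain s0 where s0: "\<And>n. s0 n \<in> {0<..<T}" "\<And>n. T - 1 / Suc n < s0 n"
    "\<And>n. \<exists>i j. i \<in> {1..N} \<and> j \<in> {1..N} \<and> i \<noteq> j \<and> norm (x (s0 n) i - x (s0 n) j) < 1 / Suc n" by metis
  have s0lim: "s0 \<longlonglongrightarrow> T"
  proof (rule tendsto_sandwich)
    have "(\<lambda>n. T - 1 / Suc n) \<longlonglongrightarrow> T - 0" by (intro tendsto_intros LIMSEQ_Suc lim_1_over_n)
    thus "(\<lambda>n. T - 1 / Suc n) \<longlonglongrightarrow> T" by simp
    show "\<forall>\<^sub>F n in sequentially. s0 n \<le> T" "\<forall>\<^sub>F n in sequentially. T - 1 / real (Suc n) \<le> s0 n"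
      using s0 by (auto intro!: always_eventually less_imp_le)
  qed auto
  obtain r :: "nat \<Rightarrow> nat" and A \<zeta> where r: "strict_mono r" and A: "A \<subseteq> {1..N}"
    and \<zeta>: "\<And>j. j \<in> A \<Longrightarrow> (\<lambda>n. x (s0 (r n)) j) \<longlonglongrightarrow> \<zeta> j"
    and lim: "\<And>f. f \<in> C0 \<Longrightarrow> (\<lambda>n. S f (s0 (r n))) \<longlonglongrightarrow> (\<Sum>p\<in>\<zeta> ` A. (\<Sum>j | j \<in> A \<and> \<zeta> j = p. \<xi> j) * f p)"
    using sub[of s0] by blast
  have fA: "finite A" using A finite_subset by blast
  define w where "w p = (\<Sum>j | j \<in> A \<and> \<zeta> j = p. \<xi> j)" for p
  define \<mu> where "\<mu> = weighted_config (\<zeta> ` A) w"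
  let ?M = "card {p \<in> \<zeta> ` A. w p \<noteq> 0}"
  have "?M \<le> card (\<zeta> ` A)" using fA by (intro card_mono) auto
  also have "\<dots> < N"
  proof (rule ccontr)
    \<comment> \<open>N distinct finite limits would keep all distances bounded below along the
      subsequence of \<open>s0\<close>, against the choice of \<open>s0\<close>.\<close>
    assume "\<not> card (\<zeta> ` A) < N"
    moreover have "card (\<zeta> ` A) \<le> card A" "card A \<le> N" using fA card_image_le card_mono[OF _ A] by auto
    ultimately have c: "card (\<zeta> ` A) = card A" "card A = card {1..N}" by auto
    have inj: "inj_on \<zeta> A" using c fA by (simp add: eq_card_imp_inj_on)
    have AN: "A = {1..N}" using c A by (intro card_subset_eq) auto
    have "\<forall>\<^sub>F n in sequentially. \<forall>p\<in>{(i, j). i \<in> A \<and> j \<in> A \<and> i \<noteq> j}. 1 / Suc n < norm (x (s0 (r n)) (fst p) - x (s0 (r n)) (snd p))"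
    proof (rule eventually_ball_finite)
      show "finite {(i, j). i \<in> A \<and> j \<in> A \<and> i \<noteq> j}"
        by (rule finite_subset[of _ "A \<times> A"]) (use fA in auto)
      show "\<forall>p\<in>{(i, j). i \<in> A \<and> j \<in> A \<and> i \<noteq> j}. \<forall>\<^sub>F n in sequentially. 1 / Suc n < norm (x (s0 (r n)) (fst p) - x (s0 (r n)) (snd p))"
      proof clarify
        fix i j assume ij: "i \<in> A" "j \<in> A" "i \<noteq> j"
        have "(\<lambda>n. norm (x (s0 (r n)) i - x (s0 (r n)) j) - 1 / Suc n) \<longlonglongrightarrow> norm (\<zeta> i - \<zeta> j) - 0"
          by (intro tendsto_intros LIMSEQ_Suc lim_1_over_n \<zeta> ij)
        moreover have "norm (\<zeta> i - \<zeta> j) - 0 > 0" using ij inj by (auto simp: inj_on_def)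
        ultimately have "\<forall>\<^sub>F n in sequentially. norm (x (s0 (r n)) i - x (s0 (r n)) j) - 1 / Suc n > 0"
          by (rule order_tendstoD(1))
        thus "\<forall>\<^sub>F n in sequentially. 1 / Suc n < norm (x (s0 (r n)) (fst (i, j)) - x (s0 (r n)) (snd (i, j)))"
          by eventually_elim simp
      qed
    qed
    then obtain n where n: "\<And>i j. i \<in> A \<Longrightarrow> j \<in> A \<Longrightarrow> i \<noteq> j \<Longrightarrow> 1 / Suc n < norm (x (s0 (r n)) i - x (s0 (r n)) j)"
      by (auto simp: eventually_sequentially)
    obtain i j where ij: "i \<in> {1..N}" "j \<in> {1..N}" "i \<noteq> j" "norm (x (s0 (r n)) i - x (s0 (r n)) j) < 1 / Suc (r n)"
      using s0(3) by blast
    \<comment> \<open>r n \<ge> n, so the bound guaranteed at index r n is no larger than the one at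
      n.\<close>
    have "1 / real (Suc (r n)) \<le> 1 / Suc n" using seq_suble[OF r, of n] by (intro divide_left_mono) auto
    thus False using n[of i j] ij AN by auto
  qed
  finally have M: "?M < N" .
  have "((\<lambda>t. pairing f (vortex_config N \<xi> (x t))) \<longlongrightarrow> pairing f \<mu>) (at_left T)" if f: "f \<in> C0" for f
  proof (rule tendsto_at_left_sequentially[of 0])
    show "0 < T" by fact
    fix s assume s: "\<And>n. s n < T" "\<And>n. 0 < s n" "s \<longlonglongrightarrow> T"
    have P: "pairing f (vortex_config N \<xi> (x (s n))) = S f (s n)" for n
      unfolding S_def by (rule pairing_vortex_config) (use s f x(1) in auto)
    have Pm: "pairing f \<mu> = (\<Sum>p\<in>\<zeta> ` A. w p * f p)"
      unfolding \<mu>_def using fA f by (simp add: pairing_weighted_config)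
    have "(\<lambda>n. S f (s n)) \<longlonglongrightarrow> (\<Sum>p\<in>\<zeta> ` A. w p * f p)"
    \<comment> \<open>Times at which the pairing stays away from the claimed limit have a
      subsequence with a limit measure of their own; testing with bumps identifies it with the
      measure already found.\<close>
    proof (rule ccontr)
      assume "\<not> ?thesis"
      then obtain e where e: "e > 0" "\<not> (\<forall>\<^sub>F n in sequentially. dist (S f (s n)) (\<Sum>p\<in>\<zeta> ` A. w p * f p) < e)"
        by (auto simp: tendsto_iff)
      hence "\<exists>\<^sub>F n in sequentially. e \<le> dist (S f (s n)) (\<Sum>p\<in>\<zeta> ` A. w p * f p)" by (simp add: frequently_def not_le)
      hence "infinite {n. e \<le> dist (S f (s n)) (\<Sum>p\<in>\<zeta> ` A. w p * f p)}"
        by (simp add: INFM_iff_infinite cofinite_eq_sequentially[symmetric])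
      then obtain q :: "nat \<Rightarrow> nat" where q: "strict_mono q" "\<And>n. q n \<in> {n. e \<le> dist (S f (s n)) (\<Sum>p\<in>\<zeta> ` A. w p * f p)}"
        using infinite_enumerate by blast
      obtain r' :: "nat \<Rightarrow> nat" and A' \<zeta>' where r': "strict_mono r'" and A': "A' \<subseteq> {1..N}"
        and lim': "\<And>f. f \<in> C0 \<Longrightarrow> (\<lambda>n. S f (s (q (r' n)))) \<longlonglongrightarrow> (\<Sum>p\<in>\<zeta>' ` A'. (\<Sum>j | j \<in> A' \<and> \<zeta>' j = p. \<xi> j) * f p)"
        using sub[of "\<lambda>n. s (q n)"] by blast
      have fA': "finite A'" using A' finite_subset by blast
      have "(\<Sum>p\<in>\<zeta>' ` A'. (\<Sum>j | j \<in> A' \<and> \<zeta>' j = p. \<xi> j) * f p) = (\<Sum>p\<in>\<zeta> ` A. w p * f p)"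
      proof (rule weighted_sums_eq)
        fix a and \<rho> :: real assume "\<rho> > 0"
        hence b: "bump a \<rho> \<in> C11" by (rule bump_C11)
        hence b0: "bump a \<rho> \<in> C0" by (simp add: C11_def)
        have "(\<lambda>n. S (bump a \<rho>) (s (q (r' n))) - S (bump a \<rho>) (s0 (r n))) \<longlonglongrightarrow> 0"
        proof (rule Lip[OF b])
          show "(\<lambda>n. s (q (r' n))) \<longlonglongrightarrow> T" "(\<lambda>n. s0 (r n)) \<longlonglongrightarrow> T"
            using LIMSEQ_subseq_LIMSEQ[OF s(3) strict_mono_o[OF q(1) r']] LIMSEQ_subseq_LIMSEQ[OF s0lim r]
            by (auto simp: o_def)
        qed (use s s0 in auto)
        moreover have "(\<lambda>n. S (bump a \<rho>) (s (q (r' n))) - S (bump a \<rho>) (s0 (r n))) \<longlonglongrightarrow>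
           (\<Sum>p\<in>\<zeta>' ` A'. (\<Sum>j | j \<in> A' \<and> \<zeta>' j = p. \<xi> j) * bump a \<rho> p) - (\<Sum>p\<in>\<zeta> ` A. w p * bump a \<rho> p)"
          unfolding w_def by (intro tendsto_diff lim lim' b0)
        ultimately show "(\<Sum>p\<in>\<zeta>' ` A'. (\<Sum>j | j \<in> A' \<and> \<zeta>' j = p. \<xi> j) * bump a \<rho> p) = (\<Sum>p\<in>\<zeta> ` A. w p * bump a \<rho> p)"
          using LIMSEQ_unique by fastforce
      qed (use fA fA' in auto)
      with lim'[OF f] have "(\<lambda>n. S f (s (q (r' n)))) \<longlonglongrightarrow> (\<Sum>p\<in>\<zeta> ` A. w p * f p)" by simp
      from tendstoD[OF this e(1)] obtain n where "dist (S f (s (q (r' n)))) (\<Sum>p\<in>\<zeta> ` A. w p * f p) < e"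
        by (auto simp: eventually_sequentially)
      thus False using q(2)[of "r' n"] by simp
    qed
    thus "(\<lambda>n. pairing f (vortex_config N \<xi> (x (s n)))) \<longlonglongrightarrow> pairing f \<mu>" by (simp add: P Pm)
  qed
  moreover have "\<mu> \<in> configs_N ?M" unfolding \<mu>_def by (rule weighted_config_in_configs_N) (use fA in simp)
  ultimately show ?thesis using M by blast
qed


section \<open>The motion up to the first collision\<close>

definition plane_of :: "complex \<Rightarrow> real^2" where "plane_of w = vector [Re w, Im w]"
definition complex_of_plane :: "real^2 \<Rightarrow> complex" where "complex_of_plane v = Complex (v $ 1) (v $ 2)"

lemma plane_of_nth [simp]: "plane_of w $ 1 = Re w" "plane_of w $ 2 = Im w"
  by (auto simp: plane_of_def)

lemma plane_of_complex_of_plane [simp]: "plane_of (complex_of_plane v) = v"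
  by (simp add: vec_eq_iff forall_2 complex_of_plane_def)

lemma complex_of_plane_plane_of [simp]: "complex_of_plane (plane_of w) = w"
  by (simp add: complex_of_plane_def)

lemma norm_plane_of [simp]: "norm (plane_of w) = cmod w"
  by (simp add: norm_vec_def L2_set_def sum_2 cmod_def)

lemma bounded_linear_plane_of: "bounded_linear plane_of"
  by (rule bounded_linear_intro[where K = 1]) (auto simp: vec_eq_iff forall_2 norm_vec_def L2_set_def sum_2 cmod_def)

lemma plane_of_diff: "plane_of (a - b) = plane_of a - plane_of b"
  by (simp add: vec_eq_iff forall_2)

lemma plane_of_eq_iff [simp]: "plane_of a = plane_of b \<longleftrightarrow> a = b"
  by (metis complex_of_plane_plane_of)

text \<open>The Biot-Savart kernel in complex notation, \<i> w / (2 pi |w|^2). Its value at 0 is 0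
  by the convention for division.\<close>

definition kern :: "complex \<Rightarrow> complex" where "kern w = \<i> / (2 * pi * cnj w)"

lemma biot_savart_plane_of: "biot_savart (plane_of w) = plane_of (kern w)"
proof -
  have "kern w = (\<i> * w) / (2 * pi * (w * cnj w))"
    by (simp add: kern_def)
  also have "\<dots> = (1 / (2 * pi * (cmod w)\<^sup>2)) *\<^sub>R (\<i> * w)"
  proof -
    have "complex_of_real (1 / (2 * pi * (cmod w)\<^sup>2)) = 1 / (2 * pi * complex_of_real ((cmod w)\<^sup>2))"
      by (simp only: of_real_divide of_real_mult of_real_1 of_real_numeral)
    thus ?thesis unfolding scaleR_conv_of_real complex_norm_square by (simp only:) simp
  qed
  finally have "kern w = (1 / (2 * pi * (cmod w)\<^sup>2)) *\<^sub>R (\<i> * w)" .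
  hence k: "plane_of (kern w) = (1 / (2 * pi * (cmod w)\<^sup>2)) *\<^sub>R plane_of (\<i> * w)"
    by (simp only: linear_cmul[OF bounded_linear.linear[OF bounded_linear_plane_of]])
  have p: "perp (plane_of w) = plane_of (\<i> * w)"
    by (simp add: perp_def vec_eq_iff forall_2 vector_2)
  have v: "(1 / (2 * pi)) *\<^sub>R (v /\<^sub>R (cmod w)\<^sup>2) = (1 / (2 * pi * (cmod w)\<^sup>2)) *\<^sub>R v" for v :: "real^2"
    by (simp only: scaleR_scaleR inverse_eq_divide times_divide_times_eq mult_1)
  show ?thesis
    unfolding biot_savart_def norm_plane_of p v k by (rule refl)
qed

lemma kern_0 [simp]: "kern 0 = 0" by (simp add: kern_def)

definition cvel :: "nat \<Rightarrow> (nat \<Rightarrow> real) \<Rightarrow> (nat \<Rightarrow> complex) \<Rightarrow> nat \<Rightarrow> complex" where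
  "cvel N \<xi> z j = (\<Sum>k=1..N. \<xi> k *\<^sub>R kern (z j - z k))"

lemma velocity_plane_of: "velocity N \<xi> (\<lambda>j. plane_of (z j)) j = plane_of (cvel N \<xi> z j)"
proof -
  interpret bounded_linear plane_of by (rule bounded_linear_plane_of)
  show ?thesis
    by (simp add: velocity_def cvel_def sum scaleR biot_savart_plane_of flip: diff)
qed

text \<open>Inserting 1 keeps the minimum meaningful for N \<le> 1 and bounds by 1 the squared
  separation, which later governs the change of time.\<close>

definition separation :: "nat \<Rightarrow> (nat \<Rightarrow> complex) \<Rightarrow> real" where
  "separation N z = Min (insert 1 ((\<lambda>(i, j). cmod (z i - z j)) ` {(i, j) \<in> {1..N} \<times> {1..N}. i \<noteq> j}))"

lemma finite_off_diagonal: "finite {(i, j) \<in> {1..N::nat} \<times> {1..N}. i \<noteq> j}"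
  by (rule finite_subset[of _ "{1..N} \<times> {1..N}"]) auto

lemma separation_le_1: "separation N z \<le> 1"
  unfolding separation_def using finite_off_diagonal by (intro Min_le) auto

lemma separation_le: "i \<in> {1..N} \<Longrightarrow> j \<in> {1..N} \<Longrightarrow> i \<noteq> j \<Longrightarrow> separation N z \<le> cmod (z i - z j)"
  unfolding separation_def using finite_off_diagonal by (intro Min_le) force+

lemma separation_geI:
  assumes "c \<le> 1" "\<And>i j. i \<in> {1..N} \<Longrightarrow> j \<in> {1..N} \<Longrightarrow> i \<noteq> j \<Longrightarrow> c \<le> cmod (z i - z j)"
  shows "c \<le> separation N z"
  unfolding separation_def using finite_off_diagonal assms by (subst Min_ge_iff) auto

lemma separation_nonneg: "0 \<le> separation N z" by (rule separation_geI) auto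

lemma separation_pos: "inj_on z {1..N} \<Longrightarrow> 0 < separation N z"
  unfolding separation_def using finite_off_diagonal by (subst Min_gr_iff) (auto dest: inj_onD)

lemma separation_lipschitz:
  assumes "\<And>i. i \<in> {1..N} \<Longrightarrow> cmod (u i - v i) \<le> \<delta>" "\<delta> \<ge> 0"
  shows "\<bar>separation N u - separation N v\<bar> \<le> 2 * \<delta>"
proof -
  have "separation N u - 2 * \<delta> \<le> separation N v"
    if "\<And>i. i \<in> {1..N} \<Longrightarrow> cmod (u i - v i) \<le> \<delta>" for u v
  proof (rule separation_geI)
    show "separation N u - 2 * \<delta> \<le> 1" using separation_le_1[of N u] assms(2) by simp
    fix i j assume ij: "i \<in> {1..N}" "j \<in> {1..N}" "i \<noteq> j"
    have "u i - u j = (v i - v j) + ((u i - v i) - (u j - v j))" by simp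
    hence "cmod (u i - u j) \<le> cmod (v i - v j) + (cmod (u i - v i) + cmod (u j - v j))"
      by (metis norm_triangle_ineq norm_triangle_ineq4 order_trans add_left_mono)
    thus "separation N u - 2 * \<delta> \<le> cmod (v i - v j)"
      using separation_le[OF ij, of u] that[OF ij(1)] that[OF ij(2)] by simp
  qed
  note * = this
  have "separation N u - 2 * \<delta> \<le> separation N v" by (rule *) (rule assms(1))
  moreover have "separation N v - 2 * \<delta> \<le> separation N u"
    by (rule *) (subst norm_minus_commute, rule assms(1))
  ultimately show ?thesis by simp
qed

text \<open>For m \<le> |a| the derivatives 2 m / a and m^2 / a^2 of m^2 / a are bounded by 2 and 1,
  and both increments are at most 2 \<delta>; hence 6 = 2 * 2 + 1 * 2. The case a = 0 is included,
  since then m = 0.\<close>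

lemma regularized_inverse_lipschitz:
  fixes a b :: complex and m n :: real
  assumes m: "0 \<le> m" "m \<le> cmod a" and n: "0 \<le> n" "n \<le> cmod b"
    and mn: "\<bar>m - n\<bar> \<le> 2 * \<delta>" and ab: "cmod (a - b) \<le> 2 * \<delta>"
  shows "cmod (of_real (m\<^sup>2) / a - of_real (n\<^sup>2) / b) \<le> 6 * \<delta>"
proof -
  have \<delta>: "\<delta> \<ge> 0" using mn by simp
  \<comment> \<open>Up to exchanging the roles |b| \<le> |a|, hence also n \<le> |a|.\<close>
  have one: "cmod (of_real (m\<^sup>2) / a - of_real (n\<^sup>2) / b) \<le> 6 * \<delta>"
    if m: "0 \<le> m" "m \<le> cmod a" and n: "0 \<le> n" "n \<le> cmod b" and mn: "\<bar>m - n\<bar> \<le> 2 * \<delta>" and ab: "cmod (a - b) \<le> 2 * \<delta>"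
      and le: "cmod b \<le> cmod a" for a b :: complex and m n
  proof (cases "b = 0")
    case True
    hence "n = 0" using n by simp
    have "cmod (of_real (m\<^sup>2) / a) \<le> m"
      using m by (cases "a = 0") (auto simp: norm_divide norm_mult power2_eq_square field_simps intro: mult_left_mono)
    thus ?thesis using True \<open>n = 0\<close> mn \<delta> by simp
  next
    case False
    hence a: "a \<noteq> 0" using le by auto
    have "of_real (m\<^sup>2) / a - of_real (n\<^sup>2) / b = of_real ((m - n) * (m + n)) / a + of_real (n\<^sup>2) * (b - a) / (a * b)"
      using a False by (simp add: field_simps power2_eq_square)
    hence "cmod (of_real (m\<^sup>2) / a - of_real (n\<^sup>2) / b)
        \<le> cmod (of_real ((m - n) * (m + n)) / a) + cmod (of_real (n\<^sup>2) * (b - a) / (a * b))"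
      by (metis norm_triangle_ineq)
    moreover have "cmod (of_real ((m - n) * (m + n)) / a) \<le> 4 * \<delta>"
    proof -
      have "\<bar>m - n\<bar> * \<bar>m + n\<bar> \<le> (2 * \<delta>) * (2 * cmod a)" using m n le mn by (intro mult_mono) auto
      moreover have "cmod (of_real ((m - n) * (m + n)) / a) = \<bar>m - n\<bar> * \<bar>m + n\<bar> / cmod a"
        by (simp only: norm_divide norm_of_real abs_mult)
      ultimately show ?thesis using a by (simp add: divide_le_eq)
    qed
    moreover have "cmod (of_real (n\<^sup>2) * (b - a) / (a * b)) \<le> 2 * \<delta>"
    proof -
      have "(n * n) * cmod (b - a) \<le> (cmod a * cmod b) * (2 * \<delta>)"
        using n le ab \<delta> by (intro mult_mono) (auto simp: norm_minus_commute)
      moreover have "cmod (of_real (n\<^sup>2) * (b - a) / (a * b)) = (n * n) * cmod (b - a) / (cmod a * cmod b)"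
        by (simp add: norm_divide norm_mult power2_eq_square)
      ultimately show ?thesis using a False by (simp add: divide_le_eq mult_ac)
    qed
    ultimately show ?thesis by simp
  qed
  show ?thesis
  proof (cases "cmod b \<le> cmod a")
    case True
    from one[OF m n mn ab this] show ?thesis .
  next
    case False
    from one[OF n m _ _ ] mn ab False show ?thesis
      by (metis abs_minus_commute le_cases norm_minus_commute)
  qed
qed

lemma continuous_on_sup_lipschitz:
  fixes \<Gamma> :: "(nat \<Rightarrow> complex) \<Rightarrow> complex"
  assumes J: "finite J"
    and lip: "\<And>u v \<delta>. \<delta> \<ge> 0 \<Longrightarrow> (\<And>i. i \<in> J \<Longrightarrow> cmod (u i - v i) \<le> \<delta>) \<Longrightarrow> cmod (\<Gamma> u - \<Gamma> v) \<le> K * \<delta>"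
    and u: "\<And>i. i \<in> J \<Longrightarrow> continuous_on UNIV (u i)"
  shows "continuous_on UNIV (\<lambda>s::real. \<Gamma> (\<lambda>i. u i s))"
  unfolding continuous_on_def
proof
  fix s :: real
  have lim: "((\<lambda>r. u i r) \<longlongrightarrow> u i s) (at s)" if "i \<in> J" for i
    using u[OF that] by (auto simp: continuous_on_def)
  have "((\<lambda>r. K * (\<Sum>i\<in>J. cmod (u i r - u i s))) \<longlongrightarrow> K * (\<Sum>i\<in>J. cmod (u i s - u i s))) (at s)"
    by (intro tendsto_intros lim)
  hence 0: "((\<lambda>r. K * (\<Sum>i\<in>J. cmod (u i r - u i s))) \<longlongrightarrow> 0) (at s)" by simp
  have "((\<lambda>r. \<Gamma> (\<lambda>i. u i r) - \<Gamma> (\<lambda>i. u i s)) \<longlongrightarrow> 0) (at s)"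
  proof (rule Lim_null_comparison[OF always_eventually 0], rule allI)
    fix r
    show "norm (\<Gamma> (\<lambda>i. u i r) - \<Gamma> (\<lambda>i. u i s)) \<le> K * (\<Sum>i\<in>J. cmod (u i r - u i s))"
      by (rule lip) (auto intro!: sum_nonneg member_le_sum J)
  qed
  thus "((\<lambda>s. \<Gamma> (\<lambda>i. u i s)) \<longlongrightarrow> \<Gamma> (\<lambda>i. u i s)) (at s within UNIV)"
    by (simp add: LIM_zero_iff)
qed

text \<open>One power of the separation cancels the singular kernel. The other one remains in the
  norm bound, and it later rules out collisions in the rescaled time.\<close>

lemma regularized_cvel:
  fixes \<xi> :: "nat \<Rightarrow> real" and N :: nat
  defines "X \<equiv> (\<Sum>k=1..N. \<bar>\<xi> k\<bar>)"
  assumes j: "j \<in> {1..N}"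
  shows regularized_cvel_norm: "cmod (of_real ((separation N z)\<^sup>2) * cvel N \<xi> z j) \<le> X * separation N z"
    and regularized_cvel_lipschitz: "(\<And>i. i \<in> {1..N} \<Longrightarrow> cmod (u i - v i) \<le> \<delta>) \<Longrightarrow> \<delta> \<ge> 0 \<Longrightarrow>
      cmod (of_real ((separation N u)\<^sup>2) * cvel N \<xi> u j - of_real ((separation N v)\<^sup>2) * cvel N \<xi> v j) \<le> X * \<delta>"
proof -
  have eq: "of_real ((separation N z)\<^sup>2) * kern (z j - z k) = \<i> / (2 * pi) * cnj (of_real ((separation N z)\<^sup>2) / (z j - z k))" for z k
    by (simp add: kern_def)
  have "of_real ((separation N z)\<^sup>2) * cvel N \<xi> z j = (\<Sum>k=1..N. \<xi> k *\<^sub>R (of_real ((separation N z)\<^sup>2) * kern (z j - z k)))"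
    for z by (simp add: cvel_def sum_distrib_left mult_ac scaleR_conv_of_real)
  note eq2 = this[unfolded eq]
  \<comment> \<open>This absorbs the constant 6 of
    \<open>regularized_inverse_lipschitz\<close>.\<close>
  have pi: "1 / (2 * pi) \<le> 1 / 6" using pi_gt3 by (intro divide_left_mono) auto
  have n: "cmod (\<i> / (2 * pi) * cnj w) \<le> cmod w / 6" for w
  proof -
    have "cmod (\<i> / (2 * pi) * cnj w) = 1 / (2 * pi) * cmod w" by (simp add: norm_mult norm_divide)
    also have "\<dots> \<le> 1 / 6 * cmod w" using pi by (rule mult_right_mono) simp
    finally show ?thesis by simp
  qed
  show "cmod (of_real ((separation N z)\<^sup>2) * cvel N \<xi> z j) \<le> X * separation N z"
    unfolding eq2 X_def sum_distrib_right
  proof (rule order_trans[OF norm_sum sum_mono])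
    fix k assume k: "k \<in> {1..N}"
    have "cmod (of_real ((separation N z)\<^sup>2) / (z j - z k)) \<le> separation N z"
    proof (cases "z j = z k")
      case True
      thus ?thesis using separation_nonneg[of N z] by simp
    next
      case False
      hence "separation N z * separation N z \<le> separation N z * cmod (z j - z k)"
        using separation_le[OF j k] separation_nonneg[of N z] by (intro mult_left_mono) auto
      thus ?thesis using False by (simp add: norm_divide norm_mult power2_eq_square divide_le_eq)
    qed
    hence "cmod (\<i> / (2 * pi) * cnj (of_real ((separation N z)\<^sup>2) / (z j - z k))) \<le> separation N z"
      using n[of "of_real ((separation N z)\<^sup>2) / (z j - z k)"] separation_nonneg[of N z] by linarith
    thus "cmod (\<xi> k *\<^sub>R (\<i> / (2 * pi) * cnj (of_real ((separation N z)\<^sup>2) / (z j - z k)))) \<le> \<bar>\<xi> k\<bar> * separation N z"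
      unfolding norm_scaleR by (intro mult_left_mono) auto
  qed
  assume uv: "\<And>i. i \<in> {1..N} \<Longrightarrow> cmod (u i - v i) \<le> \<delta>" and \<delta>: "\<delta> \<ge> 0"
  show "cmod (of_real ((separation N u)\<^sup>2) * cvel N \<xi> u j - of_real ((separation N v)\<^sup>2) * cvel N \<xi> v j) \<le> X * \<delta>"
    unfolding eq2 X_def sum_distrib_right sum_subtractf[symmetric]
  proof (rule order_trans[OF norm_sum sum_mono])
    fix k assume k: "k \<in> {1..N}"
    let ?a = "of_real ((separation N u)\<^sup>2) / (u j - u k)" and ?b = "of_real ((separation N v)\<^sup>2) / (v j - v k)"
    have "cmod (?a - ?b) \<le> 6 * \<delta>"
    proof (cases "j = k")
      case False
      show ?thesis
      proof (rule regularized_inverse_lipschitz[OF separation_nonneg separation_le[OF j k False] separation_nonneg separation_le[OF j k False]])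
        show "\<bar>separation N u - separation N v\<bar> \<le> 2 * \<delta>" by (rule separation_lipschitz[OF uv \<delta>])
        have "(u j - u k) - (v j - v k) = (u j - v j) - (u k - v k)" by simp
        hence "cmod ((u j - u k) - (v j - v k)) \<le> cmod (u j - v j) + cmod (u k - v k)" by (metis norm_triangle_ineq4)
        thus "cmod ((u j - u k) - (v j - v k)) \<le> 2 * \<delta>" using uv[OF j] uv[OF k] by simp
      qed
    qed (use \<delta> in simp)
    hence "cmod (\<i> / (2 * pi) * cnj ?a - \<i> / (2 * pi) * cnj ?b) \<le> \<delta>"
      using n[of "?a - ?b"] by (simp add: right_diff_distrib)
    thus "cmod (\<xi> k *\<^sub>R (\<i> / (2 * pi) * cnj ?a) - \<xi> k *\<^sub>R (\<i> / (2 * pi) * cnj ?b)) \<le> \<bar>\<xi> k\<bar> * \<delta>"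
      unfolding scaleR_diff_right[symmetric] norm_scaleR by (intro mult_left_mono) auto
  qed
qed


text \<open>
  After multiplication by the squared separation the velocity field is globally Lipschitz, and it is made to
  decay as \<open>s \<rightarrow> -\<infinity>\<close>, where the initial condition sits. The physical time \<open>t\<close> is an additional unknown.
\<close>

lemma regularized_flow:
  fixes \<xi> :: "nat \<Rightarrow> real" and z0 :: "nat \<Rightarrow> complex"
  assumes inj: "inj_on z0 {1..N}"
  shows "\<exists>\<epsilon> R z t. \<epsilon> > 0 \<and>
    (\<forall>s. \<forall>j\<in>{1..N}. cmod (z s j - z0 j) \<le> R * exp s \<and>
       ((\<lambda>s. z s j) has_vector_derivative (min 1 (exp s) * \<epsilon> * (separation N (z s))\<^sup>2) *\<^sub>R cvel N \<xi> (z s) j) (at s)) \<and>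
    (\<forall>s. \<bar>t s\<bar> \<le> R * exp s \<and>
       (t has_real_derivative min 1 (exp s) * \<epsilon> * (separation N (z s))\<^sup>2) (at s)) \<and>
    (\<forall>s. inj_on (z s) {1..N})"
proof -
  define X where "X = (\<Sum>k=1..N. \<bar>\<xi> k\<bar>)"
  have X: "X \<ge> 0" unfolding X_def by (rule sum_nonneg) auto
  \<comment> \<open>Makes the Lipschitz constant 1/2, below the relaxation rate 1 that the weight
    exp s provides.\<close>
  define \<epsilon> where "\<epsilon> = 1 / (2 * (4 + X))"
  have \<epsilon>: "\<epsilon> > 0" "\<epsilon> * (4 + X) = 1/2" using X by (auto simp: \<epsilon>_def field_simps)
  define B where "B = \<epsilon> * (4 + X)"
  \<comment> \<open>exp s gives the decay at minus infinity, and the cap 1 keeps the Lipschitz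
    constant bounded. For s \<ge> 0 the system is autonomous.\<close>
  define \<theta> where "\<theta> s = min 1 (exp s)" for s :: real
  have \<theta>: "0 < \<theta> s" "\<theta> s \<le> 1" "\<theta> s \<le> exp s" for s by (auto simp: \<theta>_def)
  \<comment> \<open>Component 0 is the physical time; components 1 to N are the vortices.\<close>
  define \<Gamma> where "\<Gamma> z j = of_real ((separation N z)\<^sup>2) * (if j = 0 then 1 else cvel N \<xi> z j)" for z j
  define F where "F s u j = (\<theta> s * \<epsilon>) *\<^sub>R \<Gamma> (\<lambda>i. z0 i + u i) j" for s :: real and u :: "nat \<Rightarrow> complex" and j
  have lip: "cmod (\<Gamma> u j - \<Gamma> v j) \<le> (4 + X) * \<delta>"
    if j: "j \<in> {0..N}" and uv: "\<And>i. i \<in> {0..N} \<Longrightarrow> cmod (u i - v i) \<le> \<delta>" and \<delta>: "\<delta> \<ge> 0" for u v j \<delta>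
  proof (cases "j = 0")
    case True
    have "\<bar>separation N u - separation N v\<bar> * \<bar>separation N u + separation N v\<bar> \<le> (2 * \<delta>) * 2"
      using separation_nonneg[of N] separation_le_1[of N u] separation_le_1[of N v] uv \<delta>
      by (intro mult_mono separation_lipschitz) auto
    moreover have "\<Gamma> u j - \<Gamma> v j = of_real ((separation N u - separation N v) * (separation N u + separation N v))"
      using True by (simp add: \<Gamma>_def power2_eq_square algebra_simps)
    hence "cmod (\<Gamma> u j - \<Gamma> v j) = \<bar>separation N u - separation N v\<bar> * \<bar>separation N u + separation N v\<bar>"
      by (simp only: norm_of_real abs_mult)
    ultimately have "cmod (\<Gamma> u j - \<Gamma> v j) \<le> 4 * \<delta>" by simp
    also have "\<dots> \<le> (4 + X) * \<delta>" using X \<delta> by (intro mult_right_mono) auto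
    finally show ?thesis .
  next
    case False
    hence jj: "j \<in> {1..N}" using j by simp
    have "cmod (of_real ((separation N u)\<^sup>2) * cvel N \<xi> u j - of_real ((separation N v)\<^sup>2) * cvel N \<xi> v j) \<le> X * \<delta>"
      unfolding X_def by (rule regularized_cvel_lipschitz[OF jj]) (use uv \<delta> in auto)
    hence "cmod (\<Gamma> u j - \<Gamma> v j) \<le> X * \<delta>" using False by (simp only: \<Gamma>_def if_False)
    also have "\<dots> \<le> (4 + X) * \<delta>" using X \<delta> by (intro mult_right_mono) auto
    finally show ?thesis .
  qed
  have bnd: "cmod (\<Gamma> u j) \<le> 4 + X" if j: "j \<in> {0..N}" for u j
  proof (cases "j = 0")
    case True
    thus ?thesis using separation_le_1[of N u] separation_nonneg[of N u] X
      by (simp add: \<Gamma>_def norm_power power_le_one order_trans[of _ 1])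
  next
    case False
    have "cmod (\<Gamma> u j) \<le> X * separation N u"
      using regularized_cvel_norm[of j N u \<xi>] j False by (simp add: \<Gamma>_def X_def)
    also have "\<dots> \<le> X * 1" using X separation_le_1 by (intro mult_left_mono) auto
    finally show ?thesis by simp
  qed
  have "\<exists>u. \<forall>j\<in>{0..N}. \<forall>s\<in>UNIV. norm (u j s) \<le> 2 * B * exp (1 * s) \<and>
    (u j has_vector_derivative (\<lambda>_. 0) j *\<^sub>R u j s + F s (\<lambda>i. u i s) j) (at s)"
  \<comment> \<open>With L = 1/2 and m = 1 the condition on the ball reads B + R/2 \<le> R, whence R
    = 2 B.\<close>
  proof (rule weighted_ode[where c = "\<lambda>s. s" and L = "1/2" and m = 1 and B = B])
    fix u :: "nat \<Rightarrow> real \<Rightarrow> complex" and j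
    assume u: "\<And>i. i \<in> {0..N} \<Longrightarrow> continuous_on UNIV (u i)" and j: "j \<in> {0..N}"
    have "continuous_on UNIV (\<lambda>s. (\<lambda>u. \<Gamma> (\<lambda>i. z0 i + u i) j) (\<lambda>i. u i s))"
      by (rule continuous_on_sup_lipschitz[where J = "{0..N}" and K = "4 + X"]) (use lip j u in auto)
    thus "continuous_on UNIV (\<lambda>s. F s (\<lambda>i. u i s) j)"
      unfolding F_def \<theta>_def by (intro continuous_intros) auto
  next
    fix s j \<delta> and u v :: "nat \<Rightarrow> complex"
    assume j: "j \<in> {0..N}" and uv: "\<And>i. i \<in> {0..N} \<Longrightarrow> cmod (u i - v i) \<le> \<delta>"
    have \<delta>: "\<delta> \<ge> 0" by (rule order_trans[OF norm_ge_zero uv[of 0]]) simp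
    have "cmod (\<Gamma> (\<lambda>i. z0 i + u i) j - \<Gamma> (\<lambda>i. z0 i + v i) j) \<le> (4 + X) * \<delta>"
      by (rule lip[OF j]) (use uv \<delta> in auto)
    hence "(\<theta> s * \<epsilon>) * cmod (\<Gamma> (\<lambda>i. z0 i + u i) j - \<Gamma> (\<lambda>i. z0 i + v i) j) \<le> (1 * \<epsilon>) * ((4 + X) * \<delta>)"
      using \<theta>[of s] \<epsilon> by (intro mult_mono) auto
    also have "\<dots> = (\<epsilon> * (4 + X)) * \<delta>" by (simp only: mult_1 mult.assoc)
    also have "\<dots> = 1/2 * \<delta>" unfolding \<epsilon>(2) by (rule refl)
    finally show "norm (F s u j - F s v j) \<le> 1/2 * \<delta>"
      using \<theta>[of s] \<epsilon> unfolding F_def scaleR_diff_right[symmetric] norm_scaleR by simp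
  next
    fix s j assume j: "j \<in> {0..N}"
    have "\<theta> s * (\<epsilon> * cmod (\<Gamma> (\<lambda>i. z0 i + 0) j)) \<le> exp s * (\<epsilon> * (4 + X))"
      using \<theta>[of s] \<epsilon> X bnd[OF j] by (intro mult_mono mult_left_mono) auto
    moreover have "norm (F s (\<lambda>_. 0) j) = \<theta> s * (\<epsilon> * cmod (\<Gamma> (\<lambda>i. z0 i + 0) j))"
      using \<theta>[of s] \<epsilon>(1) by (simp add: F_def abs_mult)
    moreover have "exp s * (\<epsilon> * (4 + X)) = B * exp (1 * s)" by (simp add: B_def)
    ultimately show "norm (F s (\<lambda>_. 0) j) \<le> B * exp (1 * s)" by (simp only:)
  qed (use \<epsilon> in \<open>auto simp: B_def\<close>)
  then obtain u where "\<forall>j\<in>{0..N}. \<forall>s\<in>UNIV. norm (u j s) \<le> 2 * B * exp (1 * s) \<and>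
    (u j has_vector_derivative (\<lambda>_. 0) j *\<^sub>R u j s + F s (\<lambda>i. u i s) j) (at s)" by (rule exE)
  hence u: "\<And>j s. j \<in> {0..N} \<Longrightarrow> cmod (u j s) \<le> 2 * B * exp s"
    "\<And>j s. j \<in> {0..N} \<Longrightarrow> (u j has_vector_derivative F s (\<lambda>i. u i s) j) (at s)" by auto
  define z where "z s j = z0 j + u j s" for s j
  define t where "t s = Re (u 0 s)" for s
  define \<rho> where "\<rho> s = \<theta> s * \<epsilon> * (separation N (z s))\<^sup>2" for s
  have dz: "((\<lambda>s. z s j) has_vector_derivative \<rho> s *\<^sub>R cvel N \<xi> (z s) j) (at s)" if "j \<in> {1..N}" for j s
  proof -
    have "((\<lambda>s. z0 j + u j s) has_vector_derivative 0 + F s (\<lambda>i. u i s) j) (at s)"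
      by (intro has_vector_derivative_add has_vector_derivative_const u) (use that in auto)
    moreover have "F s (\<lambda>i. u i s) j = \<rho> s *\<^sub>R cvel N \<xi> (z s) j"
      using that by (simp add: F_def \<Gamma>_def \<rho>_def z_def[abs_def] scaleR_conv_of_real mult.assoc)
    ultimately show ?thesis by (simp add: z_def)
  qed
  have dt: "(t has_real_derivative \<rho> s) (at s)" for s
  proof -
    have "(t has_vector_derivative Re (F s (\<lambda>i. u i s) 0)) (at s)"
      unfolding t_def by (rule bounded_linear.has_vector_derivative[OF bounded_linear_Re u(2)]) auto
    moreover have "Re (F s (\<lambda>i. u i s) 0) = \<rho> s"
      by (simp add: F_def \<Gamma>_def \<rho>_def z_def[abs_def] flip: of_real_power)
    ultimately show ?thesis by (simp add: has_real_derivative_iff_has_vector_derivative)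
  qed
  have zb: "cmod (z s j - z0 j) \<le> 2 * B * exp s" if "j \<in> {1..N}" for s j
    using u(1)[of j s] that by (simp add: z_def)
  have tb: "\<bar>t s\<bar> \<le> 2 * B * exp s" for s
    using u(1)[of 0 s] abs_Re_le_cmod[of "u 0 s"] by (simp add: t_def)
  have "inj_on (z s) {1..N}" for s
  proof (rule inj_onI, rule ccontr)
    fix i j assume ij: "i \<in> {1..N}" "j \<in> {1..N}" "z s i = z s j" "i \<noteq> j"
    define a where "a s = z s i - z s j" for s
    define a' where "a' s = \<rho> s *\<^sub>R cvel N \<xi> (z s) i - \<rho> s *\<^sub>R cvel N \<xi> (z s) j" for s
    have da: "(a has_vector_derivative a' s) (at s)" for s
      unfolding a_def a'_def by (intro has_vector_derivative_diff dz ij)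
    have a': "cmod (a' s) \<le> exp s * cmod (a s)" for s
    proof -
      have c: "cmod (\<rho> s *\<^sub>R cvel N \<xi> (z s) i) \<le> \<theta> s * \<epsilon> * (X * separation N (z s))" if "i \<in> {1..N}" for i
      proof -
        have "cmod (\<rho> s *\<^sub>R cvel N \<xi> (z s) i) = \<theta> s * \<epsilon> * cmod (of_real ((separation N (z s))\<^sup>2) * cvel N \<xi> (z s) i)"
          using \<theta>[of s] \<epsilon> by (simp add: \<rho>_def norm_mult norm_power abs_mult)
        also have "\<dots> \<le> \<theta> s * \<epsilon> * (X * separation N (z s))"
          unfolding X_def using \<theta>[of s] \<epsilon> that by (intro mult_left_mono regularized_cvel_norm) auto
        finally show ?thesis .
      qed
      have "cmod (a' s) \<le> 2 * (\<theta> s * \<epsilon> * (X * separation N (z s)))"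
        using c[OF ij(1)] c[OF ij(2)] norm_triangle_ineq4[of "\<rho> s *\<^sub>R cvel N \<xi> (z s) i" "\<rho> s *\<^sub>R cvel N \<xi> (z s) j"]
        by (simp add: a'_def)
      also have "\<dots> = \<theta> s * ((2 * (\<epsilon> * X)) * separation N (z s))" by simp
      also have "\<dots> \<le> exp s * (1 * cmod (a s))"
        using \<theta>[of s] \<epsilon> X separation_le[OF ij(1,2,4), of "z s"] separation_nonneg[of N "z s"]
        by (intro mult_mono) (auto simp: a_def algebra_simps)
      finally show ?thesis by simp
    qed
    \<comment> \<open>Gronwall's argument: |a'| \<le> exp s |a| makes \<open>g\<close>
      nondecreasing, and its limit at minus infinity is the square of the positive initial distance,
      so \<open>a\<close> cannot vanish.\<close>
    define g where "g s = exp (2 * exp s) * (a s \<bullet> a s)" for s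
    define g' where "g' s = exp (2 * exp s) * (2 * (exp s * (a s \<bullet> a s) + a s \<bullet> a' s))" for s
    have dg: "(g has_real_derivative g' s) (at s)" for s
    proof -
      have "((\<lambda>s. a s \<bullet> a s) has_vector_derivative a s \<bullet> a' s + a' s \<bullet> a s) (at s)"
        using bounded_bilinear.has_vector_derivative[OF bounded_bilinear_inner da da] .
      hence "((\<lambda>s. a s \<bullet> a s) has_real_derivative 2 * (a s \<bullet> a' s)) (at s)"
        by (simp add: has_real_derivative_iff_has_vector_derivative inner_commute)
      moreover have "((\<lambda>s. exp (2 * exp s)) has_real_derivative exp (2 * exp s) * (2 * exp s)) (at s)"
        by (auto intro!: derivative_eq_intros)
      ultimately have "(g has_real_derivative exp (2 * exp s) * (2 * exp s) * (a s \<bullet> a s) + 2 * (a s \<bullet> a' s) * exp (2 * exp s)) (at s)"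
        unfolding g_def by (rule DERIV_mult[rotated])
      thus ?thesis by (simp add: g'_def algebra_simps)
    qed
    have g'0: "g' s \<ge> 0" for s
    proof -
      have "- (a s \<bullet> a' s) \<le> cmod (a s) * cmod (a' s)" using Cauchy_Schwarz_ineq2[of "a s" "a' s"] by simp
      also have "\<dots> \<le> cmod (a s) * (exp s * cmod (a s))" by (intro mult_left_mono a') auto
      also have "\<dots> = exp s * (a s \<bullet> a s)" by (simp add: power2_norm_eq_inner[symmetric] power2_eq_square)
      finally show ?thesis by (simp add: g'_def)
    qed
    have mono: "g r \<le> g s" if "r \<le> s" for r s
      by (rule DERIV_nonneg_imp_nondecreasing[OF that]) (use dg g'0 in blast)
    have ez: "((\<lambda>r. 2 * B * exp r) \<longlongrightarrow> 2 * B * 0) at_bot"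
      by (intro tendsto_intros exp_at_bot)
    have zl: "((\<lambda>r. z r i) \<longlongrightarrow> z0 i) at_bot" if "i \<in> {1..N}" for i
    proof -
      have "((\<lambda>r. z r i - z0 i) \<longlongrightarrow> 0) at_bot"
        by (rule Lim_null_comparison[of _ "\<lambda>r. 2 * B * exp r"]) (use ez zb[OF that] in auto)
      thus ?thesis by (simp add: LIM_zero_iff)
    qed
    have "(g \<longlongrightarrow> exp (2 * 0) * ((z0 i - z0 j) \<bullet> (z0 i - z0 j))) at_bot"
      unfolding g_def a_def by (intro tendsto_intros exp_at_bot zl ij)
    moreover have "\<forall>\<^sub>F r in at_bot. g r \<le> g s"
      using eventually_le_at_bot[of s] by eventually_elim (rule mono)
    ultimately have "exp (2 * 0) * ((z0 i - z0 j) \<bullet> (z0 i - z0 j)) \<le> g s"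
      by (intro tendsto_upperbound) auto
    moreover have "g s = 0" using ij by (simp add: g_def a_def)
    moreover have "0 < (z0 i - z0 j) \<bullet> (z0 i - z0 j)"
      unfolding inner_gt_zero_iff using inj ij by (auto dest: inj_onD)
    ultimately show False by simp
  qed
  with zb tb dz dt \<epsilon>(1) show ?thesis
    unfolding \<rho>_def \<theta>_def by (intro exI[of _ \<epsilon>] exI[of _ "2 * B"] exI[of _ z] exI[of _ t]) auto
qed


text \<open>The rescaled motion exists for all s and never collides. Undoing the change of time
  either reaches every positive time or stops at a finite T. In the second case the rate of physical
  time has no positive lower bound, so the separation degenerates.\<close>

lemma collision_or_global:
  fixes z0 :: "nat \<Rightarrow> real^2"
  assumes inj: "inj_on z0 {1..N}"
  obtains I x where
    "I = {0<..} \<or> (\<exists>T>0. I = {0<..<T} \<and> collides N T x)"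
    "\<And>t. t \<in> I \<Longrightarrow> inj_on (x t) {1..N}"
    "\<And>t j. t \<in> I \<Longrightarrow> j \<in> {1..N} \<Longrightarrow> ((\<lambda>s. x s j) has_vector_derivative velocity N \<xi> (x t) j) (at t)"
    "\<And>j. j \<in> {1..N} \<Longrightarrow> ((\<lambda>t. x t j) \<longlongrightarrow> z0 j) (at_right 0)"
proof -
  have "inj_on (\<lambda>j. complex_of_plane (z0 j)) {1..N}"
    by (rule inj_onI, rule inj_onD[OF inj]) (metis plane_of_complex_of_plane)+
  from regularized_flow[OF this, of \<xi>] obtain \<epsilon> R z t where \<epsilon>: "\<epsilon> > 0"
    and z: "\<And>s j. j \<in> {1..N} \<Longrightarrow> cmod (z s j - complex_of_plane (z0 j)) \<le> R * exp s"
    and dz: "\<And>s j. j \<in> {1..N} \<Longrightarrow> ((\<lambda>s. z s j) has_vector_derivative (min 1 (exp s) * \<epsilon> * (separation N (z s))\<^sup>2) *\<^sub>R cvel N \<xi> (z s) j) (at s)"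
    and t: "\<And>s. \<bar>t s\<bar> \<le> R * exp s"
    and dt: "\<And>s. (t has_real_derivative min 1 (exp s) * \<epsilon> * (separation N (z s))\<^sup>2) (at s)"
    and injz: "\<And>s. inj_on (z s) {1..N}" by metis
  define \<rho> where "\<rho> s = min 1 (exp s) * \<epsilon> * (separation N (z s))\<^sup>2" for s
  have \<rho>: "\<rho> s > 0" for s using \<epsilon> separation_pos[OF injz[of s]] by (simp add: \<rho>_def)
  have strict: "t r < t s" if "r < s" for r s
    by (rule DERIV_pos_imp_increasing[OF that]) (use dt \<rho> in \<open>unfold \<rho>_def, blast\<close>)
  have t_less: "t r < t s \<longleftrightarrow> r < s" for r s
    using strict[of r s] strict[of s r] by (cases r s rule: linorder_cases) auto
  have injt: "inj t" by (rule injI) (metis less_irrefl linorder_neqE strict)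
  have contt: "isCont t s" for s using dt DERIV_isCont by blast
  have lim0: "(t \<longlongrightarrow> 0) at_bot"
  proof (rule Lim_null_comparison)
    have "((\<lambda>s. R * exp s) \<longlongrightarrow> R * 0) at_bot" by (intro tendsto_intros exp_at_bot)
    thus "((\<lambda>s. R * exp s) \<longlongrightarrow> 0) at_bot" by simp
  qed (use t in auto)
  have tpos: "t s > 0" for s
  proof -
    have "0 \<le> t (s - 1)"
    proof (rule tendsto_upperbound[OF lim0])
      show "\<forall>\<^sub>F r in at_bot. t r \<le> t (s - 1)"
        using eventually_le_at_bot[of "s - 1"] by eventually_elim (metis order_le_less strict)
    qed simp
    thus ?thesis using strict[of "s - 1" s] by simp
  qed
  \<comment> \<open>By the intermediate value theorem the range of \<open>t\<close> is an interval
    starting at 0.\<close>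
  have range_down: "\<tau> \<in> range t" if "0 < \<tau>" "\<tau> \<le> t s" for \<tau> s
  proof -
    have "\<forall>\<^sub>F r in at_bot. t r < \<tau>" by (rule order_tendstoD(2)[OF lim0 that(1)])
    then obtain r0 where "\<And>r. r \<le> r0 \<Longrightarrow> t r < \<tau>" by (auto simp: eventually_at_bot_linorder)
    hence r: "t (min r0 s) \<le> \<tau>" by (simp add: less_imp_le)
    have "\<exists>r\<ge>min r0 s. r \<le> s \<and> t r = \<tau>" using r that contt by (intro IVT) auto
    thus ?thesis by auto
  qed
  define g where "g = the_inv t"
  have gt: "g (t s) = s" for s using injt by (simp add: g_def the_inv_f_f)
  have tg: "t (g \<tau>) = \<tau>" if "\<tau> \<in> range t" for \<tau> using that gt by auto
  define x where "x \<tau> j = plane_of (z (g \<tau>) j)" for \<tau> j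
  have openr: "\<exists>a b. a < \<tau> \<and> \<tau> < b \<and> {a<..<b} \<subseteq> range t" if "\<tau> \<in> range t" for \<tau>
  proof -
    obtain s where s: "\<tau> = t s" using \<open>\<tau> \<in> range t\<close> by auto
    have "{0<..<t (s + 1)} \<subseteq> range t" using range_down[of _ "s + 1"] by auto
    thus ?thesis using s tpos[of s] strict[of s "s + 1"] by (intro exI[of _ 0] exI[of _ "t (s + 1)"]) auto
  qed
  have dg: "(g has_real_derivative inverse (\<rho> (g \<tau>))) (at \<tau>)" if "\<tau> \<in> range t" for \<tau>
  proof -
    obtain a b where ab: "a < \<tau>" "\<tau> < b" "{a<..<b} \<subseteq> range t" using openr[OF \<open>\<tau> \<in> range t\<close>] by blast
    show ?thesis
    proof (rule DERIV_inverse_function[OF _ _ ab(1,2)])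
      show "(t has_real_derivative \<rho> (g \<tau>)) (at (g \<tau>))" using dt by (simp add: \<rho>_def)
      show "\<rho> (g \<tau>) \<noteq> 0" using \<rho>[of "g \<tau>"] by simp
      show "t (g y) = y" if "a < y" "y < b" for y using that ab by (intro tg) auto
      have "isCont g (t (g \<tau>))"
        by (rule isCont_inverse_function[where d = 1]) (use gt contt in auto)
      thus "isCont g \<tau>" using tg that by simp
    qed
  qed
  have dx: "((\<lambda>s. x s j) has_vector_derivative velocity N \<xi> (x \<tau>) j) (at \<tau>)"
    if \<tau>: "\<tau> \<in> range t" and j: "j \<in> {1..N}" for \<tau> j
  proof -
    have "((\<lambda>\<tau>. z (g \<tau>) j) has_vector_derivative inverse (\<rho> (g \<tau>)) *\<^sub>R (\<rho> (g \<tau>) *\<^sub>R cvel N \<xi> (z (g \<tau>)) j)) (at \<tau>)"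
      using vector_diff_chain_at[OF dg[OF \<tau>, unfolded has_real_derivative_iff_has_vector_derivative] dz[OF j]]
      by (simp add: o_def \<rho>_def)
    hence "((\<lambda>\<tau>. z (g \<tau>) j) has_vector_derivative cvel N \<xi> (z (g \<tau>)) j) (at \<tau>)"
      using \<rho>[of "g \<tau>"] by simp
    from bounded_linear.has_vector_derivative[OF bounded_linear_plane_of this]
    show ?thesis unfolding x_def[abs_def] velocity_plane_of .
  qed
  have injx: "inj_on (x \<tau>) {1..N}" for \<tau>
    unfolding x_def by (rule inj_onI, rule inj_onD[OF injz[of "g \<tau>"]]) auto
  have limx: "((\<lambda>\<tau>. x \<tau> j) \<longlongrightarrow> z0 j) (at_right 0)" if j: "j \<in> {1..N}" for j
  proof (rule tendstoI)
    fix e :: real assume e: "e > 0"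
    have "((\<lambda>s. R * exp s) \<longlongrightarrow> R * 0) at_bot" by (intro tendsto_intros exp_at_bot)
    hence "\<forall>\<^sub>F s in at_bot. R * exp s < e" using e by (intro order_tendstoD(2)) auto
    then obtain s1 where s1: "\<And>s. s \<le> s1 \<Longrightarrow> R * exp s < e" by (auto simp: eventually_at_bot_linorder)
    show "\<forall>\<^sub>F \<tau> in at_right 0. dist (x \<tau> j) (z0 j) < e"
      unfolding eventually_at_right_field
    proof (intro exI[of _ "t s1"] conjI allI impI tpos)
      fix \<tau> assume \<tau>: "0 < \<tau>" "\<tau> < t s1"
      hence r: "\<tau> \<in> range t" using range_down[of \<tau> s1] by auto
      have "g \<tau> \<le> s1" using \<tau> tg[OF r] t_less[of "g \<tau>" s1] by simp
      have "dist (x \<tau> j) (z0 j) = norm (plane_of (z (g \<tau>) j) - plane_of (complex_of_plane (z0 j)))"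
        by (simp add: dist_norm x_def)
      also have "\<dots> = cmod (z (g \<tau>) j - complex_of_plane (z0 j))"
        by (simp only: plane_of_diff[symmetric] norm_plane_of)
      also have "\<dots> \<le> R * exp (g \<tau>)" by (rule z[OF j])
      also have "\<dots> < e" by (rule s1) fact
      finally show "dist (x \<tau> j) (z0 j) < e" .
    qed
  qed
  have "range t = {0<..} \<or> (\<exists>T>0. range t = {0<..<T} \<and> collides N T x)"
  proof (cases "bdd_above (range t)")
    case False
    have "\<tau> \<in> range t" if "\<tau> > 0" for \<tau>
      using False range_down[OF that] unfolding bdd_above_def by (metis linear rangeE)
    thus ?thesis using tpos by auto
  next
    case True
    define T where "T = Sup (range t)"
    have le: "t s < T" for s
      using cSup_upper[OF _ True, of "t (s + 1)"] strict[of s "s + 1"] by (simp add: T_def)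
    have ex: "\<exists>s. \<tau> < t s" if "\<tau> < T" for \<tau>
      using that less_cSup_iff[OF _ True, of \<tau>] by (auto simp: T_def)
    have rT: "range t = {0<..<T}"
    proof (intro equalityI subsetI)
      fix \<tau> assume "\<tau> \<in> {0<..<T}"
      thus "\<tau> \<in> range t" using ex[of \<tau>] range_down[of \<tau>] by (auto dest: less_imp_le)
    qed (use tpos le in auto)
    have "\<exists>t i j. \<tau> < t \<and> 0 < t \<and> t < T \<and> i \<in> {1..N} \<and> j \<in> {1..N} \<and> i \<noteq> j \<and> norm (x t i - x t j) < \<eta>"
      if \<eta>: "\<eta> > 0" and \<tau>: "\<tau> < T" for \<eta> \<tau>
    proof (rule ccontr)
      assume contra: "\<not> ?thesis"
      obtain s0 where s0: "\<tau> < t s0" using ex[OF \<tau>] by blast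
      \<comment> \<open>For s \<ge> 0 the factor min 1 (exp s) equals 1.\<close>
      define s1 where "s1 = max 0 s0"
      have s1: "\<tau> < t s" "s \<ge> 0" if "s \<ge> s1" for s
        using that s0 t_less[of s0 s] by (auto simp: s1_def max_def split: if_splits) 
      have far: "min 1 \<eta> \<le> separation N (z s)" if "s \<ge> s1" for s
      proof (rule separation_geI)
        fix i j assume ij: "i \<in> {1..N}" "j \<in> {1..N}" "i \<noteq> j"
        have "\<not> norm (x (t s) i - x (t s) j) < \<eta>"
          using contra s1(1)[OF that] tpos[of s] le[of s] ij by blast
        moreover have "norm (x (t s) i - x (t s) j) = cmod (z s i - z s j)"
          unfolding x_def gt plane_of_diff[symmetric] by simp
        ultimately show "min 1 \<eta> \<le> cmod (z s i - z s j)" by simp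
      qed simp
      \<comment> \<open>A lower bound for the rate of \<open>t\<close> after \<open>s1\<close>; it
        would carry \<open>t\<close> past T within the duration T / c.\<close>
      define c where "c = \<epsilon> * (min 1 \<eta>)\<^sup>2"
      have c: "c > 0" using \<epsilon> \<eta> by (simp add: c_def)
      have \<rho>c: "c \<le> \<rho> s" if "s \<ge> s1" for s
        using far[OF that] s1(2)[OF that] \<epsilon> \<eta> by (auto simp: c_def \<rho>_def intro!: mult_left_mono power_mono)
      have "t s1 - c * s1 \<le> t s - c * s" if "s \<ge> s1" for s
      proof (rule DERIV_nonneg_imp_nondecreasing[OF that])
        fix r assume r: "s1 \<le> r" "r \<le> s"
        have "((\<lambda>s. t s - c * s) has_real_derivative \<rho> r - c * 1) (at r)"
          unfolding \<rho>_def by (rule DERIV_diff[OF dt DERIV_cmult[OF DERIV_ident]])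
        thus "\<exists>y. ((\<lambda>s. t s - c * s) has_real_derivative y) (at r) \<and> 0 \<le> y"
          using \<rho>c[OF r(1)] by (intro exI[of _ "\<rho> r - c"]) auto
      qed
      from this[of "s1 + T / c"] have "t s1 + T \<le> t (s1 + T / c)"
        using c le[of s1] tpos[of s1] by (simp add: algebra_simps)
      thus False using le[of "s1 + T / c"] tpos[of s1] by simp
    qed
    moreover have "T > 0" using le[of 0] tpos[of 0] by simp
    ultimately show ?thesis using rT by blast
  qed
  from that[OF this] injx dx limx show ?thesis by blast
qed


section \<open>Global existence\<close>

lemma weak_solution_cong:
  assumes "weak_solution I \<omega>" "is_interval I" "\<And>t. t \<in> I \<Longrightarrow> \<omega>' t = \<omega> t"
  shows "weak_solution I \<omega>'"
  unfolding weak_solution_def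
proof (intro conjI ballI impI)
  fix f :: "real^2 \<Rightarrow> real" assume "f \<in> C0"
  hence "continuous_on I (\<lambda>t. pairing f (\<omega> t))" using assms by (auto simp: weak_solution_def)
  thus "continuous_on I (\<lambda>t. pairing f (\<omega>' t))"
    by (rule continuous_on_eq) (use assms in auto)
next
  fix \<phi> and a b :: real assume *: "\<phi> \<in> test_functions" "a \<in> I" "b \<in> I" "a \<le> b"
  have eq: "\<omega>' t = \<omega> t" if "t \<in> {a..b}" for t
    using mem_is_interval_1_I[OF assms(2) *(2,3)] that by (intro assms) auto
  have "weak_identity \<phi> \<omega> a b" using assms(1) * by (auto simp: weak_solution_def)
  from weak_identity_cong[where \<omega> = \<omega>' and \<omega>' = \<omega>, OF eq *(4) this]
  show "set_integrable lborel {a..b} (\<lambda>s. interaction \<phi> (\<omega>' s))"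
    "((\<lambda>s. interaction \<phi> (\<omega>' s)) has_integral pairing \<phi> (\<omega>' b) - pairing \<phi> (\<omega>' a)) {a..b}"
    by blast+
qed (use assms in \<open>auto simp: weak_solution_def\<close>)

lemma weak_solution_shift:
  assumes "weak_solution I \<omega>"
  shows "weak_solution ((\<lambda>t. t + c) ` I) (\<lambda>t. \<omega> (t - c))"
  unfolding weak_solution_def
proof (intro conjI ballI impI)
  fix t assume "t \<in> (\<lambda>t. t + c) ` I"
  thus "\<omega> (t - c) \<in> configs" using assms by (auto simp: weak_solution_def)
next
  fix f :: "real^2 \<Rightarrow> real" assume "f \<in> C0"
  hence "continuous_on I (\<lambda>t. pairing f (\<omega> t))" using assms by (auto simp: weak_solution_def)
  thus "continuous_on ((\<lambda>t. t + c) ` I) (\<lambda>t. pairing f (\<omega> (t - c)))"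
    by (rule continuous_on_compose2) (auto intro!: continuous_intros)
next
  fix \<phi> and a b :: real assume *: "\<phi> \<in> test_functions" "a \<in> (\<lambda>t. t + c) ` I" "b \<in> (\<lambda>t. t + c) ` I" "a \<le> b"
  let ?h = "\<lambda>s. interaction \<phi> (\<omega> s)"
  have h: "set_integrable lborel {a - c..b - c} ?h" "(?h has_integral pairing \<phi> (\<omega> (b - c)) - pairing \<phi> (\<omega> (a - c))) {a - c..b - c}"
    using assms * by (auto simp: weak_solution_def)
  have "integrable lborel (\<lambda>s. indicator {a - c..b - c} (- c + 1 * s) *\<^sub>R ?h (- c + 1 * s))"
    using h(1) unfolding set_integrable_def by (subst lborel_integrable_real_affine_iff) auto
  also have "(\<lambda>s. indicator {a - c..b - c} (- c + 1 * s) *\<^sub>R ?h (- c + 1 * s)) = (\<lambda>s. indicator {a..b} s *\<^sub>R ?h (s - c))"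
    by (auto simp: fun_eq_iff indicator_def)
  finally show "set_integrable lborel {a..b} (\<lambda>s. interaction \<phi> (\<omega> (s - c)))"
    by (simp add: set_integrable_def)
  have "(?h has_integral pairing \<phi> (\<omega> (b - c)) - pairing \<phi> (\<omega> (a - c))) (cbox (a - c) (b - c))" using h(2) by simp
  from has_integral_affinity[OF this, of 1 "- c"]
  show "((\<lambda>s. interaction \<phi> (\<omega> (s - c))) has_integral pairing \<phi> (\<omega> (b - c)) - pairing \<phi> (\<omega> (a - c))) {a..b}"
    by (simp add: image_add_atLeastAtMost')
qed

lemma image_add_atLeast_shift: "(\<lambda>t. t + c) ` {a..} = {a + c..}" for a c :: real
proof (intro equalityI subsetI)
  fix t assume "t \<in> {a + c..}"
  thus "t \<in> (\<lambda>t. t + c) ` {a..}" by (intro image_eqI[of _ _ "t - c"]) auto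
qed auto

lemma weak_solution_Ici:
  assumes "\<And>b. b > a \<Longrightarrow> weak_solution {a..b} \<omega>"
  shows "weak_solution {a..} \<omega>"
  unfolding weak_solution_def
proof (intro conjI ballI impI)
  fix t assume "t \<in> {a..}"
  thus "\<omega> t \<in> configs" using assms[of "t + 1"] by (auto simp: weak_solution_def)
next
  fix f :: "real^2 \<Rightarrow> real" assume f: "f \<in> C0"
  show "continuous_on {a..} (\<lambda>t. pairing f (\<omega> t))"
    unfolding continuous_on_def
  proof
    fix t assume t: "t \<in> {a..}"
    have "continuous_on {a..t + 1} (\<lambda>t. pairing f (\<omega> t))" using assms[of "t + 1"] t f by (auto simp: weak_solution_def)
    hence "((\<lambda>t. pairing f (\<omega> t)) \<longlongrightarrow> pairing f (\<omega> t)) (at t within {a..t + 1})"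
      using t by (auto simp: continuous_on_def)
    moreover have "at t within {a..t + 1} = at t within {a..}"
      by (rule at_within_nhd[where S = "{..<t + 1}"]) auto
    ultimately show "((\<lambda>t. pairing f (\<omega> t)) \<longlongrightarrow> pairing f (\<omega> t)) (at t within {a..})" by simp
  qed
next
  fix \<phi> c d assume *: "\<phi> \<in> test_functions" "c \<in> {a..}" "d \<in> {a..}" "c \<le> d"
  thus "set_integrable lborel {c..d} (\<lambda>s. interaction \<phi> (\<omega> s))"
    "((\<lambda>s. interaction \<phi> (\<omega> s)) has_integral pairing \<phi> (\<omega> d) - pairing \<phi> (\<omega> c)) {c..d}"
    using assms[of "d + 1"] by (auto simp: weak_solution_def)
qed

lemma vortex_config_in_configs_N: "\<forall>j\<in>{1..N}. \<xi> j \<noteq> 0 \<Longrightarrow> inj_on x {1..N} \<Longrightarrow> vortex_config N \<xi> x \<in> configs_N N"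
  unfolding configs_N_def by auto

lemma vortex_config_in_configs: "\<forall>j\<in>{1..N}. \<xi> j \<noteq> 0 \<Longrightarrow> inj_on x {1..N} \<Longrightarrow> vortex_config N \<xi> x \<in> configs"
  unfolding configs_def using vortex_config_in_configs_N by blast

lemma tendsto_sum_C0:
  fixes x :: "'b \<Rightarrow> nat \<Rightarrow> real^2"
  assumes f: "f \<in> C0" and x: "\<And>j. j \<in> {1..N} \<Longrightarrow> ((\<lambda>t. x t j) \<longlongrightarrow> y j) F"
  shows "((\<lambda>t. \<Sum>j=1..N. \<xi> j * f (x t j)) \<longlongrightarrow> (\<Sum>j=1..N. \<xi> j * f (y j))) F"
proof (intro tendsto_sum tendsto_mult_left)
  fix j assume "j \<in> {1..N}"
  moreover have "isCont f (y j)" using f by (auto simp: C0_def continuous_on_eq_continuous_at)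
  ultimately show "((\<lambda>t. f (x t j)) \<longlongrightarrow> f (y j)) F" using isCont_tendsto_compose x by blast
qed

text \<open>The endpoint values are any configurations that are weak* limits of the motion; their
  number of vortices may differ from the one in between.\<close>

lemma weak_solution_Icc:
  assumes T: "T > 0" and \<xi>: "\<forall>j\<in>{1..N}. \<xi> j \<noteq> 0"
    and inj: "\<And>t. t \<in> {0<..<T} \<Longrightarrow> inj_on (x t) {1..N}"
    and dx: "\<And>t j. t \<in> {0<..<T} \<Longrightarrow> j \<in> {1..N} \<Longrightarrow> ((\<lambda>s. x s j) has_vector_derivative velocity N \<xi> (x t) j) (at t)"
    and \<mu>0: "\<mu>0 \<in> configs" "\<And>f. f \<in> C0 \<Longrightarrow> ((\<lambda>t. pairing f (vortex_config N \<xi> (x t))) \<longlongrightarrow> pairing f \<mu>0) (at_right 0)"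
    and \<mu>T: "\<mu>T \<in> configs" "\<And>f. f \<in> C0 \<Longrightarrow> ((\<lambda>t. pairing f (vortex_config N \<xi> (x t))) \<longlongrightarrow> pairing f \<mu>T) (at_left T)"
  shows "weak_solution {0..T} (\<lambda>t. if t \<le> 0 then \<mu>0 else if T \<le> t then \<mu>T else vortex_config N \<xi> (x t))"
    (is "weak_solution _ ?\<omega>")
proof (rule weak_solution_smooth[OF _ \<xi>])
  show "?\<omega> t \<in> configs" if "t \<in> {0..T}" for t
    using \<mu>0 \<mu>T that vortex_config_in_configs[OF \<xi> inj] by auto
  fix f :: "real^2 \<Rightarrow> real" assume f: "f \<in> C0"
  show "continuous_on {0..T} (\<lambda>t. pairing f (?\<omega> t))"
  proof (rule continuous_on_IccI)
    have "\<forall>\<^sub>F t in at_right 0. pairing f (vortex_config N \<xi> (x t)) = pairing f (?\<omega> t)"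
      unfolding eventually_at_right_field by (rule exI[of _ T]) (use T in auto)
    thus "((\<lambda>t. pairing f (?\<omega> t)) \<longlongrightarrow> pairing f (?\<omega> 0)) (at_right 0)"
      using Lim_transform_eventually[OF \<mu>0(2)[OF f]] by simp
    have "\<forall>\<^sub>F t in at_left T. pairing f (vortex_config N \<xi> (x t)) = pairing f (?\<omega> t)"
      unfolding eventually_at_left_field by (rule exI[of _ 0]) (use T in auto)
    thus "((\<lambda>t. pairing f (?\<omega> t)) \<longlongrightarrow> pairing f (?\<omega> T)) (at_left T)"
      using Lim_transform_eventually[OF \<mu>T(2)[OF f]] T by simp
    fix t assume t: "0 < t" "t < T"
    have lim: "((\<lambda>s. \<Sum>j=1..N. \<xi> j * f (x s j)) \<longlongrightarrow> (\<Sum>j=1..N. \<xi> j * f (x t j))) (at t)"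
    proof (rule tendsto_sum_C0[OF f])
      fix j assume "j \<in> {1..N}"
      hence "isCont (\<lambda>s. x s j) t" using dx[of t j] t has_vector_derivative_continuous by auto
      thus "((\<lambda>s. x s j) \<longlongrightarrow> x t j) (at t)" by (simp add: isCont_def)
    qed
    have eq: "(\<Sum>j=1..N. \<xi> j * f (x s j)) = pairing f (?\<omega> s)" if "s \<in> {0<..<T}" for s
      using that pairing_vortex_config[OF inj f] by auto
    have "\<forall>\<^sub>F s in at t. s \<in> {0<..<T}" using t by (intro eventually_at_in_open') auto
    hence "\<forall>\<^sub>F s in at t. (\<Sum>j=1..N. \<xi> j * f (x s j)) = pairing f (?\<omega> s)"
      by eventually_elim (rule eq)
    with lim have "((\<lambda>t. pairing f (?\<omega> t)) \<longlongrightarrow> (\<Sum>j=1..N. \<xi> j * f (x t j))) (at t)"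
      by (rule Lim_transform_eventually)
    moreover have "(\<Sum>j=1..N. \<xi> j * f (x t j)) = pairing f (?\<omega> t)" by (rule eq) (use t in simp)
    ultimately show "((\<lambda>t. pairing f (?\<omega> t)) \<longlongrightarrow> pairing f (?\<omega> t)) (at t)" by simp
  qed (rule T)
qed (use inj dx test_functions_subset_C11 in auto)

text \<open>The initial positions y may coincide, since only their weighted sums have to agree with
  \<mu>. This covers a regular start and a burst alike.\<close>

lemma weak_solution_initial_segment:
  assumes T: "0 < T" "T < T'" and \<xi>: "\<forall>j\<in>{1..N}. \<xi> j \<noteq> 0"
    and inj: "\<And>t. t \<in> {0<..<T'} \<Longrightarrow> inj_on (x t) {1..N}"
    and dx: "\<And>t j. t \<in> {0<..<T'} \<Longrightarrow> j \<in> {1..N} \<Longrightarrow> ((\<lambda>s. x s j) has_vector_derivative velocity N \<xi> (x t) j) (at t)"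
    and lim: "\<And>j. j \<in> {1..N} \<Longrightarrow> ((\<lambda>t. x t j) \<longlongrightarrow> y j) (at_right 0)"
    and \<mu>: "\<mu> \<in> configs" "\<And>f. f \<in> C0 \<Longrightarrow> pairing f \<mu> = (\<Sum>j=1..N. \<xi> j * f (y j))"
  shows "weak_solution {0..T} (\<lambda>t. if t \<le> 0 then \<mu> else vortex_config N \<xi> (x t))"
proof -
  have "weak_solution {0..T} (\<lambda>t. if t \<le> 0 then \<mu> else if T \<le> t then vortex_config N \<xi> (x T) else vortex_config N \<xi> (x t))"
  proof (rule weak_solution_Icc[OF T(1) \<xi>])
    show "vortex_config N \<xi> (x T) \<in> configs" using T by (intro vortex_config_in_configs \<xi> inj) auto
    fix f :: "real^2 \<Rightarrow> real" assume f: "f \<in> C0"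
    have eq: "(\<Sum>j=1..N. \<xi> j * f (x t j)) = pairing f (vortex_config N \<xi> (x t))" if "t \<in> {0<..<T'}" for t
      using pairing_vortex_config[OF inj[OF that] f] by simp
    have "((\<lambda>t. \<Sum>j=1..N. \<xi> j * f (x t j)) \<longlongrightarrow> (\<Sum>j=1..N. \<xi> j * f (x T j))) (at_left T)"
    proof (rule tendsto_sum_C0[OF f])
      fix j assume "j \<in> {1..N}"
      hence "isCont (\<lambda>s. x s j) T" using dx[of T j] T has_vector_derivative_continuous by auto
      thus "((\<lambda>s. x s j) \<longlongrightarrow> x T j) (at_left T)" by (auto simp: isCont_def filterlim_at_split)
    qed
    moreover have "\<forall>\<^sub>F t in at_left T. (\<Sum>j=1..N. \<xi> j * f (x t j)) = pairing f (vortex_config N \<xi> (x t))"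
      unfolding eventually_at_left_field by (rule exI[of _ 0]) (use T eq in auto)
    ultimately have "((\<lambda>t. pairing f (vortex_config N \<xi> (x t))) \<longlongrightarrow> (\<Sum>j=1..N. \<xi> j * f (x T j))) (at_left T)"
      by (rule Lim_transform_eventually)
    thus "((\<lambda>t. pairing f (vortex_config N \<xi> (x t))) \<longlongrightarrow> pairing f (vortex_config N \<xi> (x T))) (at_left T)"
      using eq[of T] T by simp
    have "\<forall>\<^sub>F t in at_right 0. (\<Sum>j=1..N. \<xi> j * f (x t j)) = pairing f (vortex_config N \<xi> (x t))"
      unfolding eventually_at_right_field by (rule exI[of _ T]) (use T eq in auto)
    from Lim_transform_eventually[OF tendsto_sum_C0[OF f lim] this]
    show "((\<lambda>t. pairing f (vortex_config N \<xi> (x t))) \<longlongrightarrow> pairing f \<mu>) (at_right 0)" by (simp add: \<mu>(2)[OF f])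
  qed (use T inj dx \<mu> in auto)
  thus ?thesis by (rule weak_solution_cong) auto
qed

lemma weak_solution_concat:
  assumes "weak_solution {0..T} \<omega>1" "weak_solution {0..} \<omega>2" "\<omega>1 T = \<omega>2 0" "T \<ge> 0"
  shows "weak_solution {0..} (\<lambda>t. if t \<le> T then \<omega>1 t else \<omega>2 (t - T))"
proof -
  have 2: "weak_solution {T..} (\<lambda>t. \<omega>2 (t - T))"
    using weak_solution_shift[OF assms(2), of T] by (simp add: image_add_atLeast_shift)
  have "weak_solution ({0..T} \<union> {T..}) (\<lambda>t. if t \<le> T then \<omega>1 t else \<omega>2 (t - T))"
    by (rule weak_solution_glue[OF assms(1) _ _ 2]) (use assms in auto)
  moreover have "{0..T} \<union> {T..} = {0..}" using assms by auto
  ultimately show ?thesis by simp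
qed

text \<open>The strong induction needs no base case: for N \<le> 1 there is no pair that could
  collide, so the motion is global.\<close>

lemma forward_existence:
  "\<gamma> \<in> configs_N N \<Longrightarrow> \<exists>\<omega>. weak_solution {0..} \<omega> \<and> \<omega> 0 = \<gamma>"
proof (induction N arbitrary: \<gamma> rule: less_induct)
  case (less N)
  then obtain \<xi> z0 where \<gamma>: "\<gamma> = vortex_config N \<xi> z0" and \<xi>: "\<forall>j\<in>{1..N}. \<xi> j \<noteq> 0" and z0: "inj_on z0 {1..N}"
    by (auto simp: configs_N_def)
  obtain I x where I: "I = {0<..} \<or> (\<exists>T>0. I = {0<..<T} \<and> collides N T x)"
    and inj: "\<And>t. t \<in> I \<Longrightarrow> inj_on (x t) {1..N}"
    and dx: "\<And>t j. t \<in> I \<Longrightarrow> j \<in> {1..N} \<Longrightarrow> ((\<lambda>s. x s j) has_vector_derivative velocity N \<xi> (x t) j) (at t)"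
    and lim: "\<And>j. j \<in> {1..N} \<Longrightarrow> ((\<lambda>t. x t j) \<longlongrightarrow> z0 j) (at_right 0)"
    using collision_or_global[OF z0, where \<xi> = \<xi>] by blast
  have \<gamma>c: "\<gamma> \<in> configs" using \<gamma> vortex_config_in_configs[OF \<xi> z0] by simp
  obtain \<epsilon> where \<epsilon>: "\<epsilon> > 0" "\<And>t. t \<in> {0<..<\<epsilon>} \<Longrightarrow> t \<in> I" using I by (metis greaterThanLessThan_iff greaterThan_iff zero_less_one)
  have lim0: "((\<lambda>t. pairing f (vortex_config N \<xi> (x t))) \<longlongrightarrow> pairing f \<gamma>) (at_right 0)" if f: "f \<in> C0" for f
  proof -
    have "\<forall>\<^sub>F t in at_right 0. t \<in> I"
      unfolding eventually_at_right_field by (rule exI[of _ \<epsilon>]) (use \<epsilon> in auto)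
    hence "\<forall>\<^sub>F t in at_right 0. (\<Sum>j=1..N. \<xi> j * f (x t j)) = pairing f (vortex_config N \<xi> (x t))"
      by eventually_elim (simp add: pairing_vortex_config[OF inj f])
    from Lim_transform_eventually[OF tendsto_sum_C0[OF f lim] this]
    show ?thesis by (simp add: \<gamma> pairing_vortex_config[OF z0 f])
  qed
  from I show ?case
  proof
    assume I: "I = {0<..}"
    let ?\<omega> = "\<lambda>t. if t \<le> 0 then \<gamma> else vortex_config N \<xi> (x t)"
    have "weak_solution {0..} ?\<omega>"
    proof (rule weak_solution_Ici)
      fix b :: real assume b: "b > 0"
      show "weak_solution {0..b} ?\<omega>"
        by (rule weak_solution_initial_segment[where T' = "b + 1" and y = z0])
           (use b I \<xi> inj dx lim \<gamma>c \<gamma> pairing_vortex_config[OF z0] in auto)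
    qed
    thus ?thesis by (intro exI[of _ ?\<omega>]) simp
  next
    assume "\<exists>T>0. I = {0<..<T} \<and> collides N T x"
    then obtain T where T: "T > 0" "I = {0<..<T}" "collides N T x" by blast
    obtain M \<mu> where M: "M < N" and \<mu>: "\<mu> \<in> configs_N M"
      "\<And>f. f \<in> C0 \<Longrightarrow> ((\<lambda>t. pairing f (vortex_config N \<xi> (x t))) \<longlongrightarrow> pairing f \<mu>) (at_left T)"
      using collision_limit[OF \<xi> T(1) inj[unfolded T(2)] dx[unfolded T(2)] T(3)] by blast
    obtain \<omega>2 where \<omega>2: "weak_solution {0..} \<omega>2" "\<omega>2 0 = \<mu>" using less.IH[OF M \<mu>(1)] by blast
    let ?\<omega>1 = "\<lambda>t. if t \<le> 0 then \<gamma> else if T \<le> t then \<mu> else vortex_config N \<xi> (x t)"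
    have 1: "weak_solution {0..T} ?\<omega>1"
      by (rule weak_solution_Icc[OF T(1) \<xi>]) (use T inj dx \<gamma>c lim0 \<mu> in \<open>auto simp: configs_def\<close>)
    have "weak_solution {0..} (\<lambda>t. if t \<le> T then ?\<omega>1 t else \<omega>2 (t - T))"
      by (rule weak_solution_concat[OF 1 \<omega>2(1)]) (use T \<omega>2 in auto)
    thus ?thesis
      using T by (intro exI[of _ "\<lambda>t. if t \<le> T then ?\<omega>1 t else \<omega>2 (t - T)"]) auto
  qed
qed


section \<open>Perturbations of linear equations\<close>

abbreviation inbox :: "nat set \<Rightarrow> real \<Rightarrow> (nat \<Rightarrow> complex) \<Rightarrow> bool" where
  "inbox J r u \<equiv> \<forall>i\<in>J. cmod (u i) \<le> r"

abbreviation close :: "nat set \<Rightarrow> real \<Rightarrow> (nat \<Rightarrow> complex) \<Rightarrow> (nat \<Rightarrow> complex) \<Rightarrow> bool" where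
  "close J \<delta> u v \<equiv> \<forall>i\<in>J. cmod (u i - v i) \<le> \<delta>"

text \<open>The properties that \<open>weighted_ode\<close> asks of a right-hand side, uniformly for
  s \<le> s1; the path \<sigma> leaves room for a clamped time. The class is closed under the
  operations below, so an explicit field is checked by following its syntax.\<close>

definition lip_bounded :: "nat set \<Rightarrow> real \<Rightarrow> real \<Rightarrow> (real \<Rightarrow> (nat \<Rightarrow> complex) \<Rightarrow> complex) \<Rightarrow> bool" where
  "lip_bounded J s1 r F \<longleftrightarrow>
    (\<exists>K\<ge>0. \<forall>s\<le>s1. \<forall>u. inbox J r u \<longrightarrow> cmod (F s u) \<le> K \<and>
      (\<forall>v. \<forall>\<delta>\<ge>0. inbox J r v \<longrightarrow> close J \<delta> u v \<longrightarrow>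
        cmod (F s u - F s v) \<le> K * \<delta>)) \<and>
    (\<forall>\<sigma> u. continuous_on UNIV \<sigma> \<longrightarrow> (\<forall>s. \<sigma> s \<le> s1) \<longrightarrow> (\<forall>i\<in>J. continuous_on UNIV (u i)) \<longrightarrow>
      (\<forall>i\<in>J. \<forall>s. cmod (u i s) \<le> r) \<longrightarrow> continuous_on UNIV (\<lambda>s::real. F (\<sigma> s) (\<lambda>i. u i s)))"

lemma lip_boundedI:
  assumes "K \<ge> 0"
    and "\<And>s u. s \<le> s1 \<Longrightarrow> inbox J r u \<Longrightarrow> cmod (F s u) \<le> K"
    and "\<And>s u v \<delta>. s \<le> s1 \<Longrightarrow> inbox J r u \<Longrightarrow> inbox J r v \<Longrightarrow> \<delta> \<ge> 0 \<Longrightarrow>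
      close J \<delta> u v \<Longrightarrow> cmod (F s u - F s v) \<le> K * \<delta>"
    and "\<And>\<sigma> u. continuous_on UNIV \<sigma> \<Longrightarrow> \<forall>s. \<sigma> s \<le> s1 \<Longrightarrow> \<forall>i\<in>J. continuous_on UNIV (u i) \<Longrightarrow>
      \<forall>i\<in>J. \<forall>s. cmod (u i s) \<le> r \<Longrightarrow> continuous_on UNIV (\<lambda>s::real. F (\<sigma> s) (\<lambda>i. u i s))"
  shows "lip_bounded J s1 r F"
  unfolding lip_bounded_def using assms by blast

lemma lip_boundedE:
  assumes "lip_bounded J s1 r F"
  obtains K where "K \<ge> 0"
    "\<And>s u. s \<le> s1 \<Longrightarrow> inbox J r u \<Longrightarrow> cmod (F s u) \<le> K"
    "\<And>s u v \<delta>. s \<le> s1 \<Longrightarrow> inbox J r u \<Longrightarrow> inbox J r v \<Longrightarrow> \<delta> \<ge> 0 \<Longrightarrow>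
      close J \<delta> u v \<Longrightarrow> cmod (F s u - F s v) \<le> K * \<delta>"
  using assms unfolding lip_bounded_def by blast

lemma lip_bounded_continuous:
  assumes "lip_bounded J s1 r F" "continuous_on UNIV \<sigma>" "\<forall>s. \<sigma> s \<le> s1" "\<forall>i\<in>J. continuous_on UNIV (u i)"
    "\<forall>i\<in>J. \<forall>s. cmod (u i s) \<le> r"
  shows "continuous_on UNIV (\<lambda>s::real. F (\<sigma> s) (\<lambda>i. u i s))"
  using assms unfolding lip_bounded_def by blast

lemma lip_bounded_time:
  assumes "continuous_on {..s1} \<phi>" "\<And>s. s \<le> s1 \<Longrightarrow> cmod (\<phi> s) \<le> K"
  shows "lip_bounded J s1 r (\<lambda>s u. \<phi> s)"
proof (rule lip_boundedI)
  show K0: "0 \<le> K" by (rule order_trans[OF norm_ge_zero assms(2)[of s1]]) simp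
  fix \<sigma> :: "real \<Rightarrow> real" assume "continuous_on UNIV \<sigma>" "\<forall>s. \<sigma> s \<le> s1"
  thus "continuous_on UNIV (\<lambda>s. \<phi> (\<sigma> s))"
    by (intro continuous_on_compose2[OF assms(1)]) auto
next
  fix s \<delta> assume "s \<le> s1" "\<delta> \<ge> (0::real)"
  have "0 \<le> K" by (rule order_trans[OF norm_ge_zero assms(2)[of s1]]) simp
  thus "cmod (\<phi> s - \<phi> s) \<le> K * \<delta>" using \<open>\<delta> \<ge> 0\<close> by simp
qed (use assms(2) in auto)

lemma lip_bounded_const: "lip_bounded J s1 r (\<lambda>s u. c)"
  by (rule lip_bounded_time[where K = "cmod c"]) auto

lemma lip_bounded_proj: "i \<in> J \<Longrightarrow> r \<ge> 0 \<Longrightarrow> lip_bounded J s1 r (\<lambda>s u. u i)"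
proof (rule lip_boundedI[where K = "max 1 r"])
  fix s and u v :: "nat \<Rightarrow> complex" and \<delta> :: real
  assume "i \<in> J" "close J \<delta> u v" "\<delta> \<ge> 0"
  moreover have "1 * \<delta> \<le> max 1 r * \<delta>" using \<open>\<delta> \<ge> 0\<close> by (intro mult_right_mono) auto
  ultimately show "cmod (u i - v i) \<le> max 1 r * \<delta>" by fastforce
qed auto

lemma lip_bounded_add:
  assumes "lip_bounded J s1 r F" "lip_bounded J s1 r G"
  shows "lip_bounded J s1 r (\<lambda>s u. F s u + G s u)"
proof -
  obtain K where K: "K \<ge> 0" "\<And>s u. s \<le> s1 \<Longrightarrow> inbox J r u \<Longrightarrow> cmod (F s u) \<le> K"
    "\<And>s u v \<delta>. s \<le> s1 \<Longrightarrow> inbox J r u \<Longrightarrow> inbox J r v \<Longrightarrow> \<delta> \<ge> 0 \<Longrightarrow>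
      close J \<delta> u v \<Longrightarrow> cmod (F s u - F s v) \<le> K * \<delta>" using assms(1) by (elim lip_boundedE) blast
  obtain L where L: "L \<ge> 0" "\<And>s u. s \<le> s1 \<Longrightarrow> inbox J r u \<Longrightarrow> cmod (G s u) \<le> L"
    "\<And>s u v \<delta>. s \<le> s1 \<Longrightarrow> inbox J r u \<Longrightarrow> inbox J r v \<Longrightarrow> \<delta> \<ge> 0 \<Longrightarrow>
      close J \<delta> u v \<Longrightarrow> cmod (G s u - G s v) \<le> L * \<delta>" using assms(2) by (elim lip_boundedE) blast
  show ?thesis
  proof (rule lip_boundedI[where K = "K + L"])
    fix s u assume su: "s \<le> s1" "inbox J r u"
    show "cmod (F s u + G s u) \<le> K + L" by (intro norm_triangle_mono K L su)
    fix v \<delta> assume v: "inbox J r v" "\<delta> \<ge> 0" "close J \<delta> u v"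
    have "cmod ((F s u - F s v) + (G s u - G s v)) \<le> K * \<delta> + L * \<delta>" by (intro norm_triangle_mono K L su v)
    thus "cmod (F s u + G s u - (F s v + G s v)) \<le> (K + L) * \<delta>" by (simp add: algebra_simps)
  next
    fix \<sigma> :: "real \<Rightarrow> real" and u assume c: "continuous_on UNIV \<sigma>" "\<forall>s. \<sigma> s \<le> s1" "\<forall>i\<in>J. continuous_on UNIV (u i)"
      "\<forall>i\<in>J. \<forall>s::real. cmod (u i s) \<le> r"
    show "continuous_on UNIV (\<lambda>s::real. F (\<sigma> s) (\<lambda>i. u i s) + G (\<sigma> s) (\<lambda>i. u i s))"
      by (intro continuous_on_add lip_bounded_continuous[OF assms(1) c] lip_bounded_continuous[OF assms(2) c])
  qed (use K L in auto)
qed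

lemma lip_bounded_mult:
  assumes "lip_bounded J s1 r F" "lip_bounded J s1 r G"
  shows "lip_bounded J s1 r (\<lambda>s u. F s u * G s u)"
proof -
  obtain K where K: "K \<ge> 0" "\<And>s u. s \<le> s1 \<Longrightarrow> inbox J r u \<Longrightarrow> cmod (F s u) \<le> K"
    "\<And>s u v \<delta>. s \<le> s1 \<Longrightarrow> inbox J r u \<Longrightarrow> inbox J r v \<Longrightarrow> \<delta> \<ge> 0 \<Longrightarrow>
      close J \<delta> u v \<Longrightarrow> cmod (F s u - F s v) \<le> K * \<delta>" using assms(1) by (elim lip_boundedE) blast
  obtain L where L: "L \<ge> 0" "\<And>s u. s \<le> s1 \<Longrightarrow> inbox J r u \<Longrightarrow> cmod (G s u) \<le> L"
    "\<And>s u v \<delta>. s \<le> s1 \<Longrightarrow> inbox J r u \<Longrightarrow> inbox J r v \<Longrightarrow> \<delta> \<ge> 0 \<Longrightarrow>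
      close J \<delta> u v \<Longrightarrow> cmod (G s u - G s v) \<le> L * \<delta>" using assms(2) by (elim lip_boundedE) blast
  show ?thesis
  \<comment> \<open>One constant has to serve both as a bound (K L) and as a Lipschitz constant (2 K
    L).\<close>
  proof (rule lip_boundedI[where K = "K * L + 2 * K * L"])
    fix s u assume su: "s \<le> s1" "inbox J r u"
    have "cmod (F s u * G s u) \<le> K * L" unfolding norm_mult by (intro mult_mono K L su) auto
    also have "\<dots> \<le> K * L + 2 * K * L" using K L by simp
    finally show "cmod (F s u * G s u) \<le> K * L + 2 * K * L" .
    fix v \<delta> assume v: "inbox J r v" "\<delta> \<ge> 0" "close J \<delta> u v"
    have "F s u * G s u - F s v * G s v = F s u * (G s u - G s v) + (F s u - F s v) * G s v" by (simp add: algebra_simps)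
    also have "cmod \<dots> \<le> K * (L * \<delta>) + (K * \<delta>) * L"
    proof (rule norm_triangle_mono)
      show "cmod (F s u * (G s u - G s v)) \<le> K * (L * \<delta>)"
        unfolding norm_mult by (intro mult_mono K(1,2) L(3) su v) auto
      show "cmod ((F s u - F s v) * G s v) \<le> (K * \<delta>) * L"
        unfolding norm_mult by (intro mult_mono K(1,3) L(2) su v mult_nonneg_nonneg) auto
    qed
    also have "\<dots> \<le> (K * L + 2 * K * L) * \<delta>" using K L v by (simp add: algebra_simps)
    finally show "cmod (F s u * G s u - F s v * G s v) \<le> (K * L + 2 * K * L) * \<delta>" .
  next
    fix \<sigma> :: "real \<Rightarrow> real" and u assume c: "continuous_on UNIV \<sigma>" "\<forall>s. \<sigma> s \<le> s1" "\<forall>i\<in>J. continuous_on UNIV (u i)"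
      "\<forall>i\<in>J. \<forall>s::real. cmod (u i s) \<le> r"
    show "continuous_on UNIV (\<lambda>s::real. F (\<sigma> s) (\<lambda>i. u i s) * G (\<sigma> s) (\<lambda>i. u i s))"
      by (intro continuous_on_mult lip_bounded_continuous[OF assms(1) c] lip_bounded_continuous[OF assms(2) c])
  qed (use K L in auto)
qed

text \<open>Only the bounded parts of a set \<open>S\<close> containing all values matter. This
  admits exp, and the inverse away from 0.\<close>

lemma lip_bounded_compose:
  assumes F: "lip_bounded J s1 r F" and S: "\<And>s u. s \<le> s1 \<Longrightarrow> inbox J r u \<Longrightarrow> F s u \<in> S"
    and h: "\<And>K. \<exists>M. M-lipschitz_on (S \<inter> cball 0 K) h"
  shows "lip_bounded J s1 r (\<lambda>s u. h (F s u))"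
proof -
  obtain K where K: "K \<ge> 0" "\<And>s u. s \<le> s1 \<Longrightarrow> inbox J r u \<Longrightarrow> cmod (F s u) \<le> K"
    "\<And>s u v \<delta>. s \<le> s1 \<Longrightarrow> inbox J r u \<Longrightarrow> inbox J r v \<Longrightarrow> \<delta> \<ge> 0 \<Longrightarrow>
      close J \<delta> u v \<Longrightarrow> cmod (F s u - F s v) \<le> K * \<delta>" using F by (elim lip_boundedE) blast
  obtain M where M: "M-lipschitz_on (S \<inter> cball 0 K) h" using h by blast
  have M0: "M \<ge> 0" using M by (rule lipschitz_on_nonneg)
  have mem: "F s u \<in> S \<inter> cball 0 K" if "s \<le> s1" "inbox J r u" for s u
    using K(2)[OF that] S[OF that] by simp
  have Mh: "cmod (h a - h b) \<le> M * cmod (a - b)" if "a \<in> S \<inter> cball 0 K" "b \<in> S \<inter> cball 0 K" for a b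
    using lipschitz_onD[OF M that] by (simp add: dist_norm)
  have "bounded (h ` (S \<inter> cball 0 K))"
  proof (cases "S \<inter> cball 0 K = {}")
    case False
    then obtain p where p: "p \<in> S \<inter> cball 0 K" by blast
    have "cmod (h a) \<le> cmod (h p) + M * (2 * K)" if a: "a \<in> S \<inter> cball 0 K" for a
    proof -
      have "cmod (a - p) \<le> 2 * K" using a p norm_triangle_ineq4[of a p] by simp
      hence "M * cmod (a - p) \<le> M * (2 * K)" using M0 by (rule mult_left_mono)
      thus ?thesis using Mh[OF a p] norm_triangle_ineq2[of "h a" "h p"] by linarith
    qed
    thus ?thesis unfolding bounded_iff by (intro exI[of _ "cmod (h p) + M * (2 * K)"]) blast
  qed simp
  then obtain B where "\<forall>x\<in>h ` (S \<inter> cball 0 K). cmod x \<le> B" unfolding bounded_iff by (rule exE)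
  hence B: "cmod (h a) \<le> B" if "a \<in> S \<inter> cball 0 K" for a using that by blast
  show ?thesis
  proof (rule lip_boundedI[where K = "max B 0 + M * K"])
    fix s u assume su: "s \<le> s1" "inbox J r u"
    have "cmod (h (F s u)) \<le> B" by (intro B mem su)
    thus "cmod (h (F s u)) \<le> max B 0 + M * K"
      using mult_nonneg_nonneg[OF M0 K(1)] max.cobounded1[of B 0] by linarith
    fix v \<delta> assume v: "inbox J r v" "\<delta> \<ge> 0" "close J \<delta> u v"
    have "cmod (h (F s u) - h (F s v)) \<le> M * cmod (F s u - F s v)" by (intro Mh mem su v)
    also have "\<dots> \<le> M * (K * \<delta>)" by (intro mult_left_mono K su v M0)
    also have "\<dots> \<le> (max B 0 + M * K) * \<delta>" using v by (simp add: algebra_simps)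
    finally show "cmod (h (F s u) - h (F s v)) \<le> (max B 0 + M * K) * \<delta>" .
  next
    fix \<sigma> :: "real \<Rightarrow> real" and u assume c: "continuous_on UNIV \<sigma>" "\<forall>s. \<sigma> s \<le> s1" "\<forall>i\<in>J. continuous_on UNIV (u i)"
      "\<forall>i\<in>J. \<forall>s::real. cmod (u i s) \<le> r"
    show "continuous_on UNIV (\<lambda>s. h (F (\<sigma> s) (\<lambda>i. u i s)))"
      by (rule continuous_on_compose2[OF lipschitz_on_continuous_on[OF M] lip_bounded_continuous[OF F c]])
         (use mem c in auto)
  qed (use M0 K in auto)
qed

lemma lip_bounded_bounded_linear:
  assumes F: "lip_bounded J s1 r F" and h: "bounded_linear h"
  shows "lip_bounded J s1 r (\<lambda>s u. h (F s u))"
proof (rule lip_bounded_compose[OF F UNIV_I])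
  obtain B where "B-lipschitz_on UNIV h" using bounded_linear.lipschitz_boundE[OF h] by blast
  from lipschitz_on_subset[OF this, of "UNIV \<inter> cball 0 K" for K]
  show "\<exists>M. M-lipschitz_on (UNIV \<inter> cball 0 K) h" for K by auto
qed

lemma lip_bounded_diff: "lip_bounded J s1 r F \<Longrightarrow> lip_bounded J s1 r G \<Longrightarrow> lip_bounded J s1 r (\<lambda>s u. F s u - G s u)"
  using lip_bounded_add[OF _ lip_bounded_bounded_linear[OF _ bounded_linear_minus[OF bounded_linear_ident]]] by simp

lemma lip_bounded_sum:
  "finite A \<Longrightarrow> (\<And>i. i \<in> A \<Longrightarrow> lip_bounded J s1 r (F i)) \<Longrightarrow> lip_bounded J s1 r (\<lambda>s u. \<Sum>i\<in>A. F i s u)"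
  by (induction A rule: finite_induct) (auto intro: lip_bounded_const lip_bounded_add)

lemma lip_bounded_scaleR: "lip_bounded J s1 r F \<Longrightarrow> lip_bounded J s1 r (\<lambda>s u. c *\<^sub>R F s u)"
  by (rule lip_bounded_bounded_linear[OF _ bounded_linear_scaleR_right])

lemma lip_bounded_cnj: "lip_bounded J s1 r F \<Longrightarrow> lip_bounded J s1 r (\<lambda>s u. cnj (F s u))"
  by (rule lip_bounded_bounded_linear[OF _ bounded_linear_cnj])

lemma lip_bounded_Re: "lip_bounded J s1 r F \<Longrightarrow> lip_bounded J s1 r (\<lambda>s u. of_real (Re (F s u)))"
  by (rule lip_bounded_bounded_linear[OF _ bounded_linear_compose[OF bounded_linear_of_real bounded_linear_Re]])

lemma lip_bounded_exp:
  assumes "lip_bounded J s1 r F"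
  shows "lip_bounded J s1 r (\<lambda>s u. exp (F s u))"
proof (rule lip_bounded_compose[OF assms UNIV_I])
  fix K :: real
  have "(exp K)-lipschitz_on (cball 0 K) (exp :: complex \<Rightarrow> complex)"
  proof (rule lipschitz_onI)
    fix x y :: complex assume "x \<in> cball 0 K" "y \<in> cball 0 K"
    hence "norm (exp x - exp y) \<le> exp K * norm (x - y)"
      by (intro field_differentiable_bound[of "cball 0 K" exp exp])
         (auto intro!: derivative_eq_intros order_trans[OF complex_Re_le_cmod])
    thus "dist (exp x) (exp y) \<le> exp K * dist x y" by (simp add: dist_norm)
  qed simp
  thus "\<exists>M. M-lipschitz_on (UNIV \<inter> cball 0 K) (exp :: complex \<Rightarrow> complex)" by auto
qed

lemma lip_bounded_inverse:
  assumes F: "lip_bounded J s1 r F" and m: "m > 0" "\<And>s u. s \<le> s1 \<Longrightarrow> inbox J r u \<Longrightarrow> m \<le> cmod (F s u)"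
  shows "lip_bounded J s1 r (\<lambda>s u. inverse (F s u))"
proof (rule lip_bounded_compose[OF F, where S = "{w. m \<le> cmod w}"])
  fix K :: real
  have "(1 / m\<^sup>2)-lipschitz_on {w. m \<le> cmod w} (inverse :: complex \<Rightarrow> complex)"
  proof (rule lipschitz_onI)
    fix x y :: complex assume xy: "x \<in> {w. m \<le> cmod w}" "y \<in> {w. m \<le> cmod w}"
    hence n0: "x \<noteq> 0" "y \<noteq> 0" using m by auto
    have "inverse x - inverse y = (y - x) / (x * y)" using n0 by (simp add: field_simps)
    hence "cmod (inverse x - inverse y) = cmod (x - y) / (cmod x * cmod y)"
      by (simp add: norm_divide norm_mult norm_minus_commute)
    also have "\<dots> \<le> cmod (x - y) / (m * m)"
      using xy m n0 by (intro divide_left_mono mult_mono mult_pos_pos) auto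
    finally show "dist (inverse x) (inverse y) \<le> 1 / m\<^sup>2 * dist x y"
      by (simp add: dist_norm power2_eq_square)
  qed (use m in auto)
  from lipschitz_on_subset[OF this, of "{w. m \<le> cmod w} \<inter> cball 0 K"]
  show "\<exists>M. M-lipschitz_on ({w. m \<le> cmod w} \<inter> cball 0 K) (inverse :: complex \<Rightarrow> complex)"
    by auto
qed (use m in auto)

lemma lip_bounded_kern:
  assumes F: "lip_bounded J s1 r F" and m: "m > 0" "\<And>s u. s \<le> s1 \<Longrightarrow> inbox J r u \<Longrightarrow> m \<le> cmod (F s u)"
  shows "lip_bounded J s1 r (\<lambda>s u. kern (F s u))"
proof -
  have "lip_bounded J s1 r (\<lambda>s u. \<i> / (2 * pi) * cnj (inverse (F s u)))"
    by (intro lip_bounded_mult lip_bounded_const lip_bounded_cnj lip_bounded_inverse[OF F m])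
  moreover have "kern w = \<i> / (2 * pi) * cnj (inverse w)" for w
    by (simp add: kern_def inverse_eq_divide)
  ultimately show ?thesis by simp
qed

section \<open>Lipschitz constants near the origin\<close>

definition lip_near0 :: "nat set \<Rightarrow> real \<Rightarrow> ((nat \<Rightarrow> complex) \<Rightarrow> complex) \<Rightarrow> bool" where
  "lip_near0 J K h \<longleftrightarrow> (\<exists>r>0. \<forall>u v. \<forall>\<delta>\<ge>0. inbox J r u \<longrightarrow> inbox J r v \<longrightarrow>
     close J \<delta> u v \<longrightarrow> cmod (h u - h v) \<le> K * \<delta>)"

definition lip_at0 where "lip_at0 J h \<longleftrightarrow> h (\<lambda>_. 0) = 0 \<and> (\<exists>K\<ge>0. lip_near0 J K h)"
text \<open>Vanishing at 0 and strictly differentiable there with derivative 0: what a nonlinear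
  remainder has to satisfy for the contraction.\<close>

definition flat_at0 where "flat_at0 J h \<longleftrightarrow> h (\<lambda>_. 0) = 0 \<and> (\<forall>e>0. lip_near0 J e h)"

lemma lip_near0E:
  assumes "lip_near0 J K h"
  obtains r where "r > 0" "\<And>u v \<delta>. \<delta> \<ge> 0 \<Longrightarrow> inbox J r u \<Longrightarrow> inbox J r v \<Longrightarrow>
     close J \<delta> u v \<Longrightarrow> cmod (h u - h v) \<le> K * \<delta>"
  using assms unfolding lip_near0_def by blast

lemma lip_near0I:
  assumes "r > 0" "\<And>u v \<delta>. \<delta> \<ge> 0 \<Longrightarrow> inbox J r u \<Longrightarrow> inbox J r v \<Longrightarrow>
     close J \<delta> u v \<Longrightarrow> cmod (h u - h v) \<le> K * \<delta>"
  shows "lip_near0 J K h"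
  using assms unfolding lip_near0_def by blast

lemma flat_at0_imp_lip_at0: "flat_at0 J h \<Longrightarrow> lip_at0 J h"
  unfolding flat_at0_def lip_at0_def by (meson zero_le_one zero_less_one)

lemma lip_near0_add:
  assumes "lip_near0 J K f" "lip_near0 J L g"
  shows "lip_near0 J (K + L) (\<lambda>u. f u + g u)"
proof -
  obtain r where r: "r > 0" "\<And>u v \<delta>. \<delta> \<ge> 0 \<Longrightarrow> inbox J r u \<Longrightarrow> inbox J r v \<Longrightarrow>
     close J \<delta> u v \<Longrightarrow> cmod (f u - f v) \<le> K * \<delta>" using assms(1) by (elim lip_near0E) blast
  obtain r' where r': "r' > 0" "\<And>u v \<delta>. \<delta> \<ge> 0 \<Longrightarrow> inbox J r' u \<Longrightarrow> inbox J r' v \<Longrightarrow>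
     close J \<delta> u v \<Longrightarrow> cmod (g u - g v) \<le> L * \<delta>" using assms(2) by (elim lip_near0E) blast
  show ?thesis
  proof (rule lip_near0I[of "min r r'"])
    fix u v \<delta> assume *: "\<delta> \<ge> 0" "inbox J (min r r') u" "inbox J (min r r') v" "close J \<delta> u v"
    hence "cmod ((f u - f v) + (g u - g v)) \<le> K * \<delta> + L * \<delta>"
      by (intro norm_triangle_mono r r') auto
    thus "cmod (f u + g u - (f v + g v)) \<le> (K + L) * \<delta>" by (simp add: algebra_simps)
  qed (use r r' in auto)
qed

lemma lip_near0_mono: "lip_near0 J K h \<Longrightarrow> K \<le> L \<Longrightarrow> lip_near0 J L h"
proof -
  assume h: "lip_near0 J K h" and KL: "K \<le> L"
  obtain r where r: "r > 0" "\<And>u v \<delta>. \<delta> \<ge> 0 \<Longrightarrow> inbox J r u \<Longrightarrow> inbox J r v \<Longrightarrow>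
     close J \<delta> u v \<Longrightarrow> cmod (h u - h v) \<le> K * \<delta>" using h by (elim lip_near0E) blast
  show "lip_near0 J L h"
  proof (rule lip_near0I[OF r(1)])
    fix u v \<delta> assume *: "\<delta> \<ge> 0" "inbox J r u" "inbox J r v" "close J \<delta> u v"
    show "cmod (h u - h v) \<le> L * \<delta>"
      by (rule order_trans[OF r(2)[OF *] mult_right_mono[OF KL *(1)]])
  qed
qed

lemma flat_at0_add: "flat_at0 J f \<Longrightarrow> flat_at0 J g \<Longrightarrow> flat_at0 J (\<lambda>u. f u + g u)"
  unfolding flat_at0_def using lip_near0_add[of J "e/2" f "e/2" g for e] by (auto simp del: divide_const_simps)

lemma lip_at0_add: "lip_at0 J f \<Longrightarrow> lip_at0 J g \<Longrightarrow> lip_at0 J (\<lambda>u. f u + g u)"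
  unfolding lip_at0_def using lip_near0_add by (metis add_nonneg_nonneg add.right_neutral)

lemma lip_near0_bounded_linear:
  assumes "bounded_linear h"
  obtains B where "B > 0" "\<And>K f. lip_near0 J K f \<Longrightarrow> lip_near0 J (B * K) (\<lambda>u. h (f u))"
proof -
  obtain B where B: "B > 0" "\<And>x. norm (h x) \<le> norm x * B" using bounded_linear.pos_bounded[OF assms] by blast
  have "lip_near0 J (B * K) (\<lambda>u. h (f u))" if f: "lip_near0 J K f" for K f
  proof -
    obtain r where r: "r > 0" "\<And>u v \<delta>. \<delta> \<ge> 0 \<Longrightarrow> inbox J r u \<Longrightarrow> inbox J r v \<Longrightarrow>
      close J \<delta> u v \<Longrightarrow> cmod (f u - f v) \<le> K * \<delta>" using f by (elim lip_near0E) blast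
    show ?thesis
    proof (rule lip_near0I[OF r(1)])
      fix u v \<delta> assume *: "\<delta> \<ge> 0" "inbox J r u" "inbox J r v" "close J \<delta> u v"
      have "cmod (h (f u) - h (f v)) = norm (h (f u - f v))"
        by (simp add: linear_diff[OF bounded_linear.linear[OF assms]])
      also have "\<dots> \<le> norm (f u - f v) * B" by (rule B)
      also have "\<dots> \<le> (K * \<delta>) * B" using B by (intro mult_right_mono r *) auto
      finally show "cmod (h (f u) - h (f v)) \<le> B * K * \<delta>" by (simp add: mult_ac)
    qed
  qed
  with B that show ?thesis by blast
qed

lemma flat_at0_bounded_linear:
  assumes "flat_at0 J f" "bounded_linear h"
  shows "flat_at0 J (\<lambda>u. h (f u))"
proof -
  obtain B where B: "B > 0" "\<And>K f. lip_near0 J K f \<Longrightarrow> lip_near0 J (B * K) (\<lambda>u. h (f u))"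
    using lip_near0_bounded_linear[OF assms(2)] by blast
  have "lip_near0 J e (\<lambda>u. h (f u))" if "e > 0" for e
    using B(2)[of "e / B" f] B(1) assms(1) that by (simp add: flat_at0_def)
  thus ?thesis using assms linear_0[OF bounded_linear.linear[OF assms(2)]] by (simp add: flat_at0_def)
qed

lemma lip_at0_bounded_linear:
  assumes "lip_at0 J f" "bounded_linear h"
  shows "lip_at0 J (\<lambda>u. h (f u))"
proof -
  obtain B where B: "B > 0" "\<And>K f. lip_near0 J K f \<Longrightarrow> lip_near0 J (B * K) (\<lambda>u. h (f u))"
    using lip_near0_bounded_linear[OF assms(2)] by blast
  obtain K where "K \<ge> 0" "lip_near0 J K f" using assms(1) by (auto simp: lip_at0_def)
  hence "B * K \<ge> 0" "lip_near0 J (B * K) (\<lambda>u. h (f u))" using B by auto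
  thus ?thesis using assms linear_0[OF bounded_linear.linear[OF assms(2)]] by (auto simp: lip_at0_def)
qed

lemma lip_at0_proj: "i \<in> J \<Longrightarrow> lip_at0 J (\<lambda>u. u i)"
  unfolding lip_at0_def lip_near0_def by (intro conjI exI[of _ 1]) auto

lemma lip_at0_bound:
  assumes "lip_at0 J f"
  obtains K r where "K > 0" "r > 0" "\<And>u. inbox J r u \<Longrightarrow> cmod (f u) \<le> K"
    "\<And>u \<rho>. 0 \<le> \<rho> \<Longrightarrow> \<rho> \<le> r \<Longrightarrow> inbox J \<rho> u \<Longrightarrow> cmod (f u) \<le> K * \<rho>"
    "\<And>u v \<delta>. \<delta> \<ge> 0 \<Longrightarrow> inbox J r u \<Longrightarrow> inbox J r v \<Longrightarrow>
      close J \<delta> u v \<Longrightarrow> cmod (f u - f v) \<le> K * \<delta>"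
proof -
  obtain K0 where K0: "K0 \<ge> 0" "lip_near0 J K0 f" using assms by (auto simp: lip_at0_def)
  obtain K where K: "K > 0" "lip_near0 J K f" using lip_near0_mono[OF K0(2), of "K0 + 1"] K0(1) that[of "K0 + 1"] by simp
  obtain r0 where r0: "r0 > 0" "\<And>u v \<delta>. \<delta> \<ge> 0 \<Longrightarrow> inbox J r0 u \<Longrightarrow> inbox J r0 v \<Longrightarrow>
      close J \<delta> u v \<Longrightarrow> cmod (f u - f v) \<le> K * \<delta>" using K(2) by (elim lip_near0E) blast
  define r where "r = min r0 1"
  have r: "r > 0" "r \<le> 1" "r \<le> r0" using r0 by (auto simp: r_def)
  have 2: "cmod (f u) \<le> K * \<rho>" if "0 \<le> \<rho>" "\<rho> \<le> r" "inbox J \<rho> u" for u \<rho>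
    using r0(2)[of \<rho> u "\<lambda>_. 0"] that assms r r0(1) by (fastforce simp: lip_at0_def)
  have "K * r \<le> K * 1" using r K by (intro mult_left_mono) auto
  hence 1: "cmod (f u) \<le> K" if "inbox J r u" for u
    using 2[of r u] that r by simp
  have 3: "cmod (f u - f v) \<le> K * \<delta>" if "\<delta> \<ge> 0" "inbox J r u" "inbox J r v"
      "close J \<delta> u v" for u v \<delta>
    using that r by (intro r0(2)) fastforce+
  show ?thesis using that[OF K(1) r(1) 1 2 3] .
qed

text \<open>On the box of radius \<rho> the factors are at most K \<rho> and L \<rho>, so the
  product has Lipschitz constant 2 K L \<rho>.\<close>

lemma flat_at0_mult:
  assumes f: "lip_at0 J f" and g: "lip_at0 J g"
  shows "flat_at0 J (\<lambda>u. f u * g u)"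
  unfolding flat_at0_def
proof (intro conjI allI impI)
  show "f (\<lambda>_. 0) * g (\<lambda>_. 0) = 0" using f by (simp add: lip_at0_def)
  fix e :: real assume e: "e > 0"
  obtain K r where K: "K > 0" "r > 0" "\<And>u \<rho>. 0 \<le> \<rho> \<Longrightarrow> \<rho> \<le> r \<Longrightarrow> inbox J \<rho> u \<Longrightarrow> cmod (f u) \<le> K * \<rho>"
    "\<And>u v \<delta>. \<delta> \<ge> 0 \<Longrightarrow> inbox J r u \<Longrightarrow> inbox J r v \<Longrightarrow>
      close J \<delta> u v \<Longrightarrow> cmod (f u - f v) \<le> K * \<delta>" using f by (elim lip_at0_bound) blast
  obtain L r' where L: "L > 0" "r' > 0" "\<And>u \<rho>. 0 \<le> \<rho> \<Longrightarrow> \<rho> \<le> r' \<Longrightarrow> inbox J \<rho> u \<Longrightarrow> cmod (g u) \<le> L * \<rho>"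
    "\<And>u v \<delta>. \<delta> \<ge> 0 \<Longrightarrow> inbox J r' u \<Longrightarrow> inbox J r' v \<Longrightarrow>
      close J \<delta> u v \<Longrightarrow> cmod (g u - g v) \<le> L * \<delta>" using g by (elim lip_at0_bound) blast
  define \<rho> where "\<rho> = min (min r r') (e / (2 * K * L))"
  have \<rho>: "\<rho> > 0" "\<rho> \<le> r" "\<rho> \<le> r'" "\<rho> \<le> e / (2 * K * L)" using K L e by (auto simp: \<rho>_def)
  hence \<rho>e: "2 * K * L * \<rho> \<le> e" using K L by (simp add: field_simps)
  show "lip_near0 J e (\<lambda>u. f u * g u)"
  proof (rule lip_near0I[OF \<rho>(1)])
    fix u v \<delta> assume *: "\<delta> \<ge> 0" "inbox J \<rho> u" "inbox J \<rho> v" "close J \<delta> u v"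
    have d: "inbox J r u" "inbox J r v" "inbox J r' u" "inbox J r' v"
      using * \<rho> by fastforce+
    have "f u * g u - f v * g v = f u * (g u - g v) + (f u - f v) * g v" by (simp add: algebra_simps)
    also have "cmod \<dots> \<le> (K * \<rho>) * (L * \<delta>) + (K * \<delta>) * (L * \<rho>)"
      unfolding norm_mult[symmetric]
      using * \<rho> K(1) L(1) by (intro norm_triangle_mono) (auto simp: norm_mult intro!: mult_mono K(3,4) L(3,4) d)
    also have "\<dots> = (2 * K * L * \<rho>) * \<delta>" by simp
    also have "\<dots> \<le> e * \<delta>" using \<rho>e * by (intro mult_right_mono) auto
    finally show "cmod (f u * g u - f v * g v) \<le> e * \<delta>" .
  qed
qed

text \<open>Near 0 the derivative of h is below e / K, where K is a Lipschitz constant of f.\<close>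

lemma flat_at0_compose_deriv:
  assumes f: "lip_at0 J f" and d: "d > 0" and h: "\<And>w::complex. cmod w < d \<Longrightarrow> (h has_field_derivative h' w) (at w)"
    and h0: "h 0 = 0" "h' 0 = 0" "isCont h' 0"
  shows "flat_at0 J (\<lambda>u. h (f u))"
  unfolding flat_at0_def
proof (intro conjI allI impI)
  show "h (f (\<lambda>_. 0)) = 0" using f h0 by (simp add: lip_at0_def)
  fix e :: real assume e: "e > 0"
  obtain K r where K: "K > 0" "r > 0" "\<And>u \<rho>. 0 \<le> \<rho> \<Longrightarrow> \<rho> \<le> r \<Longrightarrow> inbox J \<rho> u \<Longrightarrow> cmod (f u) \<le> K * \<rho>"
    "\<And>u v \<delta>. \<delta> \<ge> 0 \<Longrightarrow> inbox J r u \<Longrightarrow> inbox J r v \<Longrightarrow>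
      close J \<delta> u v \<Longrightarrow> cmod (f u - f v) \<le> K * \<delta>" using f by (elim lip_at0_bound) blast
  have "e / K > 0" using e K by simp
  then obtain d' where d': "d' > 0" "\<And>w. cmod w < d' \<Longrightarrow> cmod (h' w) < e / K"
    using h0 unfolding continuous_at_eps_delta by (auto simp: dist_norm)
  define D where "D = min d d'"
  have D: "D > 0" using d d' by (simp add: D_def)
  have Lh: "cmod (h a - h b) \<le> e / K * cmod (a - b)" if "cmod a < D" "cmod b < D" for a b
  proof (rule field_differentiable_bound[of "ball 0 D" h h'])
    fix w :: complex assume "w \<in> ball 0 D"
    hence w: "cmod w < d" "cmod w < d'" by (auto simp: D_def)
    show "(h has_field_derivative h' w) (at w within ball 0 D)" using h[OF w(1)] by (rule has_field_derivative_at_within)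
    show "norm (h' w) \<le> e / K" using d'(2)[OF w(2)] by simp
  qed (use that in auto)
  define \<rho> where "\<rho> = min r (D / (2 * K))"
  have \<rho>: "\<rho> > 0" "\<rho> \<le> r" "K * \<rho> < D"
  proof -
    have "K * \<rho> \<le> K * (D / (2 * K))" unfolding \<rho>_def using K by (intro mult_left_mono) auto
    also have "\<dots> < D" using K D by simp
    finally show "K * \<rho> < D" .
  qed (use K D in \<open>auto simp: \<rho>_def\<close>)
  show "lip_near0 J e (\<lambda>u. h (f u))"
  proof (rule lip_near0I[OF \<rho>(1)])
    fix u v \<delta> assume *: "\<delta> \<ge> 0" "inbox J \<rho> u" "inbox J \<rho> v" "close J \<delta> u v"
    have "cmod (f u) < D" "cmod (f v) < D"
      using K(3)[of \<rho> u] K(3)[of \<rho> v] \<rho> * by (auto intro: le_less_trans)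
    hence "cmod (h (f u) - h (f v)) \<le> e / K * cmod (f u - f v)" by (rule Lh)
    also have "\<dots> \<le> e / K * (K * \<delta>)"
      using * \<rho> K(1) e by (intro mult_left_mono K(4)) fastforce+
    also have "\<dots> = e * \<delta>" using K by simp
    finally show "cmod (h (f u) - h (f v)) \<le> e * \<delta>" .
  qed
qed

lemma flat_at0_exp: "lip_at0 J f \<Longrightarrow> flat_at0 J (\<lambda>u. exp (f u) - 1 - f u)"
  by (rule flat_at0_compose_deriv[where h = "\<lambda>w. exp w - 1 - w" and h' = "\<lambda>w. exp w - 1" and d = 1])
     (auto intro!: derivative_eq_intros continuous_intros)

lemma flat_at0_geometric: "lip_at0 J f \<Longrightarrow> flat_at0 J (\<lambda>u. 1 / (1 - f u) - 1 - f u)"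
proof (rule flat_at0_compose_deriv[where h = "\<lambda>w. 1 / (1 - w) - 1 - w" and h' = "\<lambda>w. 1 / (1 - w)\<^sup>2 - 1" and d = 1])
  fix w :: complex assume "cmod w < 1"
  hence "1 - w \<noteq> 0" by auto
  thus "((\<lambda>w. 1 / (1 - w) - 1 - w) has_field_derivative 1 / (1 - w)\<^sup>2 - 1) (at w)"
    by (auto intro!: derivative_eq_intros simp: power2_eq_square)
qed (auto intro!: continuous_intros)


text \<open>The factor exp (s/2) brings the Lipschitz constant of the nonautonomous part below 1/8
  for very negative s. With 1/8 from \<open>A\<close> this makes 1/4, at most half of the rate 1/2 -
  lam that the weight exp (s/2) provides.\<close>

lemma perturbed_linear_ode:
  fixes B :: "nat \<Rightarrow> real \<Rightarrow> (nat \<Rightarrow> complex) \<Rightarrow> complex" and A :: "nat \<Rightarrow> (nat \<Rightarrow> complex) \<Rightarrow> complex"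
  assumes J: "finite J" "J \<noteq> {}" and r: "r > 0"
    and B: "\<And>j. j \<in> J \<Longrightarrow> lip_bounded J s1 r (B j)"
    and A: "\<And>j. j \<in> J \<Longrightarrow> lip_bounded J s1 r (\<lambda>s. A j)" "\<And>j. j \<in> J \<Longrightarrow> A j (\<lambda>_. 0) = 0"
      "\<And>j u v \<delta>. j \<in> J \<Longrightarrow> \<delta> \<ge> 0 \<Longrightarrow> inbox J r u \<Longrightarrow> inbox J r v \<Longrightarrow>
        close J \<delta> u v \<Longrightarrow> cmod (A j u - A j v) \<le> 1/8 * \<delta>"
    and lam: "\<And>j. j \<in> J \<Longrightarrow> lam j \<le> 0"
  shows "\<exists>s0\<le>s1. \<exists>R u. \<forall>j\<in>J. \<forall>s\<le>s0. cmod (u j s) \<le> R * exp (s / 2) \<and> cmod (u j s) \<le> r \<and>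
    (u j has_vector_derivative lam j *\<^sub>R u j s + (A j (\<lambda>i. u i s) + exp (s / 2) *\<^sub>R B j s (\<lambda>i. u i s))) (at s)"
proof -
  define Q where "Q j K \<longleftrightarrow> K \<ge> 0 \<and> (\<forall>s\<le>s1. \<forall>u. inbox J r u \<longrightarrow> cmod (B j s u) \<le> K \<and>
      (\<forall>v. \<forall>\<delta>\<ge>0. inbox J r v \<longrightarrow> close J \<delta> u v \<longrightarrow>
        cmod (B j s u - B j s v) \<le> K * \<delta>))" for j K
  have "\<forall>j\<in>J. \<exists>K. Q j K" using B unfolding lip_bounded_def Q_def by blast
  from bchoice[OF this] obtain K where KQ: "\<And>j. j \<in> J \<Longrightarrow> Q j (K j)" by blast
  have K: "K j \<ge> 0"
    "\<And>s u. s \<le> s1 \<Longrightarrow> inbox J r u \<Longrightarrow> cmod (B j s u) \<le> K j"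
    "\<And>s u v \<delta>. s \<le> s1 \<Longrightarrow> inbox J r u \<Longrightarrow> inbox J r v \<Longrightarrow> \<delta> \<ge> 0 \<Longrightarrow>
      close J \<delta> u v \<Longrightarrow> cmod (B j s u - B j s v) \<le> K j * \<delta>" if "j \<in> J" for j
    using KQ[OF that] unfolding Q_def by blast+
  define M where "M = 1 + (\<Sum>j\<in>J. K j)"
  have KM: "K j \<le> M" if "j \<in> J" for j
    using member_le_sum[of j J K] K(1) J that by (simp add: M_def)
  have M: "M > 0" using sum_nonneg[of J K] K(1) by (simp add: M_def add_pos_nonneg)
  \<comment> \<open>From the condition M + R/4 \<le> R/2 on the ball.\<close>
  define R where "R = 4 * M"
  have R: "R > 0" using M by (simp add: R_def)
  \<comment> \<open>The second entry keeps R exp (s/2) within the box, the third makes M exp (s/2)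
    at most 1/8.\<close>
  define s0 where "s0 = Min {s1, 2 * ln (r / R), 2 * ln (1 / (8 * M))}"
  have s0: "s0 \<le> s1" "s0 \<le> 2 * ln (r / R)" "s0 \<le> 2 * ln (1 / (8 * M))" by (auto simp: s0_def)
  have e1: "R * exp (s / 2) \<le> r" if "s \<le> s0" for s
  proof -
    have "exp (s / 2) \<le> exp (ln (r / R))" using that s0 by (subst exp_le_cancel_iff) simp
    thus ?thesis using r R by (simp add: field_simps)
  qed
  have e2: "M * exp (s / 2) \<le> 1 / 8" if "s \<le> s0" for s
  proof -
    have "exp (s / 2) \<le> exp (ln (1 / (8 * M)))" using that s0 by (subst exp_le_cancel_iff) simp
    thus ?thesis using M by (simp add: field_simps)
  qed
  define c where "c s = min s s0" for s
  have c: "c s \<le> s0" "c s \<le> s1" for s using s0 by (auto simp: c_def)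
  have cc: "continuous_on UNIV c" unfolding c_def by (intro continuous_intros)
  have dom: "x \<le> r" if "x \<le> R * exp (1/2 * c s)" for x s using that e1[OF c(1)[of s]] by simp
  define F where "F s u j = A j u + exp (s / 2) *\<^sub>R B j s u" for s u j
  have "\<exists>u. \<forall>j\<in>J. \<forall>s\<in>{..s0}. norm (u j s) \<le> R * exp (1/2 * s) \<and>
    (u j has_vector_derivative lam j *\<^sub>R u j s + F s (\<lambda>i. u i s) j) (at s)"
  proof (rule weighted_ode[where c = c and L = "1/4" and m = "1/2" and B = M])
    fix u :: "nat \<Rightarrow> real \<Rightarrow> complex" and j
    assume u: "\<And>i. i \<in> J \<Longrightarrow> continuous_on UNIV (u i)" "\<And>i s. i \<in> J \<Longrightarrow> norm (u i s) \<le> R * exp (1/2 * c s)" and j: "j \<in> J"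
    have u1: "\<forall>i\<in>J. continuous_on UNIV (u i)" and u2: "\<forall>i\<in>J. \<forall>s. cmod (u i s) \<le> r" using u dom by blast+
    have c': "\<forall>s. c s \<le> s1" using c by blast
    show "continuous_on UNIV (\<lambda>s. F (c s) (\<lambda>i. u i s) j)"
      unfolding F_def
      by (intro continuous_intros cc lip_bounded_continuous[OF A(1)[OF j] cc c' u1 u2] lip_bounded_continuous[OF B[OF j] cc c' u1 u2]) auto
  next
    fix s j \<delta> and u v :: "nat \<Rightarrow> complex"
    assume u: "\<And>i. i \<in> J \<Longrightarrow> norm (u i) \<le> R * exp (1/2 * c s)" and v: "\<And>i. i \<in> J \<Longrightarrow> norm (v i) \<le> R * exp (1/2 * c s)"
      and uv: "\<And>i. i \<in> J \<Longrightarrow> cmod (u i - v i) \<le> \<delta>" and j: "j \<in> J"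
    have d: "inbox J r u" "inbox J r v" "close J \<delta> u v" using u v uv dom by blast+
    have \<delta>: "\<delta> \<ge> 0" using order_trans[OF norm_ge_zero uv[OF j]] .
    have "F (c s) u j - F (c s) v j = (A j u - A j v) + exp (c s / 2) *\<^sub>R (B j (c s) u - B j (c s) v)"
      by (simp add: F_def scaleR_diff_right)
    also have "cmod \<dots> \<le> 1/8 * \<delta> + exp (c s / 2) * (M * \<delta>)"
    proof (rule norm_triangle_mono[OF A(3)[OF j \<delta> d]])
      have "cmod (B j (c s) u - B j (c s) v) \<le> K j * \<delta>" by (rule K(3)[OF j c(2) d(1,2) \<delta> d(3)])
      also have "\<dots> \<le> M * \<delta>" by (rule mult_right_mono[OF KM[OF j] \<delta>])
      finally show "cmod (exp (c s / 2) *\<^sub>R (B j (c s) u - B j (c s) v)) \<le> exp (c s / 2) * (M * \<delta>)"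
        by simp
    qed
    also have "\<dots> = 1/8 * \<delta> + (M * exp (c s / 2)) * \<delta>" by simp
    also have "\<dots> \<le> 1/8 * \<delta> + 1/8 * \<delta>" by (intro add_left_mono mult_right_mono e2 c \<delta>)
    finally show "norm (F (c s) u j - F (c s) v j) \<le> 1/4 * \<delta>" by simp
  next
    fix s j assume j: "j \<in> J"
    have "cmod (B j (c s) (\<lambda>_. 0)) \<le> M"
      by (rule order_trans[OF K(2)[OF j c(2)] KM[OF j]]) (use r in auto)
    thus "norm (F (c s) (\<lambda>_. 0) j) \<le> M * exp (1/2 * c s)"
      by (simp add: F_def A(2)[OF j] mult.commute)
  next
    fix j assume "j \<in> J"
    thus "1/2 \<le> 1/2 - lam j" using lam by simp
  qed (use R cc in \<open>auto simp: c_def R_def\<close>)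
  then obtain u where u: "\<And>j s. j \<in> J \<Longrightarrow> s \<le> s0 \<Longrightarrow> norm (u j s) \<le> R * exp (1/2 * s)"
    "\<And>j s. j \<in> J \<Longrightarrow> s \<le> s0 \<Longrightarrow> (u j has_vector_derivative lam j *\<^sub>R u j s + F s (\<lambda>i. u i s) j) (at s)"
    by (auto simp: Ball_def)
  show ?thesis
  proof (rule exI[of _ s0], rule conjI[OF s0(1)], rule exI[of _ R], rule exI[of _ u], intro ballI allI impI conjI)
    fix j s assume j: "j \<in> J" "s \<le> s0"
    show "cmod (u j s) \<le> R * exp (s / 2)" using u(1)[OF j] by simp
    thus "cmod (u j s) \<le> r" using e1[OF j(2)] by simp
    show "(u j has_vector_derivative lam j *\<^sub>R u j s + (A j (\<lambda>i. u i s) + exp (s / 2) *\<^sub>R B j s (\<lambda>i. u i s))) (at s)"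
      using u(2)[OF j] by (simp add: F_def)
  qed
qed


section \<open>Splitting a vortex into three\<close>

text \<open>
  For vortices of intensities \<open>2k, 2k, -k\<close> at \<open>x\<^sub>1, x\<^sub>2, x\<^sub>3\<close>, put \<open>S = x\<^sub>1 + x\<^sub>2 - 2 x\<^sub>3\<close> and \<open>D = x\<^sub>1 - x\<^sub>2\<close>. With the
  centre of vorticity at 0, \<open>x\<^sub>1 = -S/6 + D/2\<close>, \<open>x\<^sub>2 = -S/6 - D/2\<close> and \<open>x\<^sub>3 = -2S/3\<close>, and \<open>S' = 12 k kern ((S\<^sup>2 - D\<^sup>2) / S)\<close>,
  \<open>D' = 4 k kern (D (S\<^sup>2 - D\<^sup>2) / S\<^sup>2)\<close>.
\<close>

lemma kern_eq: "kern w = \<i> / (2 * pi) * cnj (1 / w)"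
  by (simp add: kern_def)

text \<open>Vortex 1 is separated from the other two by D and (S + D) / 2, and the left side is
  -S'/6 + D'/2. Under the conjugation in \<open>kern\<close> the claim is a partial fraction
  identity.\<close>

lemma triple_velocity_1:
  fixes S D :: complex and k :: real
  assumes "S \<noteq> 0" "D \<noteq> 0" "S + D \<noteq> 0" "S - D \<noteq> 0"
  shows "- (12 * k * kern ((S\<^sup>2 - D\<^sup>2) / S)) / 6 + (4 * k * kern (D * (S\<^sup>2 - D\<^sup>2) / S\<^sup>2)) / 2
    = 2 * k * kern D - k * kern ((S + D) / 2)"
proof -
  have "S\<^sup>2 - D\<^sup>2 = (S + D) * (S - D)" by (simp add: power2_eq_square algebra_simps)
  hence 1: "- (2 * (1 / ((S\<^sup>2 - D\<^sup>2) / S))) + 2 * (1 / (D * (S\<^sup>2 - D\<^sup>2) / S\<^sup>2)) = 2 * (1 / D) - 1 / ((S + D) / 2)"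
    using assms by (simp add: divide_simps) (simp add: power2_eq_square algebra_simps)
  have lin: "- (complex_of_real (12 * k) * (c * a)) / 6 + complex_of_real (4 * k) * (c * b) / 2 = complex_of_real k * c * (- (2 * a) + 2 * b)" for a b c
    by (simp add: algebra_simps)
  have lin': "complex_of_real k * c * (2 * a - b) = complex_of_real (2 * k) * (c * a) - complex_of_real k * (c * b)" for a b c
    by (simp add: algebra_simps)
  have "- (12 * k * kern ((S\<^sup>2 - D\<^sup>2) / S)) / 6 + (4 * k * kern (D * (S\<^sup>2 - D\<^sup>2) / S\<^sup>2)) / 2
     = k * (\<i> / (2 * pi)) * cnj (- (2 * (1 / ((S\<^sup>2 - D\<^sup>2) / S))) + 2 * (1 / (D * (S\<^sup>2 - D\<^sup>2) / S\<^sup>2)))"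
    unfolding kern_eq complex_cnj_add complex_cnj_minus complex_cnj_mult[of 2] complex_cnj_numeral by (rule lin)
  also have "\<dots> = 2 * k * kern D - k * kern ((S + D) / 2)"
    unfolding 1 kern_eq complex_cnj_diff complex_cnj_mult[of 2] complex_cnj_numeral by (rule lin')
  finally show ?thesis .
qed

text \<open>Replacing D by -D exchanges the two equal vortices.\<close>

lemma triple_velocity_2:
  fixes S D :: complex and k :: real
  assumes "S \<noteq> 0" "D \<noteq> 0" "S + D \<noteq> 0" "S - D \<noteq> 0"
  shows "- (12 * k * kern ((S\<^sup>2 - D\<^sup>2) / S)) / 6 - (4 * k * kern (D * (S\<^sup>2 - D\<^sup>2) / S\<^sup>2)) / 2
    = 2 * k * kern (- D) - k * kern ((S - D) / 2)"
  using triple_velocity_1[of S "- D" k] assms by (simp add: kern_def)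

lemma triple_velocity_3:
  fixes S D :: complex and k :: real
  assumes "S \<noteq> 0" "D \<noteq> 0" "S + D \<noteq> 0" "S - D \<noteq> 0"
  shows "- (2 * (12 * k * kern ((S\<^sup>2 - D\<^sup>2) / S)) / 3)
    = 2 * k * kern (- ((S + D) / 2)) + 2 * k * kern (- ((S - D) / 2))"
proof -
  have "S\<^sup>2 - D\<^sup>2 = (S + D) * (S - D)" by (simp add: power2_eq_square algebra_simps)
  hence 1: "- (8 * (1 / ((S\<^sup>2 - D\<^sup>2) / S))) = 2 * (1 / (- ((S + D) / 2))) + 2 * (1 / (- ((S - D) / 2)))"
    using assms by (simp add: divide_simps)
  have lin: "- (2 * (complex_of_real (12 * k) * (c * a)) / 3) = complex_of_real k * c * (- (8 * a))" for a c
    by (simp add: algebra_simps)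
  have lin': "complex_of_real k * c * (2 * a + 2 * b) = complex_of_real (2 * k) * (c * a) + complex_of_real (2 * k) * (c * b)" for a b c
    by (simp add: algebra_simps)
  have "- (2 * (12 * k * kern ((S\<^sup>2 - D\<^sup>2) / S)) / 3)
     = k * (\<i> / (2 * pi)) * cnj (- (8 * (1 / ((S\<^sup>2 - D\<^sup>2) / S))))"
    unfolding kern_eq complex_cnj_minus complex_cnj_mult[of 8] complex_cnj_numeral by (rule lin)
  also have "\<dots> = 2 * k * kern (- ((S + D) / 2)) + 2 * k * kern (- ((S - D) / 2))"
    unfolding 1 kern_eq complex_cnj_add complex_cnj_mult[of 2] complex_cnj_numeral by (rule lin')
  finally show ?thesis .
qed

text \<open>\<open>E\<close> and \<open>E'\<close> measure the deviation from |S|^2 = 3 A t and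
  |D|^2 = A t, and q = D^2 / S^2. The factor 3 between the two offsets the ratio 12 : 4 of the
  coefficients, so one g serves both equations. For E = E' = 1 and q = R0 they read t S' = g S and t
  D' = g D.\<close>

lemma triple_self_similar:
  fixes S D g R0 q :: complex and k A t E E' :: real
  assumes S: "S \<noteq> 0" "S * cnj S = of_real (3 * A * t * E)" and D: "D \<noteq> 0" "D * cnj D = of_real (A * t * E')"
    and q: "D\<^sup>2 = q * S\<^sup>2" "q \<noteq> 1" and pos: "A > 0" "t > 0" "E > 0" "E' > 0"
    and g: "g * cnj (1 - R0) = 2 * k * \<i> / (pi * A)"
  shows "S * (g * (of_real (1 / E) * cnj ((1 - R0) / (1 - q)))) = t * (12 * k * kern ((S\<^sup>2 - D\<^sup>2) / S))"
    and "D * (g * (of_real (1 / E') * cnj ((1 - R0) / (1 - q)))) = t * (4 * k * kern (D * (S\<^sup>2 - D\<^sup>2) / S\<^sup>2))"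
proof -
  define c where "c = cnj (1 - q)"
  have c: "c \<noteq> 0" using q by (simp only: c_def complex_cnj_zero_iff) simp
  have X: "S\<^sup>2 - D\<^sup>2 = S\<^sup>2 * (1 - q)" using q by (simp add: algebra_simps)
  have gg: "g * cnj ((1 - R0) / (1 - q)) = 2 * k * \<i> / (pi * A) / c"
    unfolding complex_cnj_divide c_def[symmetric] using g by simp
  have cS: "cnj S = of_real (3 * A * t * E) / S" using S by (simp add: field_simps)
  have cD: "cnj D = of_real (A * t * E') / D" using D by (simp add: field_simps)
  have "(S\<^sup>2 - D\<^sup>2) / S = S * (1 - q)" unfolding X using S by (simp add: power2_eq_square)
  hence k1: "kern ((S\<^sup>2 - D\<^sup>2) / S) = \<i> / (2 * pi * (of_real (3 * A * t * E) / S * c))"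
    unfolding kern_def cS[symmetric] by (simp only: complex_cnj_mult c_def)
  have "D * (S\<^sup>2 - D\<^sup>2) / S\<^sup>2 = D * (1 - q)" unfolding X using S by simp
  hence k2: "kern (D * (S\<^sup>2 - D\<^sup>2) / S\<^sup>2) = \<i> / (2 * pi * (of_real (A * t * E') / D * c))"
    unfolding kern_def cD[symmetric] by (simp only: complex_cnj_mult c_def)
  have nz: "complex_of_real A \<noteq> 0" "complex_of_real t \<noteq> 0" "complex_of_real E \<noteq> 0" "complex_of_real E' \<noteq> 0" "complex_of_real pi \<noteq> 0"
    using pos by auto
  have "S * (g * (of_real (1 / E) * cnj ((1 - R0) / (1 - q)))) = S * of_real (1 / E) * (2 * k * \<i> / (pi * A) / c)"
    unfolding gg[symmetric] by (simp only: mult_ac)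
  also have "\<dots> = t * (12 * k * kern ((S\<^sup>2 - D\<^sup>2) / S))"
    unfolding k1 using nz c S by (simp add: field_simps)
  finally show "S * (g * (of_real (1 / E) * cnj ((1 - R0) / (1 - q)))) = t * (12 * k * kern ((S\<^sup>2 - D\<^sup>2) / S))" .
  have "D * (g * (of_real (1 / E') * cnj ((1 - R0) / (1 - q)))) = D * of_real (1 / E') * (2 * k * \<i> / (pi * A) / c)"
    unfolding gg[symmetric] by (simp only: mult_ac)
  also have "\<dots> = t * (4 * k * kern (D * (S\<^sup>2 - D\<^sup>2) / S\<^sup>2))"
    unfolding k2 using nz c D by (simp add: field_simps)
  finally show "D * (g * (of_real (1 / E') * cnj ((1 - R0) / (1 - q)))) = t * (4 * k * kern (D * (S\<^sup>2 - D\<^sup>2) / S\<^sup>2))" .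
qed

lemma lip_at0_cmult: "lip_at0 J f \<Longrightarrow> lip_at0 J (\<lambda>u. c * f u)"
  by (rule lip_at0_bounded_linear[OF _ bounded_linear_mult_right])
lemma lip_at0_cnj: "lip_at0 J f \<Longrightarrow> lip_at0 J (\<lambda>u. cnj (f u))"
  by (rule lip_at0_bounded_linear[OF _ bounded_linear_cnj])
lemma lip_at0_Re: "lip_at0 J f \<Longrightarrow> lip_at0 J (\<lambda>u. of_real (Re (f u)))"
  by (rule lip_at0_bounded_linear[OF _ bounded_linear_compose[OF bounded_linear_of_real bounded_linear_Re]])
lemma flat_at0_cmult: "flat_at0 J f \<Longrightarrow> flat_at0 J (\<lambda>u. c * f u)"
  by (rule flat_at0_bounded_linear[OF _ bounded_linear_mult_right])
lemma flat_at0_cnj: "flat_at0 J f \<Longrightarrow> flat_at0 J (\<lambda>u. cnj (f u))"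
  by (rule flat_at0_bounded_linear[OF _ bounded_linear_cnj])
lemma flat_at0_diff: "flat_at0 J f \<Longrightarrow> flat_at0 J g \<Longrightarrow> flat_at0 J (\<lambda>u. f u - g u)"
  using flat_at0_add[OF _ flat_at0_cmult[of J g "-1"], of f] by simp
lemma lip_at0_diff: "lip_at0 J f \<Longrightarrow> lip_at0 J g \<Longrightarrow> lip_at0 J (\<lambda>u. f u - g u)"
  using lip_at0_add[OF _ lip_at0_cmult[of J g "-1"], of f] by simp

lemma lip_at0_exp_minus_1:
  assumes "lip_at0 J f"
  shows "lip_at0 J (\<lambda>u. exp (f u) - 1)"
  using lip_at0_add[OF flat_at0_imp_lip_at0[OF flat_at0_exp[OF assms]] assms] by simp

lemma lip_at0_geometric:
  assumes "lip_at0 J f"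
  shows "lip_at0 J (\<lambda>u. 1 / (1 - f u) - 1)"
  using lip_at0_add[OF flat_at0_imp_lip_at0[OF flat_at0_geometric[OF assms]] assms] by simp

section \<open>Coordinates around the self-similar motion\<close>

locale vortex_burst =
  fixes N :: nat and \<xi> :: "nat \<Rightarrow> real" and z :: "nat \<Rightarrow> complex"
  assumes N: "N \<ge> 1" and inj: "inj_on z {1..N}" and \<xi>1: "\<xi> 1 \<noteq> 0"
begin

text \<open>
  The self-similar motion is \<open>S = f \<sigma>\<close>, \<open>D = f\<close> with \<open>f = \<surd>A exp (\<gamma> s)\<close>, \<open>s = ln t\<close>; here \<open>\<bar>S\<bar>\<^sup>2 = 3 \<bar>D\<bar>\<^sup>2\<close> is forced, and
  \<open>R0 = D\<^sup>2 / S\<^sup>2\<close> is chosen such that the motion expands (\<open>A > 0\<close>) for either sign of \<open>k\<close>. A general motion is written as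
  \<open>S = f \<sigma> exp pp\<close>, \<open>D = f exp (pp + dd)\<close>. The linearised equations are \<open>pp' = -2 \<gamma> Re pp + cp\<close> and \<open>dd' = -2 \<gamma> Re dd\<close>,
  diagonal up to \<open>cp\<close> in the real coordinates given by the basis \<open>2 \<gamma>, \<i>\<close>; the factor \<open>\<eta>\<close> in \<open>dd\<close> makes the coupling \<open>cp\<close> small.
\<close>

definition k where "k = \<xi> 1 / 3"
definition \<epsilon> :: real where "\<epsilon> = sgn k"
definition A where "A = 6 * \<bar>k\<bar> / (5 * pi)"
definition \<gamma> :: complex where "\<gamma> = (1 + 3 * \<epsilon> * \<i>) / 2"
definition R0 :: complex where "R0 = \<epsilon> * \<i> / 3"
definition \<sigma> :: complex where "\<sigma> = csqrt (1 / R0)"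
definition \<rho> :: complex where "\<rho> = 2 * R0 / (1 - R0)"
definition c0 :: real where "c0 = 2 * cmod \<gamma> + 1"
definition \<eta> :: real where "\<eta> = 1 / (64 * (cmod \<gamma> * cmod \<rho> * c0 + 1))"
definition J where "J = {1..N + 4}"

lemma k0: "k \<noteq> 0" using \<xi>1 by (simp add: k_def)
lemma \<epsilon>: "\<epsilon> = 1 \<or> \<epsilon> = -1" "\<epsilon> * \<epsilon> = 1" "\<epsilon> * \<bar>k\<bar> = k"
  using k0 by (auto simp: \<epsilon>_def sgn_if)
lemma A: "A > 0" using k0 by (simp add: A_def)
lemma c0: "c0 \<ge> 1" by (simp add: c0_def)
lemma \<eta>: "0 < \<eta>" "\<eta> \<le> 1" "cmod \<gamma> * cmod \<rho> * c0 * \<eta> \<le> 1 / 64"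
proof -
  have n: "cmod \<gamma> * cmod \<rho> * c0 \<ge> 0" using c0 by (intro mult_nonneg_nonneg) auto
  thus "0 < \<eta>" "\<eta> \<le> 1" "cmod \<gamma> * cmod \<rho> * c0 * \<eta> \<le> 1 / 64"
    by (auto simp: \<eta>_def divide_simps)
qed
lemma two_\<gamma>: "2 * \<gamma> = 1 + 3 * \<epsilon> * \<i>" by (simp add: \<gamma>_def)
lemma Re_\<gamma>: "Re \<gamma> = 1 / 2" by (simp add: \<gamma>_def)
lemma norm_R0: "cmod R0 = 1 / 3" using \<epsilon>(1) by (auto simp: R0_def norm_divide norm_mult)
lemma R0: "R0 \<noteq> 0" "R0 \<noteq> 1" using norm_R0 by auto
lemma \<sigma>: "\<sigma>\<^sup>2 = 1 / R0" "cmod \<sigma> * cmod \<sigma> = 3" "\<sigma> \<noteq> 0" "cmod \<sigma> \<le> 2"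
proof -
  show 1: "\<sigma>\<^sup>2 = 1 / R0" by (simp add: \<sigma>_def)
  have "cmod (\<sigma>\<^sup>2) = 3" unfolding 1 by (simp add: norm_divide norm_R0)
  thus 2: "cmod \<sigma> * cmod \<sigma> = 3" by (simp add: norm_mult power2_eq_square)
  thus "\<sigma> \<noteq> 0" by auto
  show "cmod \<sigma> \<le> 2" by (rule power2_le_imp_le) (use 2 in \<open>auto simp: power2_eq_square\<close>)
qed
text \<open>The condition on g in \<open>triple_self_similar\<close>. With R0 = \<epsilon> \<i> / 3
  it makes Re \<gamma> positive, and Re \<gamma> = 1/2, growth like the square root of time, then
  fixes A = 6 |k| / (5 pi).\<close>

lemma \<gamma>_R0: "\<gamma> * cnj (1 - R0) = 2 * k * \<i> / (pi * A)"
proof -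
  have ee: "complex_of_real \<epsilon> * complex_of_real \<epsilon> = 1" using \<epsilon>(2) by (metis of_real_1 of_real_mult)
  have "\<gamma> * cnj (1 - R0) = (1 + 3 * \<epsilon> * \<i>) * (1 + \<epsilon> * \<i> / 3) / 2" by (simp add: \<gamma>_def R0_def)
  also have "\<dots> = (1 - complex_of_real \<epsilon> * complex_of_real \<epsilon> + (10 / 3) * \<epsilon> * \<i>) / 2"
    by (simp add: algebra_simps)
  also have "\<dots> = of_real (5 / 3 * \<epsilon>) * \<i>" unfolding ee by simp
  also have "5 / 3 * \<epsilon> = 2 * k / (pi * A)"
    using k0 \<epsilon>(3) by (simp add: A_def field_simps)
  finally show ?thesis by simp
qed

definition pp :: "(nat \<Rightarrow> complex) \<Rightarrow> complex" where
  "pp u = 2 * \<gamma> * of_real (Re (u (N + 1))) + \<i> * of_real (Re (u (N + 2)))"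
definition dd :: "(nat \<Rightarrow> complex) \<Rightarrow> complex" where
  "dd u = of_real \<eta> * (2 * \<gamma> * of_real (Re (u (N + 3))) + \<i> * of_real (Re (u (N + 4))))"
text \<open>Chosen such that 1 - yy = (1 - q) / (1 - R0) for q = D^2 / S^2 = R0 exp (2 dd);
  \<open>Ph\<close> is then the ratio (1 - R0) / (1 - q) of
  \<open>triple_self_similar\<close>.\<close>

definition yy where "yy u = R0 / (1 - R0) * (exp (2 * dd u) - 1)"
definition Ph where "Ph u = 1 / (1 - yy u)"
text \<open>\<open>al\<close> and \<open>al'\<close> are 1 / E - 1 and 1 / E' - 1 in the notation of
  \<open>triple_self_similar\<close>.\<close>

definition al where "al u = exp (- 2 * complex_of_real (Re (pp u))) - 1"
definition al' where "al' u = exp (- 2 * complex_of_real (Re (pp u + dd u))) - 1"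
text \<open>The first-order effect of \<open>dd\<close> on the equation for \<open>pp\<close>:
  \<rho> is the derivative of \<open>Ph\<close> with respect to \<open>dd\<close> at 0.\<close>

definition cp where "cp u = \<gamma> * cnj (\<rho> * dd u)"
definition rp where "rp u = \<gamma> * ((al u - (- 2 * of_real (Re (pp u)))) + (cnj (Ph u - 1 - \<rho> * dd u) + al u * cnj (Ph u - 1)))"
definition rd where "rd u = \<gamma> * (((al' u - (- 2 * of_real (Re (pp u + dd u)))) - (al u - (- 2 * of_real (Re (pp u))))) + cnj (Ph u - 1) * (al' u - al u))"

text \<open>The left side is S' / S - \<gamma> for the isolated triple in the variable s; it is
  split into a linear part, the coupling and a remainder.\<close>

lemma rp_eq: "\<gamma> * ((al u + 1) * cnj (Ph u) - 1) = - 2 * \<gamma> * of_real (Re (pp u)) + (cp u + rp u)"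
  unfolding cp_def rp_def complex_cnj_diff complex_cnj_one by (simp add: algebra_simps)

text \<open>The left side is D' / D - S' / S for the isolated triple. Its linear part involves
  \<open>dd\<close> alone, so to first order \<open>pp\<close> does not act back on
  \<open>dd\<close>.\<close>

lemma rd_eq: "\<gamma> * (cnj (Ph u) * (al' u - al u)) = - 2 * \<gamma> * of_real (Re (dd u)) + rd u"
  unfolding rd_def complex_cnj_diff complex_cnj_one by (simp add: algebra_simps)

lemma one_minus_yy: "1 - yy u = (1 - R0 * exp (2 * dd u)) / (1 - R0)"
  using R0 by (simp add: yy_def divide_simps) (simp add: algebra_simps)

lemma Ph_eq: "Ph u = (1 - R0) / (1 - R0 * exp (2 * dd u))"
  by (simp add: Ph_def one_minus_yy)

lemma mem_J: "N + 1 \<in> J" "N + 2 \<in> J" "N + 3 \<in> J" "N + 4 \<in> J" "j \<in> {1..N} \<Longrightarrow> j \<in> J" "1 \<in> J"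
  using N by (auto simp: J_def)

lemma finite_J: "finite J" "J \<noteq> {}" using N by (auto simp: J_def)

lemma lip_at0_pp: "lip_at0 J pp" and lip_at0_dd: "lip_at0 J dd"
  unfolding pp_def[abs_def] dd_def[abs_def]
  by (intro lip_at0_add lip_at0_cmult lip_at0_Re lip_at0_proj mem_J)+

lemma lip_at0_al: "lip_at0 J al"
  unfolding al_def[abs_def] by (intro lip_at0_exp_minus_1 lip_at0_cmult lip_at0_Re lip_at0_pp)

lemma lip_at0_al': "lip_at0 J al'"
  unfolding al'_def[abs_def] by (intro lip_at0_exp_minus_1 lip_at0_cmult lip_at0_Re lip_at0_add lip_at0_pp lip_at0_dd)

lemma lip_at0_yy: "lip_at0 J yy"
  unfolding yy_def[abs_def] by (intro lip_at0_cmult lip_at0_exp_minus_1 lip_at0_dd)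

lemma lip_at0_Ph: "lip_at0 J (\<lambda>u. Ph u - 1)"
  unfolding Ph_def by (rule lip_at0_geometric[OF lip_at0_yy])

lemma flat_at0_Ph: "flat_at0 J (\<lambda>u. Ph u - 1 - \<rho> * dd u)"
proof -
  have "flat_at0 J (\<lambda>u. (1 / (1 - yy u) - 1 - yy u) + R0 / (1 - R0) * (exp (2 * dd u) - 1 - 2 * dd u))"
    by (intro flat_at0_add flat_at0_geometric lip_at0_yy flat_at0_cmult flat_at0_exp lip_at0_cmult lip_at0_dd)
  moreover have "(1 / (1 - yy u) - 1 - yy u) + R0 / (1 - R0) * (exp (2 * dd u) - 1 - 2 * dd u) = Ph u - 1 - \<rho> * dd u" for u
    by (simp add: Ph_def yy_def \<rho>_def algebra_simps)
  ultimately show ?thesis by (simp only:)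
qed

lemma flat_at0_al: "flat_at0 J (\<lambda>u. al u - (- 2 * of_real (Re (pp u))))"
  unfolding al_def by (intro flat_at0_exp lip_at0_cmult lip_at0_Re lip_at0_pp)

lemma flat_at0_al': "flat_at0 J (\<lambda>u. al' u - (- 2 * of_real (Re (pp u + dd u))))"
  unfolding al'_def by (intro flat_at0_exp lip_at0_cmult lip_at0_Re lip_at0_add lip_at0_pp lip_at0_dd)

lemma flat_at0_rp: "flat_at0 J rp"
  unfolding rp_def[abs_def]
  by (intro flat_at0_cmult flat_at0_add flat_at0_al flat_at0_cnj flat_at0_Ph flat_at0_mult lip_at0_al lip_at0_cnj lip_at0_Ph)

lemma flat_at0_rd: "flat_at0 J rd"
  unfolding rd_def[abs_def]
  by (intro flat_at0_cmult flat_at0_add flat_at0_diff flat_at0_al flat_at0_al' flat_at0_mult lip_at0_diff lip_at0_al lip_at0_al' lip_at0_cnj lip_at0_Ph)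

lemma twisted_norm: "cmod (2 * \<gamma> * of_real (Re a) + \<i> * of_real (Re b)) \<le> c0 * \<delta>" if "cmod a \<le> \<delta>" "cmod b \<le> \<delta>" for a b \<delta>
proof -
  have "cmod (2 * \<gamma> * of_real (Re a)) \<le> 2 * cmod \<gamma> * \<delta>"
    unfolding norm_mult norm_of_real using order_trans[OF abs_Re_le_cmod that(1)] by (simp add: mult_left_mono)
  moreover have "cmod (\<i> * of_real (Re b)) \<le> 1 * \<delta>"
    unfolding norm_mult norm_of_real using order_trans[OF abs_Re_le_cmod that(2)] by simp
  ultimately have "cmod (2 * \<gamma> * of_real (Re a) + \<i> * of_real (Re b)) \<le> 2 * cmod \<gamma> * \<delta> + 1 * \<delta>"
    by (rule norm_triangle_mono)
  thus ?thesis by (simp add: c0_def algebra_simps)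
qed

lemma pp_norm: "inbox J r u \<Longrightarrow> cmod (pp u) \<le> c0 * r"
  unfolding pp_def by (intro twisted_norm) (use mem_J in auto)

lemma dd_norm: "inbox J r u \<Longrightarrow> cmod (dd u) \<le> c0 * r"
proof -
  assume u: "inbox J r u"
  have n: "cmod (2 * \<gamma> * of_real (Re (u (N + 3))) + \<i> * of_real (Re (u (N + 4)))) \<le> c0 * r"
    by (intro twisted_norm) (use mem_J u in auto)
  have "cmod (dd u) = \<eta> * cmod (2 * \<gamma> * of_real (Re (u (N + 3))) + \<i> * of_real (Re (u (N + 4))))"
    unfolding dd_def norm_mult[of "of_real \<eta>"] using \<eta> by simp
  also have "\<dots> \<le> 1 * (c0 * r)" by (rule mult_mono[OF \<eta>(2) n]) auto
  finally show ?thesis by simp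
qed

text \<open>\<open>cp\<close> is linear and gains nothing from a smaller box; the factor \<eta>
  inside \<open>dd\<close> is what makes its constant small.\<close>

lemma cp_lipschitz:
  assumes "\<delta> \<ge> 0" "close J \<delta> u v"
  shows "cmod (cp u - cp v) \<le> 1 / 64 * \<delta>"
proof -
  have "dd u - dd v = of_real \<eta> * (2 * \<gamma> * of_real (Re (u (N + 3) - v (N + 3))) + \<i> * of_real (Re (u (N + 4) - v (N + 4))))"
    by (simp add: dd_def algebra_simps)
  moreover have "cmod (2 * \<gamma> * of_real (Re (u (N + 3) - v (N + 3))) + \<i> * of_real (Re (u (N + 4) - v (N + 4)))) \<le> c0 * \<delta>"
    by (intro twisted_norm) (use mem_J assms in auto)
  ultimately have d: "cmod (dd u - dd v) \<le> \<eta> * (c0 * \<delta>)"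
    using \<eta> by (simp only: norm_mult[of "of_real \<eta>"] norm_of_real) (simp add: mult_left_mono)
  have "cp u - cp v = \<gamma> * cnj (\<rho> * (dd u - dd v))"
    by (simp add: cp_def algebra_simps)
  hence "cmod (cp u - cp v) = cmod \<gamma> * cmod \<rho> * cmod (dd u - dd v)"
    by (simp add: norm_mult del: complex_cnj_mult complex_cnj_diff)
  also have "\<dots> \<le> cmod \<gamma> * cmod \<rho> * (\<eta> * (c0 * \<delta>))" by (intro mult_left_mono d mult_nonneg_nonneg) auto
  also have "\<dots> = (cmod \<gamma> * cmod \<rho> * c0 * \<eta>) * \<delta>" by simp
  also have "\<dots> \<le> 1 / 64 * \<delta>" by (rule mult_right_mono[OF \<eta>(3) assms(1)])
  finally show ?thesis .
qed

text \<open>The coordinate along \<open>\<i>\<close> with respect to the basis \<open>2 \<gamma>, \<i>\<close>; the other coordinate is the real part.\<close>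

definition twist :: "complex \<Rightarrow> complex" where "twist w = of_real (Im w - 3 * \<epsilon> * Re w)"

lemma bounded_linear_twist: "bounded_linear twist"
proof -
  have "bounded_linear (\<lambda>w. complex_of_real (Im w - (3 * \<epsilon>) * Re w))"
    by (intro bounded_linear_compose[OF bounded_linear_of_real] bounded_linear_sub bounded_linear_Im
        bounded_linear_compose[OF bounded_linear_mult_right bounded_linear_Re])
  thus ?thesis unfolding twist_def[abs_def] .
qed

lemma twist_norm: "cmod (twist w) \<le> 4 * cmod w"
proof -
  have "\<bar>Im w - 3 * \<epsilon> * Re w\<bar> \<le> \<bar>Im w\<bar> + 3 * \<bar>Re w\<bar>" using \<epsilon>(1) by auto
  thus ?thesis unfolding twist_def norm_of_real using abs_Im_le_cmod[of w] abs_Re_le_cmod[of w] by linarith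
qed

lemma twist_inverse: "2 * \<gamma> * of_real (Re w) + \<i> * twist w = w"
  by (simp add: two_\<gamma> twist_def complex_eq_iff)

text \<open>The autonomous part without the diagonal terms, in real coordinates; the division by
  \<eta> undoes the scaling of \<open>dd\<close>.\<close>

definition Aj :: "nat \<Rightarrow> (nat \<Rightarrow> complex) \<Rightarrow> complex" where
  "Aj j u = (if j \<le> N then 0 else if j = N + 1 then of_real (Re (cp u + rp u))
     else if j = N + 2 then twist (cp u + rp u)
     else if j = N + 3 then of_real (Re (rd u)) / of_real \<eta> else twist (rd u) / of_real \<eta>)"

lemma Aj_0: "Aj j (\<lambda>_. 0) = 0"
  using flat_at0_rp flat_at0_rd by (simp add: Aj_def flat_at0_def cp_def dd_def twist_def)

text \<open>Coupling and remainder contribute 1/64 each, and \<eta>/32 for \<open>rd\<close> becomes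
  1/32 after the division by \<eta>. \<open>twist\<close> costs a factor 4, which gives 1/8.\<close>

lemma Aj_lipschitz:
  obtains r where "r > 0" "\<And>j u v \<delta>. \<delta> \<ge> 0 \<Longrightarrow> inbox J r u \<Longrightarrow> inbox J r v \<Longrightarrow>
    close J \<delta> u v \<Longrightarrow> cmod (Aj j u - Aj j v) \<le> 1/8 * \<delta>"
proof -
  have "lip_near0 J (1/64) rp" using flat_at0_rp by (simp add: flat_at0_def)
  then obtain r1 where r1: "r1 > 0" "\<And>u v \<delta>. \<delta> \<ge> 0 \<Longrightarrow> inbox J r1 u \<Longrightarrow> inbox J r1 v \<Longrightarrow>
    close J \<delta> u v \<Longrightarrow> cmod (rp u - rp v) \<le> 1/64 * \<delta>" by (elim lip_near0E) blast
  have "lip_near0 J (\<eta>/32) rd" using flat_at0_rd \<eta>(1) by (simp add: flat_at0_def)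
  then obtain r2 where r2: "r2 > 0" "\<And>u v \<delta>. \<delta> \<ge> 0 \<Longrightarrow> inbox J r2 u \<Longrightarrow> inbox J r2 v \<Longrightarrow>
    close J \<delta> u v \<Longrightarrow> cmod (rd u - rd v) \<le> \<eta>/32 * \<delta>" by (elim lip_near0E) blast
  have "cmod (Aj j u - Aj j v) \<le> 1/8 * \<delta>"
    if \<delta>: "\<delta> \<ge> 0" and u: "inbox J (min r1 r2) u" and v: "inbox J (min r1 r2) v"
      and uv: "close J \<delta> u v" for j u v \<delta>
  proof -
    define a where "a = (cp u + rp u) - (cp v + rp v)"
    define b where "b = (rd u - rd v) / of_real \<eta>"
    have "a = (cp u - cp v) + (rp u - rp v)" by (simp add: a_def)
    also have "cmod \<dots> \<le> 1/64 * \<delta> + 1/64 * \<delta>"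
      by (intro norm_triangle_mono cp_lipschitz r1 \<delta> uv) (use u v in auto)
    finally have a: "cmod a \<le> 1/32 * \<delta>" by simp
    have "cmod (rd u - rd v) \<le> \<eta>/32 * \<delta>" by (intro r2 \<delta> uv) (use u v in auto)
    hence b: "cmod b \<le> 1/32 * \<delta>" using \<eta>(1) by (simp add: b_def norm_divide field_simps)
    have tw: "cmod (twist w) \<le> 1/8 * \<delta>" "cmod (of_real (Re w)) \<le> 1/8 * \<delta>" if "cmod w \<le> 1/32 * \<delta>" for w
      using twist_norm[of w] abs_Re_le_cmod[of w] that \<delta> by (auto simp del: of_real_Re)
    have lin: "twist x - twist y = twist (x - y)" "twist x / of_real \<eta> - twist y / of_real \<eta> = twist ((x - y) / of_real \<eta>)"
       "complex_of_real (Re x) - of_real (Re y) = of_real (Re (x - y))"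
       "complex_of_real (Re x) / of_real \<eta> - of_real (Re y) / of_real \<eta> = of_real (Re ((x - y) / of_real \<eta>))" for x y
      using \<eta>(1) by (auto simp: twist_def complex_eq_iff field_simps)
    show ?thesis
    proof -
      consider "j \<le> N" | "j = N + 1" | "j = N + 2" | "j = N + 3" | "j > N + 3" by linarith
      thus ?thesis
      proof cases
        case 1
        thus ?thesis using \<delta> by (simp add: Aj_def)
      next
        case 2
        hence "Aj j u - Aj j v = of_real (Re a)" unfolding a_def lin(3)[symmetric] by (simp add: Aj_def)
        thus ?thesis using tw(2)[OF a] by (simp only:)
      next
        case 3
        hence "Aj j u - Aj j v = twist a" unfolding a_def lin(1)[symmetric] by (simp add: Aj_def)
        thus ?thesis using tw(1)[OF a] by (simp only:)
      next
        case 4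
        hence "Aj j u - Aj j v = of_real (Re b)" unfolding b_def lin(4)[symmetric] by (simp add: Aj_def)
        thus ?thesis using tw(2)[OF b] by (simp only:)
      next
        case 5
        hence "Aj j u - Aj j v = twist b" unfolding b_def lin(2)[symmetric] by (simp add: Aj_def)
        thus ?thesis using tw(1)[OF b] by (simp only:)
      qed
    qed
  qed
  with r1 r2 show ?thesis by (intro that[of "min r1 r2"]) auto
qed

end

section \<open>The triple among the other vortices\<close>

context vortex_burst begin

text \<open>
  The unknown \<open>u 1\<close> is the displacement of the centre of vorticity of the triple; indices \<open>1, N + 1, N + 2\<close> are the
  three vortices of the triple, with intensities \<open>2k, 2k, -k\<close>. The other vortices induce \<open>ext\<close> on the triple.
\<close>

definition f :: "real \<Rightarrow> complex" where "f s = of_real (sqrt A) * exp (\<gamma> * of_real s)"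
definition S where "S s u = f s * \<sigma> * exp (pp u)"
definition D where "D s u = f s * exp (pp u + dd u)"
definition pos :: "real \<Rightarrow> (nat \<Rightarrow> complex) \<Rightarrow> nat \<Rightarrow> complex" where
  "pos s u i = (if i = 1 then z 1 + u 1 - S s u / 6 + D s u / 2
     else if i = N + 1 then z 1 + u 1 - S s u / 6 - D s u / 2
     else if i = N + 2 then z 1 + u 1 - 2 * S s u / 3 else z i + u i)"
definition \<kappa> :: "nat \<Rightarrow> real" where
  "\<kappa> i = (if i = 1 \<or> i = N + 1 then 2 * k else if i = N + 2 then - k else \<xi> i)"
definition ext where "ext s u i = (\<Sum>l=2..N. \<xi> l *\<^sub>R kern (pos s u i - pos s u l))"
definition ES where "ES s u = ext s u 1 + ext s u (N + 1) - 2 * ext s u (N + 2)"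
definition ED where "ED s u = ext s u 1 - ext s u (N + 1)"
text \<open>The weights are 2k, 2k, -k divided by the total 3k: the mutual velocities inside the
  triple do not move its centre.\<close>

definition EC where "EC s u = (2 / 3) * ext s u 1 + (2 / 3) * ext s u (N + 1) - (1 / 3) * ext s u (N + 2)"
text \<open>The external term exp s * ES divided by S is exp (s/2) * GS. As |f s| is proportional to
  exp (s/2), \<open>GS\<close> stays bounded as s tends to minus infinity.\<close>

definition GS where "GS s u = exp (of_real s / 2) / (f s * \<sigma>) * exp (- pp u) * ES s u"
definition GD where "GD s u = exp (of_real s / 2) / f s * exp (- (pp u + dd u)) * ED s u"
text \<open>d/ds is exp s times d/dt. One factor exp (s/2) is supplied by
  \<open>perturbed_linear_ode\<close>; the other is kept in the first two cases and cancels the size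
  of the triple in the rest.\<close>

definition Bj :: "nat \<Rightarrow> real \<Rightarrow> (nat \<Rightarrow> complex) \<Rightarrow> complex" where
  "Bj j s u = (if j = 1 then exp (of_real s / 2) * EC s u
     else if j \<le> N then exp (of_real s / 2) * cvel (N + 2) \<kappa> (pos s u) j
     else if j = N + 1 then of_real (Re (GS s u)) else if j = N + 2 then twist (GS s u)
     else if j = N + 3 then of_real (Re ((GD s u - GS s u) / of_real \<eta>)) else twist ((GD s u - GS s u) / of_real \<eta>))"

text \<open>Smallness of the exponents \<open>pp\<close> and \<open>dd\<close>, of the displacements
  and of the triple; together they keep the triple apart from the other vortices, see
  \<open>pos_far\<close>.\<close>

definition good where
  "good r s1 \<longleftrightarrow> 0 < r \<and> c0 * r \<le> 1 / 8 \<and> r \<le> separation N z / 8 \<and> 9 * sqrt A * exp (s1 / 2) \<le> separation N z / 8"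

lemma sep_pos: "separation N z > 0" by (rule separation_pos[OF inj])

lemma norm_f: "cmod (f s) = sqrt A * exp (s / 2)"
proof -
  have "Re (\<gamma> * of_real s) = s / 2" by (simp add: Re_\<gamma>)
  thus ?thesis using A by (simp add: f_def norm_mult)
qed

lemma f_nz: "f s \<noteq> 0" using A by (simp add: f_def)
lemma S_nz: "S s u \<noteq> 0" using f_nz \<sigma> by (simp add: S_def)
lemma D_nz: "D s u \<noteq> 0" using f_nz by (simp add: D_def)

lemma D_S: "(D s u)\<^sup>2 = R0 * exp (2 * dd u) * (S s u)\<^sup>2"
proof -
  have "exp (pp u + dd u) = exp (pp u) * exp (dd u)" by (rule exp_add)
  moreover have "exp (2 * dd u) = (exp (dd u))\<^sup>2" by (rule exp_double)
  ultimately have "R0 * exp (2 * dd u) * (S s u)\<^sup>2 = (R0 * \<sigma>\<^sup>2) * (f s * exp (pp u + dd u))\<^sup>2"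
    by (simp add: S_def power2_eq_square mult_ac)
  thus ?thesis using R0 by (simp add: D_def \<sigma>(1))
qed

lemma S_cnj: "S s u * cnj (S s u) = of_real (3 * A * exp s * exp (2 * Re (pp u)))"
proof -
  have "S s u * cnj (S s u) = of_real ((cmod (S s u))\<^sup>2)" by (rule complex_norm_square[symmetric])
  also have "(cmod (S s u))\<^sup>2 = (cmod \<sigma> * cmod \<sigma>) * (sqrt A * sqrt A) * (exp (s / 2) * exp (s / 2)) * (exp (Re (pp u)) * exp (Re (pp u)))"
    by (simp add: S_def norm_mult norm_f power2_eq_square)
  also have "\<dots> = 3 * A * exp s * exp (2 * Re (pp u))"
    using A by (simp add: \<sigma> flip: exp_add)
  finally show ?thesis .
qed

lemma D_cnj: "D s u * cnj (D s u) = of_real (A * exp s * exp (2 * Re (pp u + dd u)))"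
proof -
  have "D s u * cnj (D s u) = of_real ((cmod (D s u))\<^sup>2)" by (rule complex_norm_square[symmetric])
  also have "(cmod (D s u))\<^sup>2 = (sqrt A * sqrt A) * (exp (s / 2) * exp (s / 2)) * (exp (Re (pp u + dd u)) * exp (Re (pp u + dd u)))"
    by (simp add: D_def norm_mult norm_f power2_eq_square)
  also have "\<dots> = A * exp s * exp (2 * Re (pp u + dd u))"
    using A by (simp flip: exp_add)
  finally show ?thesis .
qed

context
  fixes r s1 :: real
  assumes good: "good r s1"
begin

lemma exp_quarter: "x \<le> 1 / 4 \<Longrightarrow> exp x \<le> exp (1/4 :: real)" "exp (1/4) < (3::real)"
proof -
  have "exp (1/4) < exp (1::real)" by simp
  also have "\<dots> \<le> 3" by (rule exp_le)
  finally show "exp (1/4) < (3::real)" .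
qed simp

lemma pp_dd_small:
  assumes "inbox J r u"
  shows "cmod (pp u) \<le> 1 / 8" "cmod (dd u) \<le> 1 / 8" "cmod (pp u + dd u) \<le> 1 / 4"
  using pp_norm[OF assms] dd_norm[OF assms] good norm_triangle_ineq[of "pp u" "dd u"] by (auto simp: good_def)

text \<open>|R0| = 1/3 leaves enough room: since exp (1/4) < 3, the ratio q = D^2 / S^2 stays away
  from 1.\<close>

lemma norm_q: "inbox J r u \<Longrightarrow> cmod (R0 * exp (2 * dd u)) \<le> exp (1/4) / 3"
proof -
  assume u: "inbox J r u"
  have "Re (2 * dd u) \<le> 1 / 4" using pp_dd_small(2)[OF u] complex_Re_le_cmod[of "dd u"] by simp
  thus ?thesis by (simp add: norm_mult norm_R0)
qed

lemma q_ne_1: "inbox J r u \<Longrightarrow> R0 * exp (2 * dd u) \<noteq> 1"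
  using norm_q[of u] exp_quarter(2) by auto

text \<open>S + D and S - D are twice the vectors from the third vortex of the triple to the other
  two.\<close>

lemma S_pm_D_nz:
  assumes "inbox J r u"
  shows "S s u + D s u \<noteq> 0" "S s u - D s u \<noteq> 0"
proof -
  have "(S s u)\<^sup>2 \<noteq> (D s u)\<^sup>2"
    using q_ne_1[OF assms] S_nz[of s u] unfolding D_S by simp
  moreover have "(S s u)\<^sup>2 - (D s u)\<^sup>2 = (S s u + D s u) * (S s u - D s u)"
    by (simp add: power2_eq_square algebra_simps)
  ultimately show "S s u + D s u \<noteq> 0" "S s u - D s u \<noteq> 0" by auto
qed

text \<open>9 = 2 * 3 + 3, from |\<sigma>| \<le> 2 and the bound 3 for both exponentials.\<close>

lemma S_D_small:
  assumes u: "inbox J r u"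
  shows "cmod (S s u) + cmod (D s u) \<le> 9 * sqrt A * exp (s / 2)"
proof -
  have e: "exp (Re w) \<le> 3" if "cmod w \<le> 1 / 4" for w
    using exp_quarter(1)[of "Re w"] exp_quarter(2) that complex_Re_le_cmod[of w] by linarith
  have p: "0 \<le> sqrt A * exp (s / 2)" using A by simp
  have "cmod (S s u) \<le> sqrt A * exp (s / 2) * 2 * 3"
    using A pp_dd_small[OF u] e[of "pp u"] \<sigma>(4) p unfolding S_def norm_mult norm_f norm_exp_eq_Re
    by (intro mult_mono) auto
  moreover have "cmod (D s u) \<le> sqrt A * exp (s / 2) * 3"
    using A pp_dd_small[OF u] e[of "pp u + dd u"] p unfolding D_def norm_mult norm_f norm_exp_eq_Re
    by (intro mult_mono) auto
  ultimately show ?thesis by simp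
qed

lemma pos_near:
  assumes u: "inbox J r u"
  shows "i \<in> {1, N + 1, N + 2} \<Longrightarrow> cmod (pos s u i - z 1) \<le> cmod (u 1) + 9 * sqrt A * exp (s / 2)"
    and "i \<in> {2..N} \<Longrightarrow> pos s u i = z i + u i"
proof -
  show "cmod (pos s u i - z 1) \<le> cmod (u 1) + 9 * sqrt A * exp (s / 2)" if i: "i \<in> {1, N + 1, N + 2}"
  proof -
    obtain a b :: real where ab: "pos s u i - z 1 = u 1 + (of_real a * S s u + of_real b * D s u)" "\<bar>a\<bar> \<le> 1" "\<bar>b\<bar> \<le> 1"
    proof -
      consider "i = 1" | "i = N + 1" | "i = N + 2" using i by auto
      thus thesis
      proof cases
        case 1 thus thesis using that[of "-1/6" "1/2"] by (simp add: pos_def)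
      next
        case 2 thus thesis using that[of "-1/6" "-1/2"] N by (simp add: pos_def)
      next
        case 3 thus thesis using that[of "-2/3" 0] N by (simp add: pos_def)
      qed
    qed
    have "cmod (of_real a * S s u + of_real b * D s u) \<le> 1 * cmod (S s u) + 1 * cmod (D s u)"
      using ab by (intro norm_triangle_mono) (auto simp: norm_mult mult_left_le_one_le)
    hence "cmod (of_real a * S s u + of_real b * D s u) \<le> cmod (S s u) + cmod (D s u)" by simp
    hence "cmod (pos s u i - z 1) \<le> cmod (u 1) + (cmod (S s u) + cmod (D s u))"
      unfolding ab(1) by (rule norm_triangle_mono[OF order_refl])
    thus ?thesis using S_D_small[OF u, of s] by simp
  qed
  show "pos s u i = z i + u i" if "i \<in> {2..N}" using that by (auto simp: pos_def)
qed

text \<open>With d the initial separation, vortex l has moved by at most d/8 and vortex i lies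
  within d/4 of a starting point other than that of l, so 5 d / 8 remain.\<close>

lemma pos_far:
  assumes s: "s \<le> s1" and u: "inbox J r u" and i: "i \<in> {1..N + 2}" and l: "l \<in> {2..N}" and il: "i \<noteq> l"
  shows "separation N z / 2 \<le> cmod (pos s u i - pos s u l)"
proof -
  let ?d = "separation N z"
  have l': "l \<in> {1..N}" using l by auto
  have 1: "cmod (pos s u l - z l) \<le> ?d / 8"
    using pos_near(2)[OF u l] good u mem_J(5)[OF l'] by (auto simp: good_def intro: order_trans)
  obtain j where j: "j \<in> {1..N}" "j \<noteq> l" "cmod (pos s u i - z j) \<le> ?d / 4"
  proof (cases "i \<in> {2..N}")
    case True
    hence "i \<in> {1..N}" by auto
    moreover have "cmod (u i) \<le> r" using u mem_J(5)[OF \<open>i \<in> {1..N}\<close>] by blast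
    ultimately show ?thesis using that[of i] pos_near(2)[OF u True] good il sep_pos by (auto simp: good_def)
  next
    case False
    hence c: "i \<in> {1, N + 1, N + 2}" using i by auto
    have "9 * sqrt A * exp (s / 2) \<le> 9 * sqrt A * exp (s1 / 2)" using s A by (intro mult_left_mono) auto
    moreover have "cmod (u 1) \<le> r" using u mem_J by blast
    ultimately show ?thesis using that[of 1] pos_near(1)[OF u c, of s] good N l by (auto simp: good_def)
  qed
  have "?d \<le> cmod (z j - z l)" by (rule separation_le[OF j(1) l' j(2)])
  also have "z j - z l = (pos s u i - pos s u l) - (pos s u i - z j) + (pos s u l - z l)" by simp
  also have "cmod \<dots> \<le> (cmod (pos s u i - pos s u l) + cmod (pos s u i - z j)) + cmod (pos s u l - z l)"
    by (intro norm_triangle_mono norm_triangle_ineq4) auto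
  finally show ?thesis using 1 j(3) sep_pos by simp
qed

lemma pos_inj:
  assumes s: "s \<le> s1" and u: "inbox J r u"
  shows "inj_on (pos s u) {1..N + 2}"
proof (rule inj_onI, rule ccontr)
  fix i l assume il: "i \<in> {1..N + 2}" "l \<in> {1..N + 2}" "pos s u i = pos s u l" "i \<noteq> l"
  have "l \<notin> {2..N}" using pos_far[OF s u il(1) _ il(4)] il(3) sep_pos by auto
  moreover have "i \<notin> {2..N}" using pos_far[OF s u il(2) _ il(4)[symmetric]] il(3) sep_pos by auto
  ultimately have "i \<in> {1, N + 1, N + 2}" "l \<in> {1, N + 1, N + 2}" using il by auto
  moreover have p: "pos s u 1 - pos s u (N + 1) = D s u" "2 * (pos s u 1 - pos s u (N + 2)) = S s u + D s u"
    "2 * (pos s u (N + 1) - pos s u (N + 2)) = S s u - D s u"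
    using N by (auto simp: pos_def field_simps)
  ultimately show False using il(3,4) D_nz[of s u] S_pm_D_nz[OF u, of s] N by auto
qed

lemma r_nonneg: "0 \<le> r" using good by (simp add: good_def)

lemma lip_bounded_pp: "lip_bounded J s1 r (\<lambda>s. pp)" and lip_bounded_dd: "lip_bounded J s1 r (\<lambda>s. dd)"
  unfolding pp_def[abs_def] dd_def[abs_def]
  by (intro lip_bounded_add lip_bounded_mult lip_bounded_const lip_bounded_Re lip_bounded_proj mem_J r_nonneg)+

lemma lip_bounded_f: "lip_bounded J s1 r (\<lambda>s u. f s)"
proof (rule lip_bounded_time)
  show "continuous_on {..s1} f" unfolding f_def by (intro continuous_intros)
  show "cmod (f s) \<le> sqrt A * exp (s1 / 2)" if "s \<le> s1" for s
    unfolding norm_f using that A by (intro mult_left_mono) auto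
qed

lemma lip_bounded_S: "lip_bounded J s1 r S" and lip_bounded_D: "lip_bounded J s1 r D"
  unfolding S_def[abs_def] D_def[abs_def]
  by (intro lip_bounded_mult lip_bounded_f lip_bounded_const lip_bounded_exp lip_bounded_add lip_bounded_pp lip_bounded_dd)+

lemma lip_bounded_pos: "i \<in> {1..N + 2} \<Longrightarrow> lip_bounded J s1 r (\<lambda>s u. pos s u i)"
proof -
  assume i: "i \<in> {1..N + 2}"
  have r: "r \<ge> 0" using good by (simp add: good_def)
  have c: "lip_bounded J s1 r (\<lambda>s u. z 1 + u 1 + (a * S s u + b * D s u))" for a b
    by (intro lip_bounded_add lip_bounded_const lip_bounded_proj[OF mem_J(6) r] lip_bounded_mult lip_bounded_S lip_bounded_D)
  consider "i = 1" | "i = N + 1" | "i = N + 2" | "i \<in> {2..N}" using i by force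
  thus ?thesis
  proof cases
    case 1
    have "(\<lambda>s u. pos s u i) = (\<lambda>s u. z 1 + u 1 + ((-1/6) * S s u + (1/2) * D s u))" using 1 by (simp add: pos_def fun_eq_iff)
    thus ?thesis using c by (simp only:)
  next
    case 2
    have "(\<lambda>s u. pos s u i) = (\<lambda>s u. z 1 + u 1 + ((-1/6) * S s u + (-1/2) * D s u))" using 2 N by (simp add: pos_def fun_eq_iff)
    thus ?thesis using c by (simp only:)
  next
    case 3
    have "(\<lambda>s u. pos s u i) = (\<lambda>s u. z 1 + u 1 + ((-2/3) * S s u + 0 * D s u))" using 3 N by (simp add: pos_def fun_eq_iff)
    thus ?thesis using c by (simp only:)
  next
    case 4
    have "(\<lambda>s u. pos s u i) = (\<lambda>s u. z i + u i)" using 4 by (auto simp: pos_def fun_eq_iff)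
    moreover have "lip_bounded J s1 r (\<lambda>s u. z i + u i)" using 4 r mem_J(5)[of i] by (intro lip_bounded_add lip_bounded_const lip_bounded_proj) auto
    ultimately show ?thesis by (simp only:)
  qed
qed

lemma lip_bounded_kern_pos:
  assumes "i \<in> {1..N + 2}" "l \<in> {2..N}"
  shows "lip_bounded J s1 r (\<lambda>s u. kern (pos s u i - pos s u l))"
proof (cases "i = l")
  case False
  show ?thesis
    by (rule lip_bounded_kern[OF lip_bounded_diff[OF lip_bounded_pos lip_bounded_pos], of _ _ "separation N z / 2"])
       (use assms False pos_far sep_pos in auto)
qed (simp add: lip_bounded_const)

lemma lip_bounded_ext: "i \<in> {1..N + 2} \<Longrightarrow> lip_bounded J s1 r (\<lambda>s u. ext s u i)"
  unfolding ext_def by (intro lip_bounded_sum lip_bounded_scaleR lip_bounded_kern_pos) auto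

lemma lip_bounded_cvel: "j \<in> {2..N} \<Longrightarrow> lip_bounded J s1 r (\<lambda>s u. cvel (N + 2) \<kappa> (pos s u) j)"
  unfolding cvel_def
proof (intro lip_bounded_sum lip_bounded_scaleR)
  fix l assume j: "j \<in> {2..N}" and l: "l \<in> {1..N + 2}"
  show "lip_bounded J s1 r (\<lambda>s u. kern (pos s u j - pos s u l))"
  proof (cases "j = l")
    case False
    show ?thesis
      by (rule lip_bounded_kern[OF lip_bounded_diff[OF lip_bounded_pos lip_bounded_pos], of _ _ "separation N z / 2"])
         (use j l False pos_far[OF _ _ l j] sep_pos in \<open>auto simp: norm_minus_commute\<close>)
  qed (simp add: lip_bounded_const)
qed auto

lemma lip_bounded_half: "lip_bounded J s1 r (\<lambda>s u. exp (of_real s / 2))"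
proof (rule lip_bounded_time)
  show "continuous_on {..s1} (\<lambda>s. exp (complex_of_real s / 2))" by (intro continuous_intros) auto
  show "cmod (exp (complex_of_real s / 2)) \<le> exp (s1 / 2)" if "s \<le> s1" for s using that by simp
qed

text \<open>The modulus of this function is constant in time, as |f s| = sqrt A exp (s/2).\<close>

lemma lip_bounded_ratio: "c \<noteq> 0 \<Longrightarrow> lip_bounded J s1 r (\<lambda>s u. exp (of_real s / 2) / (f s * c))"
proof (rule lip_bounded_time)
  assume c: "c \<noteq> 0"
  show "continuous_on {..s1} (\<lambda>s. exp (complex_of_real s / 2) / (f s * c))"
    using f_nz c by (auto simp: f_def intro!: continuous_intros)
  show "cmod (exp (complex_of_real s / 2) / (f s * c)) \<le> 1 / (sqrt A * cmod c)" for s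
    using A by (simp add: norm_divide norm_mult norm_f)
qed

lemma lip_bounded_GS: "lip_bounded J s1 r GS" and lip_bounded_GD: "lip_bounded J s1 r GD"
proof -
  have m: "lip_bounded J s1 r (\<lambda>s u. - F s u)" if "lip_bounded J s1 r F" for F
    using lip_bounded_mult[OF lip_bounded_const[of _ _ _ "-1"] that] by simp
  have e: "lip_bounded J s1 r (\<lambda>s u. ext s u 1)" "lip_bounded J s1 r (\<lambda>s u. ext s u (N + 1))" "lip_bounded J s1 r (\<lambda>s u. ext s u (N + 2))"
    by (intro lip_bounded_ext; simp)+
  show "lip_bounded J s1 r GS"
    unfolding GS_def[abs_def] ES_def
    by (intro lip_bounded_mult lip_bounded_ratio \<sigma> lip_bounded_exp m lip_bounded_pp lip_bounded_add lip_bounded_diff lip_bounded_const e)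
  have "lip_bounded J s1 r (\<lambda>s u. exp (of_real s / 2) / f s)" using lip_bounded_ratio[of 1] by simp
  thus "lip_bounded J s1 r GD"
    unfolding GD_def[abs_def] ED_def
    by (intro lip_bounded_mult lip_bounded_exp m lip_bounded_pp lip_bounded_dd lip_bounded_add lip_bounded_diff lip_bounded_const e)
qed

lemma lip_bounded_twist: "lip_bounded J s1 r F \<Longrightarrow> lip_bounded J s1 r (\<lambda>s u. twist (F s u))"
  by (rule lip_bounded_bounded_linear[OF _ bounded_linear_twist])

lemma lip_bounded_div: "lip_bounded J s1 r F \<Longrightarrow> lip_bounded J s1 r (\<lambda>s u. F s u / c)"
  by (rule lip_bounded_bounded_linear[OF _ bounded_linear_divide])

lemma lip_bounded_Bj: "j \<in> J \<Longrightarrow> lip_bounded J s1 r (Bj j)"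
proof -
  assume j: "j \<in> J"
  have e: "lip_bounded J s1 r (\<lambda>s u. ext s u 1)" "lip_bounded J s1 r (\<lambda>s u. ext s u (N + 1))" "lip_bounded J s1 r (\<lambda>s u. ext s u (N + 2))"
    by (intro lip_bounded_ext; simp)+
  consider "j = 1" | "j \<in> {2..N}" | "j = N + 1" | "j = N + 2" | "j = N + 3" | "j = N + 4" using j by (force simp: J_def)
  thus ?thesis
  proof cases
    case 1
    thus ?thesis unfolding Bj_def[abs_def] EC_def
      by (simp only: simp_thms if_True) (intro lip_bounded_mult lip_bounded_half lip_bounded_add lip_bounded_diff lip_bounded_const e)
  next
    case 2
    hence "Bj j = (\<lambda>s u. exp (of_real s / 2) * cvel (N + 2) \<kappa> (pos s u) j)" by (auto simp: Bj_def fun_eq_iff)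
    thus ?thesis using 2 by (simp only:) (intro lip_bounded_mult lip_bounded_half lip_bounded_cvel)
  next
    case 3
    hence "Bj j = (\<lambda>s u. of_real (Re (GS s u)))" using N by (auto simp: Bj_def fun_eq_iff)
    thus ?thesis by (simp only:) (intro lip_bounded_Re lip_bounded_GS)
  next
    case 4
    hence "Bj j = (\<lambda>s u. twist (GS s u))" using N by (auto simp: Bj_def fun_eq_iff)
    thus ?thesis by (simp only:) (intro lip_bounded_twist lip_bounded_GS)
  next
    case 5
    hence "Bj j = (\<lambda>s u. of_real (Re ((GD s u - GS s u) / of_real \<eta>)))" using N by (auto simp: Bj_def fun_eq_iff)
    thus ?thesis by (simp only:) (intro lip_bounded_Re lip_bounded_div lip_bounded_diff lip_bounded_GD lip_bounded_GS)
  next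
    case 6
    hence "Bj j = (\<lambda>s u. twist ((GD s u - GS s u) / of_real \<eta>))" using N by (auto simp: Bj_def fun_eq_iff)
    thus ?thesis by (simp only:) (intro lip_bounded_twist lip_bounded_div lip_bounded_diff lip_bounded_GD lip_bounded_GS)
  qed
qed

lemma lip_bounded_al: "lip_bounded J s1 r (\<lambda>s. al)" and lip_bounded_al': "lip_bounded J s1 r (\<lambda>s. al')"
  unfolding al_def[abs_def] al'_def[abs_def]
  by (intro lip_bounded_diff lip_bounded_exp lip_bounded_mult lip_bounded_const lip_bounded_Re lip_bounded_add lip_bounded_pp lip_bounded_dd)+

lemma lip_bounded_Ph: "lip_bounded J s1 r (\<lambda>s. Ph)"
proof -
  have y: "lip_bounded J s1 r (\<lambda>s u. 1 - yy u)"
    unfolding yy_def by (intro lip_bounded_diff lip_bounded_const lip_bounded_mult lip_bounded_exp lip_bounded_dd)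
  have "lip_bounded J s1 r (\<lambda>s u. inverse (1 - yy u))"
  proof (rule lip_bounded_inverse[OF y])
    \<comment> \<open>The lower bound comes from |1 - q| \<ge> 1 - |q| and
      \<open>norm_q\<close>.\<close>
    show "0 < (1 - exp (1/4) / 3) / cmod (1 - R0)" using exp_quarter R0 by auto
    fix u assume "inbox J r u"
    from norm_q[OF this] have "1 - exp (1/4) / 3 \<le> cmod (1 - R0 * exp (2 * dd u))"
      using norm_triangle_ineq2[of 1 "R0 * exp (2 * dd u)"] by simp
    thus "(1 - exp (1/4) / 3) / cmod (1 - R0) \<le> cmod (1 - yy u)"
      unfolding one_minus_yy norm_divide by (rule divide_right_mono) simp
  qed
  thus ?thesis by (simp add: Ph_def[abs_def] inverse_eq_divide)
qed

lemma lip_bounded_Aj: "lip_bounded J s1 r (\<lambda>s. Aj j)"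
proof -
  have 1: "lip_bounded J s1 r (\<lambda>s u. cp u + rp u)"
    unfolding cp_def rp_def
    by (intro lip_bounded_add lip_bounded_mult lip_bounded_const lip_bounded_cnj lip_bounded_diff lip_bounded_al lip_bounded_Ph lip_bounded_dd lip_bounded_Re lip_bounded_pp)
  have 2: "lip_bounded J s1 r (\<lambda>s u. rd u)"
    unfolding rd_def
    by (intro lip_bounded_add lip_bounded_mult lip_bounded_const lip_bounded_cnj lip_bounded_diff lip_bounded_al lip_bounded_al' lip_bounded_Ph lip_bounded_dd lip_bounded_Re lip_bounded_pp)
  have if_lip_bounded: "lip_bounded J s1 r (\<lambda>s u. if b then F s u else G s u)" if "lip_bounded J s1 r F" "lip_bounded J s1 r G" for b F G
    using that by (cases b) simp_all
  show ?thesis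
    unfolding Aj_def[abs_def]
    by (intro if_lip_bounded lip_bounded_const lip_bounded_Re[OF 1] lip_bounded_twist[OF 1] lip_bounded_div[OF lip_bounded_Re[OF 2]] lip_bounded_div[OF lip_bounded_twist[OF 2]])
qed

end

lemma good_exists:
  assumes "r0 > 0"
  obtains r s1 where "good r s1" "r \<le> r0"
proof
  let ?d = "separation N z"
  have "8 * c0 > 0" using c0 by simp
  define r where "r = min r0 (min (1 / (8 * c0)) (?d / 8))"
  have r: "r > 0" "r \<le> 1 / (8 * c0)" "r \<le> ?d / 8" using assms sep_pos c0 by (auto simp: r_def)
  have "c0 * r \<le> 1 / 8" using r(2) c0 by (simp add: field_simps)
  \<comment> \<open>72 = 9 * 8: this s1 gives equality.\<close>
  moreover have "9 * sqrt A * exp ((2 * ln (?d / (72 * sqrt A))) / 2) \<le> ?d / 8"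
    using A sep_pos by simp
  ultimately show "good r (2 * ln (?d / (72 * sqrt A)))" using r unfolding good_def by blast
  show "r \<le> r0" by (simp add: r_def)
qed

text \<open>Separates the velocity induced by the triple, which is treated exactly, from the one
  induced by the remaining vortices, which perturbs the triple.\<close>

lemma cvel_split:
  "cvel (N + 2) \<kappa> x i = 2 * k * kern (x i - x 1) + (\<Sum>l=2..N. \<xi> l *\<^sub>R kern (x i - x l))
     + 2 * k * kern (x i - x (N + 1)) - k * kern (x i - x (N + 2))"
proof -
  let ?h = "\<lambda>l. \<kappa> l *\<^sub>R kern (x i - x l)"
  have "(\<Sum>l=1..N + 2. ?h l) = ?h 1 + (\<Sum>l=2..N + 2. ?h l)"
    by (subst sum.atLeast_Suc_atMost) (auto simp: numeral_2_eq_2)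
  also have "{2..N + 2} = {2..N} \<union> {N + 1, N + 2}" using N by auto
  also have "(\<Sum>l\<in>{2..N} \<union> {N + 1, N + 2}. ?h l) = (\<Sum>l=2..N. ?h l) + (?h (N + 1) + ?h (N + 2))"
    by (subst sum.union_disjoint) auto
  also have "(\<Sum>l=2..N. ?h l) = (\<Sum>l=2..N. \<xi> l *\<^sub>R kern (x i - x l))"
    by (intro sum.cong) (auto simp: \<kappa>_def)
  finally show ?thesis using N by (simp add: cvel_def \<kappa>_def scaleR_conv_of_real)
qed

section \<open>The burst as a true motion\<close>

lemma burst:
  obtains T x where "T > 0"
    "\<And>t. t \<in> {0<..<T} \<Longrightarrow> inj_on (x t) {1..N + 2}"
    "\<And>t j. t \<in> {0<..<T} \<Longrightarrow> j \<in> {1..N + 2} \<Longrightarrow> ((\<lambda>s. x s j) has_vector_derivative cvel (N + 2) \<kappa> (x t) j) (at t)"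
    "\<And>j. j \<in> {1..N + 2} \<Longrightarrow> ((\<lambda>t. x t j) \<longlongrightarrow> (if j \<le> N then z j else z 1)) (at_right 0)"
proof -
  obtain r0 where r0: "r0 > 0" "\<And>j u v \<delta>. \<delta> \<ge> 0 \<Longrightarrow> inbox J r0 u \<Longrightarrow> inbox J r0 v \<Longrightarrow>
    close J \<delta> u v \<Longrightarrow> cmod (Aj j u - Aj j v) \<le> 1/8 * \<delta>"
    using Aj_lipschitz by blast
  obtain r s1 where good: "good r s1" and rr0: "r \<le> r0" using good_exists[OF r0(1)] by blast
  \<comment> \<open>Since Re (2 \<gamma>) = 1, the coordinates along 2 \<gamma> are Re pp and, up to
    the factor \<eta>, Re dd. They have the eigenvalue -1, all other unknowns 0.\<close>
  define lam :: "nat \<Rightarrow> real" where "lam j = (if j = N + 1 \<or> j = N + 3 then -1 else 0)" for j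
  have "\<exists>s0\<le>s1. \<exists>R u. \<forall>j\<in>J. \<forall>s\<le>s0. cmod (u j s) \<le> R * exp (s / 2) \<and> cmod (u j s) \<le> r \<and>
    (u j has_vector_derivative lam j *\<^sub>R u j s + (Aj j (\<lambda>i. u i s) + exp (s / 2) *\<^sub>R Bj j s (\<lambda>i. u i s))) (at s)"
  proof (rule perturbed_linear_ode[OF finite_J])
    show "r > 0" using good by (simp add: good_def)
    fix j and u v :: "nat \<Rightarrow> complex" and \<delta> :: real
    assume *: "\<delta> \<ge> 0" "inbox J r u" "inbox J r v" "close J \<delta> u v"
    have "inbox J r0 u" "inbox J r0 v" using * rr0 by (meson order_trans)+
    thus "cmod (Aj j u - Aj j v) \<le> 1/8 * \<delta>" using r0(2) * by blast
  qed (auto simp: lam_def Aj_0 intro: lip_bounded_Bj[OF good] lip_bounded_Aj[OF good])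
  then obtain s0 R u where s0: "s0 \<le> s1"
    and uR: "\<And>j s. j \<in> J \<Longrightarrow> s \<le> s0 \<Longrightarrow> cmod (u j s) \<le> R * exp (s / 2)"
    and ur: "\<And>j s. j \<in> J \<Longrightarrow> s \<le> s0 \<Longrightarrow> cmod (u j s) \<le> r"
    and du: "\<And>j s. j \<in> J \<Longrightarrow> s \<le> s0 \<Longrightarrow>
      (u j has_vector_derivative lam j *\<^sub>R u j s + (Aj j (\<lambda>i. u i s) + exp (s / 2) *\<^sub>R Bj j s (\<lambda>i. u i s))) (at s)"
    by blast
  define U where "U s = (\<lambda>i. u i s)" for s
  have Ur: "inbox J r (U s)" if "s \<le> s0" for s using ur that by (simp add: U_def)
  have half: "exp (complex_of_real s / 2) = of_real (exp (s / 2))" for s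
    by (simp add: exp_of_real[symmetric])
  have hh: "complex_of_real (exp (s / 2)) * complex_of_real (exp (s / 2)) = of_real (exp s)" for s
    by (simp flip: of_real_mult exp_add)

  have twist_sum: "twist (a + b) = twist a + twist b" "twist (c *\<^sub>R a) = of_real c * twist a" "twist (a / of_real c) = twist a / of_real c"
    "of_real (Re (twist a)) = twist a" for a b c
    by (auto simp: twist_def algebra_simps Re_divide_of_real Im_divide_of_real add_divide_distrib diff_divide_distrib)
  have Re_pp: "Re (u (N + 1) s) = Re (pp (U s))" for s
    unfolding pp_def two_\<gamma> by (simp add: U_def)
  have Re_dd: "\<eta> * Re (u (N + 3) s) = Re (dd (U s))" for s
    unfolding dd_def two_\<gamma> by (simp add: U_def)

  have dRe: "((\<lambda>s. complex_of_real (Re (u j s))) has_vector_derivative of_real (Re y)) (at s)"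
    if "(u j has_vector_derivative y) (at s)" for j s y
    by (rule bounded_linear.has_vector_derivative[OF bounded_linear_compose[OF bounded_linear_of_real bounded_linear_Re] that])

  \<comment> \<open>The real unknowns N + 1 and N + 2 recombine: \<open>twist_inverse\<close>
    restores the complex right-hand side.\<close>
  have dpp: "((\<lambda>s. pp (U s)) has_vector_derivative
      \<gamma> * ((al (U s) + 1) * cnj (Ph (U s)) - 1) + exp (s / 2) *\<^sub>R GS s (U s)) (at s)" if s: "s \<le> s0" for s
  proof -
    define P where "P = cp (U s) + rp (U s) + exp (s / 2) *\<^sub>R GS s (U s)"
    have "((\<lambda>s. complex_of_real (Re (u (N + 1) s))) has_vector_derivative of_real (- Re (pp (U s)) + Re P)) (at s)"
      using dRe[OF du[OF mem_J(1) s]] N Re_pp[of s] by (simp add: lam_def Aj_def Bj_def P_def U_def[symmetric])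
    moreover have "((\<lambda>s. complex_of_real (Re (u (N + 2) s))) has_vector_derivative twist P) (at s)"
      using dRe[OF du[OF mem_J(2) s]] N by (simp add: lam_def Aj_def Bj_def P_def U_def[symmetric] twist_sum)
    ultimately have "((\<lambda>s. 2 * \<gamma> * of_real (Re (u (N + 1) s)) + \<i> * of_real (Re (u (N + 2) s))) has_vector_derivative
        2 * \<gamma> * of_real (- Re (pp (U s)) + Re P) + \<i> * twist P) (at s)"
      by (intro has_vector_derivative_add has_vector_derivative_mult_right)
    moreover have "2 * \<gamma> * of_real (- Re (pp (U s)) + Re P) + \<i> * twist P = - 2 * \<gamma> * of_real (Re (pp (U s))) + P"
      using twist_inverse[of P] by (simp add: algebra_simps)
    moreover have "- 2 * \<gamma> * of_real (Re (pp (U s))) + P = \<gamma> * ((al (U s) + 1) * cnj (Ph (U s)) - 1) + exp (s / 2) *\<^sub>R GS s (U s)"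
      unfolding rp_eq P_def by (simp only: add.assoc)
    ultimately show ?thesis by (simp only: pp_def U_def)
  qed

  have ddd: "((\<lambda>s. dd (U s)) has_vector_derivative
      \<gamma> * (cnj (Ph (U s)) * (al' (U s) - al (U s))) + exp (s / 2) *\<^sub>R (GD s (U s) - GS s (U s))) (at s)" if s: "s \<le> s0" for s
  proof -
    define Q where "Q = (rd (U s) + exp (s / 2) *\<^sub>R (GD s (U s) - GS s (U s))) / of_real \<eta>"
    have eQ: "of_real \<eta> * Q = rd (U s) + exp (s / 2) *\<^sub>R (GD s (U s) - GS s (U s))" using \<eta>(1) by (simp add: Q_def)
    have "((\<lambda>s. complex_of_real (Re (u (N + 3) s))) has_vector_derivative of_real (- Re (u (N + 3) s) + Re Q)) (at s)"
      using dRe[OF du[OF mem_J(3) s]] N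
      by (simp add: lam_def Aj_def Bj_def Q_def U_def[symmetric] Re_divide_of_real add_divide_distrib diff_divide_distrib algebra_simps)
    moreover have "((\<lambda>s. complex_of_real (Re (u (N + 4) s))) has_vector_derivative twist Q) (at s)"
    proof -
      define a b where "a = rd (U s)" and "b = GD s (U s) - GS s (U s)"
      have "of_real (Re (twist a / of_real \<eta> + exp (s / 2) *\<^sub>R twist (b / of_real \<eta>))) = twist ((a + exp (s / 2) *\<^sub>R b) / of_real \<eta>)"
        using \<eta>(1) by (simp add: twist_def Re_divide_of_real Im_divide_of_real) (simp add: field_simps)
      thus ?thesis
        using dRe[OF du[OF mem_J(4) s]] N by (simp add: lam_def Aj_def Bj_def U_def[symmetric] Q_def a_def b_def)
    qed
    ultimately have "((\<lambda>s. of_real \<eta> * (2 * \<gamma> * of_real (Re (u (N + 3) s)) + \<i> * of_real (Re (u (N + 4) s)))) has_vector_derivative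
        of_real \<eta> * (2 * \<gamma> * of_real (- Re (u (N + 3) s) + Re Q) + \<i> * twist Q)) (at s)"
      by (intro has_vector_derivative_add has_vector_derivative_mult_right)
    moreover have "of_real \<eta> * (2 * \<gamma> * of_real (- Re (u (N + 3) s) + Re Q) + \<i> * twist Q)
        = - 2 * \<gamma> * of_real (\<eta> * Re (u (N + 3) s)) + of_real \<eta> * Q"
    proof -
      have "2 * \<gamma> * of_real (- Re (u (N + 3) s) + Re Q) + \<i> * twist Q = - 2 * \<gamma> * of_real (Re (u (N + 3) s)) + Q"
        using twist_inverse[of Q] by (simp add: algebra_simps)
      thus ?thesis by (simp add: algebra_simps)
    qed
    moreover have "- 2 * \<gamma> * of_real (\<eta> * Re (u (N + 3) s)) + of_real \<eta> * Q
        = \<gamma> * (cnj (Ph (U s)) * (al' (U s) - al (U s))) + exp (s / 2) *\<^sub>R (GD s (U s) - GS s (U s))"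
      unfolding rd_eq eQ Re_dd by (simp only: add.assoc)
    ultimately show ?thesis by (simp only: dd_def U_def)
  qed

  have df: "(f has_vector_derivative \<gamma> * f s) (at s)" for s
  proof -
    have "((\<lambda>s. \<gamma> * complex_of_real s) has_vector_derivative \<gamma> * of_real 1) (at s)"
      by (intro has_vector_derivative_mult_right bounded_linear.has_vector_derivative[OF bounded_linear_of_real]
          has_vector_derivative_id)
    from field_vector_diff_chain_at[OF this DERIV_exp]
    have "((\<lambda>s. exp (\<gamma> * complex_of_real s)) has_vector_derivative \<gamma> * exp (\<gamma> * of_real s)) (at s)" by (simp add: o_def mult.commute)
    from has_vector_derivative_mult_right[OF this, of "of_real (sqrt A)"]
    show ?thesis by (simp add: f_def[abs_def] mult_ac)
  qed
  have dfexp: "((\<lambda>s. f s * c * exp (h s)) has_vector_derivative f s * c * exp (h s) * (\<gamma> + h')) (at s)"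
    if h: "(h has_vector_derivative h') (at s)" for c h h' s
  proof -
    have "((\<lambda>s. exp (h s)) has_vector_derivative h' * exp (h s)) (at s)"
      using field_vector_diff_chain_at[OF h DERIV_exp] by (simp add: o_def)
    from has_vector_derivative_mult[OF has_vector_derivative_mult_left[OF df] this]
    have "((\<lambda>s. f s * c * exp (h s)) has_vector_derivative f s * c * (h' * exp (h s)) + \<gamma> * f s * c * exp (h s)) (at s)" .
    thus ?thesis by (simp add: algebra_simps)
  qed

  define S' where "S' s = S s (U s)" for s
  define D' where "D' s = D s (U s)" for s
  \<comment> \<open>\<open>VS\<close> and \<open>VD\<close> are the rates of S and D in physical
    time due to the triple alone.\<close>
  define VS where "VS s = 12 * k * kern (((S' s)\<^sup>2 - (D' s)\<^sup>2) / S' s)" for s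
  define VD where "VD s = 4 * k * kern (D' s * ((S' s)\<^sup>2 - (D' s)\<^sup>2) / (S' s)\<^sup>2)" for s
  have al_eq: "al v + 1 = of_real (1 / exp (2 * Re (pp v)))" "al' v + 1 = of_real (1 / exp (2 * Re (pp v + dd v)))" for v
  proof -
    have "exp (- 2 * complex_of_real y) = of_real (1 / exp (2 * y))" for y
      using exp_of_real[of "- (2 * y)", where 'a = complex] by (simp add: exp_minus inverse_eq_divide)
    thus "al v + 1 = of_real (1 / exp (2 * Re (pp v)))" "al' v + 1 = of_real (1 / exp (2 * Re (pp v + dd v)))"
      unfolding al_def al'_def by (simp_all only: diff_add_cancel)
  qed
  \<comment> \<open>Here the logarithmic equations for \<open>pp\<close> and \<open>dd\<close>
    become the exact equations of the isolated triple.\<close>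
  have ss: "S' s * (\<gamma> * ((al (U s) + 1) * cnj (Ph (U s)))) = of_real (exp s) * VS s"
       "D' s * (\<gamma> * ((al' (U s) + 1) * cnj (Ph (U s)))) = of_real (exp s) * VD s" if s: "s \<le> s0" for s
    unfolding al_eq Ph_eq S'_def D'_def VS_def VD_def
    by (rule triple_self_similar[OF S_nz S_cnj D_nz D_cnj D_S q_ne_1[OF good Ur[OF s]] A _ _ _ \<gamma>_R0]; simp)+
  have rearrange: "p * (h * (h / q * inverse w * e)) = p / (q * w) * (h * h) * e" for p h q w e :: complex
    by (simp only: divide_inverse inverse_mult_distrib mult_ac)
  have dS: "(S' has_vector_derivative of_real (exp s) * (VS s + ES s (U s))) (at s)" if s: "s \<le> s0" for s
  proof -
    have "((\<lambda>s. S s (U s)) has_vector_derivative S' s * (\<gamma> + (\<gamma> * ((al (U s) + 1) * cnj (Ph (U s)) - 1) + exp (s / 2) *\<^sub>R GS s (U s)))) (at s)"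
      unfolding S_def S'_def by (rule dfexp[OF dpp[OF s]])
    moreover have "S' s * (exp (s / 2) *\<^sub>R GS s (U s)) = of_real (exp s) * ES s (U s)"
    proof -
      have "S' s * (exp (s / 2) *\<^sub>R GS s (U s)) = (S' s / (f s * \<sigma> * exp (pp (U s)))) * (of_real (exp (s / 2)) * of_real (exp (s / 2))) * ES s (U s)"
        unfolding GS_def half scaleR_conv_of_real exp_minus by (rule rearrange)
      thus ?thesis unfolding hh using f_nz[of s] \<sigma>(3) by (simp add: S'_def S_def)
    qed
    ultimately show ?thesis
      using ss(1)[OF s] by (simp add: S'_def[abs_def] algebra_simps)
  qed
  have dD: "(D' has_vector_derivative of_real (exp s) * (VD s + ED s (U s))) (at s)" if s: "s \<le> s0" for s
  proof -
    have "((\<lambda>s. D s (U s)) has_vector_derivative D' s * (\<gamma> +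
        ((\<gamma> * ((al (U s) + 1) * cnj (Ph (U s)) - 1) + exp (s / 2) *\<^sub>R GS s (U s)) +
         (\<gamma> * (cnj (Ph (U s)) * (al' (U s) - al (U s))) + exp (s / 2) *\<^sub>R (GD s (U s) - GS s (U s)))))) (at s)"
      using dfexp[OF has_vector_derivative_add[OF dpp[OF s] ddd[OF s]], of 1] by (simp add: D_def D'_def)
    moreover have "\<gamma> + ((\<gamma> * ((al (U s) + 1) * cnj (Ph (U s)) - 1) + exp (s / 2) *\<^sub>R GS s (U s)) +
         (\<gamma> * (cnj (Ph (U s)) * (al' (U s) - al (U s))) + exp (s / 2) *\<^sub>R (GD s (U s) - GS s (U s))))
       = \<gamma> * ((al' (U s) + 1) * cnj (Ph (U s))) + exp (s / 2) *\<^sub>R GD s (U s)"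
      by (simp add: algebra_simps scaleR_diff_right)
    moreover have "D' s * (exp (s / 2) *\<^sub>R GD s (U s)) = of_real (exp s) * ED s (U s)"
    proof -
      have "D' s * (exp (s / 2) *\<^sub>R GD s (U s)) = (D' s / (f s * exp (pp (U s) + dd (U s)))) * (of_real (exp (s / 2)) * of_real (exp (s / 2))) * ED s (U s)"
        unfolding GD_def half scaleR_conv_of_real exp_minus[of "pp (U s) + dd (U s)"] by (rule rearrange)
      thus ?thesis unfolding hh using f_nz[of s] by (simp add: D'_def D_def)
    qed
    ultimately show ?thesis
      using ss(2)[OF s] by (simp add: D'_def[abs_def] distrib_left)
  qed

  have dpos: "((\<lambda>s. pos s (U s) i) has_vector_derivative exp s *\<^sub>R cvel (N + 2) \<kappa> (pos s (U s)) i) (at s)"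
    if s: "s \<le> s0" and i: "i \<in> {1..N + 2}" for s i
  proof -
    have nz: "S' s \<noteq> 0" "D' s \<noteq> 0" "S' s + D' s \<noteq> 0" "S' s - D' s \<noteq> 0"
      using S_nz D_nz S_pm_D_nz[OF good Ur[OF s]] by (auto simp: S'_def D'_def)
    have dC: "((\<lambda>s. U s 1) has_vector_derivative of_real (exp s) * EC s (U s)) (at s)"
    proof -
      have "(\<lambda>s. U s 1) = u 1" by (simp add: U_def)
      thus ?thesis using du[OF mem_J(6) s] N
        by (simp only:) (simp add: U_def[symmetric] lam_def Aj_def Bj_def half scaleR_conv_of_real hh flip: mult.assoc)
    qed
    \<comment> \<open>All three vortices of the triple have the form centre + a S + b D.\<close>
    have comb: "((\<lambda>s. z 1 + U s 1 + (a * S' s + b * D' s)) has_vector_derivative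
        of_real (exp s) * EC s (U s) + (a * (of_real (exp s) * (VS s + ES s (U s))) + b * (of_real (exp s) * (VD s + ED s (U s))))) (at s)" for a b
    proof -
      have "((\<lambda>s. z 1 + U s 1 + (a * S' s + b * D' s)) has_vector_derivative
        (0 + of_real (exp s) * EC s (U s)) + (a * (of_real (exp s) * (VS s + ES s (U s))) + b * (of_real (exp s) * (VD s + ED s (U s))))) (at s)"
        by (intro has_vector_derivative_add has_vector_derivative_const dC has_vector_derivative_mult_right dS dD s)
      thus ?thesis by simp
    qed
    have diffs: "pos s (U s) 1 - pos s (U s) (N + 1) = D' s" "pos s (U s) 1 - pos s (U s) (N + 2) = (S' s + D' s) / 2"
      "pos s (U s) (N + 1) - pos s (U s) (N + 2) = (S' s - D' s) / 2"
      using N by (auto simp: pos_def S'_def D'_def field_simps)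
    have diffs': "pos s (U s) (N + 1) - pos s (U s) 1 = - D' s" "pos s (U s) (N + 2) - pos s (U s) 1 = - ((S' s + D' s) / 2)"
      "pos s (U s) (N + 2) - pos s (U s) (N + 1) = - ((S' s - D' s) / 2)"
      using arg_cong[OF diffs(1), of uminus] arg_cong[OF diffs(2), of uminus] arg_cong[OF diffs(3), of uminus]
      by (simp_all only: minus_diff_eq)
    note ext = ES_def ED_def EC_def
    consider "i = 1" | "i = N + 1" | "i = N + 2" | "i \<in> {2..N}" using i by force
    thus ?thesis
    proof cases
      case 1
      have p: "(\<lambda>s. pos s (U s) i) = (\<lambda>s. z 1 + U s 1 + ((-1/6) * S' s + (1/2) * D' s))"
        using 1 by (simp add: pos_def S'_def D'_def fun_eq_iff)
      have cv: "cvel (N + 2) \<kappa> (pos s (U s)) i = (- VS s / 6 + VD s / 2) + ext s (U s) 1"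
        unfolding 1 cvel_split diffs VS_def VD_def triple_velocity_1[OF nz] ext_def by simp
      \<comment> \<open>EC - ES/6 + ED/2 is the external velocity at vortex 1: the coefficients at
        the three vortices add up to 1, 0, 0. The other two vortices work in the same way.\<close>
      have "exp s *\<^sub>R cvel (N + 2) \<kappa> (pos s (U s)) i = of_real (exp s) * EC s (U s) +
          ((-1/6) * (of_real (exp s) * (VS s + ES s (U s))) + (1/2) * (of_real (exp s) * (VD s + ED s (U s))))"
        unfolding cv ext scaleR_conv_of_real by (simp add: field_simps)
      thus ?thesis unfolding p using comb[of "-1/6" "1/2"] by (simp only:)
    next
      case 2
      have p: "(\<lambda>s. pos s (U s) i) = (\<lambda>s. z 1 + U s 1 + ((-1/6) * S' s + (-1/2) * D' s))"
        using 2 N by (simp add: pos_def S'_def D'_def fun_eq_iff)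
      have cv: "cvel (N + 2) \<kappa> (pos s (U s)) i = (- VS s / 6 - VD s / 2) + ext s (U s) (N + 1)"
        unfolding 2 cvel_split diffs diffs' VS_def VD_def triple_velocity_2[OF nz] ext_def by simp
      have "exp s *\<^sub>R cvel (N + 2) \<kappa> (pos s (U s)) i = of_real (exp s) * EC s (U s) +
          ((-1/6) * (of_real (exp s) * (VS s + ES s (U s))) + (-1/2) * (of_real (exp s) * (VD s + ED s (U s))))"
        unfolding cv ext scaleR_conv_of_real by (simp add: field_simps)
      thus ?thesis unfolding p using comb[of "-1/6" "-1/2"] by (simp only:)
    next
      case 3
      have p: "(\<lambda>s. pos s (U s) i) = (\<lambda>s. z 1 + U s 1 + ((-2/3) * S' s + 0 * D' s))"
        using 3 N by (simp add: pos_def S'_def D'_def fun_eq_iff)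
      have cv: "cvel (N + 2) \<kappa> (pos s (U s)) i = - (2 * VS s / 3) + ext s (U s) (N + 2)"
        unfolding 3 cvel_split diffs' VS_def triple_velocity_3[OF nz] ext_def by simp
      have "exp s *\<^sub>R cvel (N + 2) \<kappa> (pos s (U s)) i = of_real (exp s) * EC s (U s) +
          ((-2/3) * (of_real (exp s) * (VS s + ES s (U s))) + 0 * (of_real (exp s) * (VD s + ED s (U s))))"
        unfolding cv ext scaleR_conv_of_real by (simp add: field_simps)
      thus ?thesis unfolding p using comb[of "-2/3" 0] by (simp only:)
    next
      case 4
      hence iJ: "i \<in> J" "i \<noteq> 1" "i \<le> N" using mem_J(5)[of i] by auto
      have p: "(\<lambda>s. pos s (U s) i) = (\<lambda>s. z i + u i s)" using 4 by (auto simp: pos_def U_def fun_eq_iff)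
      have "(u i has_vector_derivative exp s *\<^sub>R cvel (N + 2) \<kappa> (pos s (U s)) i) (at s)"
        using du[OF iJ(1) s] iJ by (simp add: U_def[symmetric] lam_def Aj_def Bj_def half scaleR_conv_of_real hh flip: mult.assoc)
      from has_vector_derivative_add[OF has_vector_derivative_const this, of "z i"]
      show ?thesis unfolding p by simp
    qed
  qed

  \<comment> \<open>Back to physical time t = exp s.\<close>
  define x where "x t = pos (ln t) (U (ln t))" for t
  show ?thesis
  proof (rule that[of "exp s0" x])
    fix t assume t: "t \<in> {0<..<exp s0}"
    hence lt: "ln t \<le> s0" using ln_less_cancel_iff[of t "exp s0"] by simp
    show "inj_on (x t) {1..N + 2}"
      unfolding x_def using lt s0 by (intro pos_inj[OF good] Ur) auto
    fix j assume j: "j \<in> {1..N + 2}"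
    have "(ln has_vector_derivative 1 / t) (at t)"
      using t by (auto simp: has_real_derivative_iff_has_vector_derivative[symmetric] intro!: derivative_eq_intros)
    from vector_diff_chain_at[OF this dpos[OF lt j]]
    show "((\<lambda>s. x s j) has_vector_derivative cvel (N + 2) \<kappa> (x t) j) (at t)"
      using t by (simp add: o_def x_def)
  next
    fix j assume j: "j \<in> {1..N + 2}"
    let ?l = "if j \<le> N then z j else z 1"
    define C where "C = R + 9 * sqrt A"
    have b: "cmod (pos s (U s) j - ?l) \<le> C * exp (s / 2)" if s: "s \<le> s0" for s
    proof (cases "j \<in> {2..N}")
      case True
      hence "cmod (u j s) \<le> R * exp (s / 2)" using uR[OF mem_J(5) s, of j] by auto
      also have "\<dots> \<le> C * exp (s / 2)" using A by (intro mult_right_mono) (auto simp: C_def)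
      finally show ?thesis using True pos_near(2)[OF good Ur[OF s] True] by (auto simp: U_def)
    next
      case False
      hence c: "j \<in> {1, N + 1, N + 2}" using j by auto
      hence l: "?l = z 1" by auto
      have "cmod (pos s (U s) j - z 1) \<le> cmod (U s 1) + 9 * sqrt A * exp (s / 2)"
        by (rule pos_near(1)[OF good Ur[OF s] c])
      also have "\<dots> \<le> R * exp (s / 2) + 9 * sqrt A * exp (s / 2)"
        using uR[OF mem_J(6) s] by (simp add: U_def)
      finally show ?thesis unfolding l by (simp add: C_def algebra_simps)
    qed
    have "((\<lambda>t. x t j - ?l) \<longlongrightarrow> 0) (at_right 0)"
    proof (rule Lim_null_comparison)
      show "\<forall>\<^sub>F t in at_right 0. norm (x t j - ?l) \<le> C * sqrt t"
        unfolding eventually_at_right_field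
      proof (intro exI[of _ "exp s0"] conjI allI impI)
        fix t :: real assume t: "0 < t" "t < exp s0"
        have "ln t \<le> s0" using t ln_less_cancel_iff[of t "exp s0"] by simp
        moreover have "exp (ln t / 2) = sqrt t" using t(1) by (simp add: powr_half_sqrt[symmetric] powr_def)
        ultimately show "norm (x t j - ?l) \<le> C * sqrt t" using b[of "ln t"] by (simp add: x_def)
      qed simp
      have "((\<lambda>t. C * sqrt t) \<longlongrightarrow> C * sqrt 0) (at_right 0)" by (intro tendsto_intros)
      thus "((\<lambda>t. C * sqrt t) \<longlongrightarrow> 0) (at_right 0)" by simp
    qed
    thus "((\<lambda>t. x t j) \<longlongrightarrow> ?l) (at_right 0)" by (simp only: LIM_zero_iff)
  qed simp
qed

end


section \<open>Non-uniqueness\<close>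

text \<open>Distinct positions and nonzero intensities make the positions exactly the atoms. So the
  number of vortices is a property of the measure, and can distinguish solutions.\<close>

lemma card_atoms:
  assumes "\<gamma> \<in> configs_N n"
  shows "card {p. \<gamma> {p} \<noteq> 0} = n"
proof -
  obtain \<xi> z where \<gamma>: "\<gamma> = vortex_config n \<xi> z" and \<xi>: "\<forall>j\<in>{1..n}. \<xi> j \<noteq> 0" and z: "inj_on z {1..n}"
    using assms by (auto simp: configs_N_def)
  have "{p. \<gamma> {p} \<noteq> 0} = z ` {1..n}"
  proof (intro equalityI subsetI)
    fix p assume "p \<in> {p. \<gamma> {p} \<noteq> 0}"
    hence "(\<Sum>j | j \<in> {1..n} \<and> z j = p. \<xi> j) \<noteq> 0" by (simp add: \<gamma> vortex_config_singleton)
    then obtain j where "j \<in> {1..n}" "z j = p" by (metis (mono_tags, lifting) mem_Collect_eq sum.neutral)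
    thus "p \<in> z ` {1..n}" by blast
  next
    fix p assume "p \<in> z ` {1..n}"
    then obtain j where j: "j \<in> {1..n}" "p = z j" by blast
    have "{i. i \<in> {1..n} \<and> z i = z j} = {j}" using inj_onD[OF z] j by blast
    thus "p \<in> {p. \<gamma> {p} \<noteq> 0}" using \<xi> j by (simp add: \<gamma> vortex_config_singleton)
  qed
  thus ?thesis using card_image[OF z] by simp
qed

text \<open>Provides the common motion into which the bursts are inserted.\<close>

lemma regular_segment:
  assumes "\<gamma> \<in> configs_N N"
  obtains T \<omega> where "T > 0" "weak_solution {0..T} \<omega>" "\<omega> 0 = \<gamma>" "\<And>t. t \<in> {0..T} \<Longrightarrow> \<omega> t \<in> configs_N N"
proof -
  obtain \<xi> z0 where \<gamma>: "\<gamma> = vortex_config N \<xi> z0" and \<xi>: "\<forall>j\<in>{1..N}. \<xi> j \<noteq> 0" and z0: "inj_on z0 {1..N}"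
    using assms by (auto simp: configs_N_def)
  obtain I x where I: "I = {0<..} \<or> (\<exists>T>0. I = {0<..<T} \<and> collides N T x)"
    and inj: "\<And>t. t \<in> I \<Longrightarrow> inj_on (x t) {1..N}"
    and dx: "\<And>t j. t \<in> I \<Longrightarrow> j \<in> {1..N} \<Longrightarrow> ((\<lambda>s. x s j) has_vector_derivative velocity N \<xi> (x t) j) (at t)"
    and lim: "\<And>j. j \<in> {1..N} \<Longrightarrow> ((\<lambda>t. x t j) \<longlongrightarrow> z0 j) (at_right 0)"
    using collision_or_global[OF z0, where \<xi> = \<xi>] by blast
  obtain T' where T': "T' > 0" "\<And>t. t \<in> {0<..<T'} \<Longrightarrow> t \<in> I" using I by (metis greaterThanLessThan_iff greaterThan_iff zero_less_one)
  let ?\<omega> = "\<lambda>t. if t \<le> 0 then \<gamma> else vortex_config N \<xi> (x t)"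
  show ?thesis
  proof (rule that[of "T' / 2" ?\<omega>])
    show "weak_solution {0..T' / 2} ?\<omega>"
      by (rule weak_solution_initial_segment[where T' = T' and y = z0])
         (use T' \<xi> inj dx lim \<gamma> vortex_config_in_configs[OF \<xi> z0] pairing_vortex_config[OF z0] in auto)
    show "?\<omega> t \<in> configs_N N" if "t \<in> {0..T' / 2}" for t
      using that T' assms vortex_config_in_configs_N[OF \<xi> inj, of t] by auto
  qed (use T' in auto)
qed

lemma burst_segment:
  assumes "\<gamma> \<in> configs_N N" "N \<ge> 1"
  obtains T \<omega> where "T > 0" "weak_solution {0..T} \<omega>" "\<omega> 0 = \<gamma>" "\<And>t. t \<in> {0<..T} \<Longrightarrow> \<omega> t \<in> configs_N (N + 2)"
proof -
  obtain \<xi> z0 where \<gamma>: "\<gamma> = vortex_config N \<xi> z0" and \<xi>: "\<forall>j\<in>{1..N}. \<xi> j \<noteq> 0" and z0: "inj_on z0 {1..N}"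
    using assms by (auto simp: configs_N_def)
  interpret vortex_burst N \<xi> "\<lambda>j. complex_of_plane (z0 j)"
  proof
    show "inj_on (\<lambda>j. complex_of_plane (z0 j)) {1..N}"
      by (rule inj_onI, rule inj_onD[OF z0]) (metis plane_of_complex_of_plane)+
  qed (use assms \<xi> in auto)
  obtain T' x where T': "T' > 0"
    and inj: "\<And>t. t \<in> {0<..<T'} \<Longrightarrow> inj_on (x t) {1..N + 2}"
    and dx: "\<And>t j. t \<in> {0<..<T'} \<Longrightarrow> j \<in> {1..N + 2} \<Longrightarrow> ((\<lambda>s. x s j) has_vector_derivative cvel (N + 2) \<kappa> (x t) j) (at t)"
    and lim: "\<And>j. j \<in> {1..N + 2} \<Longrightarrow> ((\<lambda>t. x t j) \<longlongrightarrow> (if j \<le> N then complex_of_plane (z0 j) else complex_of_plane (z0 1))) (at_right 0)"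
    using burst by blast
  define X where "X t j = plane_of (x t j)" for t j
  define y where "y j = (if j \<le> N then z0 j else z0 1)" for j
  have injX: "inj_on (X t) {1..N + 2}" if "t \<in> {0<..<T'}" for t
    unfolding X_def by (rule inj_onI, rule inj_onD[OF inj[OF that]]) auto
  have dX: "((\<lambda>s. X s j) has_vector_derivative velocity (N + 2) \<kappa> (X t) j) (at t)" if "t \<in> {0<..<T'}" "j \<in> {1..N + 2}" for t j
    using bounded_linear.has_vector_derivative[OF bounded_linear_plane_of dx[OF that]]
    unfolding X_def[abs_def] velocity_plane_of .
  have limX: "((\<lambda>t. X t j) \<longlongrightarrow> y j) (at_right 0)" if "j \<in> {1..N + 2}" for j
    using bounded_linear.tendsto[OF bounded_linear_plane_of lim[OF that]] by (auto simp: X_def y_def)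
  have \<kappa>0: "\<forall>j\<in>{1..N + 2}. \<kappa> j \<noteq> 0"
  proof
    fix j assume "j \<in> {1..N + 2}"
    hence "j = 1 \<or> j = N + 1 \<or> j = N + 2 \<or> j \<in> {1..N}" by auto
    thus "\<kappa> j \<noteq> 0" using \<xi> k0 by (auto simp: \<kappa>_def)
  qed
  \<comment> \<open>At time 0 the three new vortices all sit at \<open>z0 1\<close>, and their
    intensities add up to 3 k = \<xi> 1.\<close>
  have mass: "pairing f \<gamma> = (\<Sum>j=1..N + 2. \<kappa> j * f (y j))" if f: "f \<in> C0" for f
  proof -
    have "(\<Sum>j=1..N + 2. \<kappa> j * f (y j)) = \<kappa> 1 * f (y 1) + (\<Sum>j=2..N + 2. \<kappa> j * f (y j))"
      by (subst sum.atLeast_Suc_atMost) (auto simp: numeral_2_eq_2)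
    also have "{2..N + 2} = {2..N} \<union> {N + 1, N + 2}" using N by auto
    also have "(\<Sum>j\<in>{2..N} \<union> {N + 1, N + 2}. \<kappa> j * f (y j)) = (\<Sum>j=2..N. \<kappa> j * f (y j)) + (\<kappa> (N + 1) * f (y (N + 1)) + \<kappa> (N + 2) * f (y (N + 2)))"
      by (subst sum.union_disjoint) auto
    also have "(\<Sum>j=2..N. \<kappa> j * f (y j)) = (\<Sum>j=2..N. \<xi> j * f (z0 j))"
      by (intro sum.cong) (auto simp: \<kappa>_def y_def)
    also have "\<kappa> 1 * f (y 1) + ((\<Sum>j=2..N. \<xi> j * f (z0 j)) + (\<kappa> (N + 1) * f (y (N + 1)) + \<kappa> (N + 2) * f (y (N + 2))))
        = \<xi> 1 * f (z0 1) + (\<Sum>j=2..N. \<xi> j * f (z0 j))"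
      using N by (simp add: \<kappa>_def y_def k_def algebra_simps)
    also have "\<dots> = (\<Sum>j=1..N. \<xi> j * f (z0 j))"
      using N by (subst sum.atLeast_Suc_atMost[of 1 N]) (auto simp: numeral_2_eq_2)
    finally show ?thesis using pairing_vortex_config[OF z0 f] by (simp add: \<gamma>)
  qed
  let ?\<omega> = "\<lambda>t. if t \<le> 0 then \<gamma> else vortex_config (N + 2) \<kappa> (X t)"
  show ?thesis
  proof (rule that[of "T' / 2" ?\<omega>])
    show "weak_solution {0..T' / 2} ?\<omega>"
    proof (rule weak_solution_initial_segment[where T' = T' and y = y, OF _ _ \<kappa>0 injX dX limX])
      show "\<gamma> \<in> configs" using assms by (auto simp: configs_def)
    qed (use T' mass in auto)
    show "?\<omega> t \<in> configs_N (N + 2)" if "t \<in> {0<..T' / 2}" for t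
      using that T' vortex_config_in_configs_N[OF \<kappa>0 injX, of t] by auto
  qed (use T' in auto)
qed

text \<open>Only the behaviour up to and just after \<tau> is prescribed: after the burst, and for
  negative times, any continuation from \<open>forward_existence\<close> will do.\<close>

lemma solution_bursting_at:
  assumes \<gamma>: "\<gamma> \<in> configs_N N" "N \<ge> 1"
    and \<omega>1: "weak_solution {0..T} \<omega>1" "\<omega>1 0 = \<gamma>" "\<And>t. t \<in> {0..T} \<Longrightarrow> \<omega>1 t \<in> configs_N N"
    and \<tau>: "\<tau> \<in> {0..T}"
  shows "\<exists>\<omega>. weak_solution UNIV \<omega> \<and> \<omega> 0 = \<gamma> \<and> (\<forall>t\<in>{0..\<tau>}. \<omega> t \<in> configs_N N) \<and>
    (\<exists>\<epsilon>>0. \<forall>t\<in>{\<tau><..\<tau> + \<epsilon>}. \<omega> t \<in> configs_N (N + 2))"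
proof -
  obtain \<epsilon> \<omega>2 where \<epsilon>: "\<epsilon> > 0" and \<omega>2: "weak_solution {0..\<epsilon>} \<omega>2" "\<omega>2 0 = \<omega>1 \<tau>" "\<And>t. t \<in> {0<..\<epsilon>} \<Longrightarrow> \<omega>2 t \<in> configs_N (N + 2)"
    using burst_segment[OF \<omega>1(3)[OF \<tau>] \<gamma>(2)] by blast
  obtain \<omega>3 where \<omega>3: "weak_solution {0..} \<omega>3" "\<omega>3 0 = \<omega>2 \<epsilon>"
    using forward_existence[OF \<omega>2(3)[of \<epsilon>]] \<epsilon> by auto
  define \<omega>23 where "\<omega>23 = (\<lambda>t. if t \<le> \<epsilon> then \<omega>2 t else \<omega>3 (t - \<epsilon>))"
  have 23: "weak_solution {0..} \<omega>23" unfolding \<omega>23_def by (rule weak_solution_concat[OF \<omega>2(1) \<omega>3(1)]) (use \<omega>3 \<epsilon> in auto)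
  define \<omega>p where "\<omega>p = (\<lambda>t. if t \<le> \<tau> then \<omega>1 t else \<omega>23 (t - \<tau>))"
  have "weak_solution {0..\<tau>} \<omega>1" by (rule weak_solution_subset[OF \<omega>1(1)]) (use \<tau> in auto)
  hence p: "weak_solution {0..} \<omega>p" unfolding \<omega>p_def by (rule weak_solution_concat[OF _ 23]) (use \<tau> \<epsilon> \<omega>2 in \<open>auto simp: \<omega>23_def\<close>)
  have "(\<lambda>A. - \<gamma> A) \<in> configs_N N"
    using \<gamma>(1) unfolding configs_N_def by (auto simp: vortex_config_uminus) (metis neg_equal_0_iff_equal)
  then obtain \<omega>0 where \<omega>0: "weak_solution {0..} \<omega>0" "\<omega>0 0 = (\<lambda>A. - \<gamma> A)" using forward_existence by blast
  define \<omega> where "\<omega> = (\<lambda>t. if t \<le> 0 then (\<lambda>A. - \<omega>0 (- t) A) else \<omega>p t)"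
  have "weak_solution ({..0} \<union> {0..}) \<omega>"
    unfolding \<omega>_def by (rule weak_solution_glue[OF weak_solution_reverse[OF \<omega>0(1)] _ _ p]) (use \<tau> \<omega>0 \<omega>1 in \<open>auto simp: \<omega>p_def\<close>)
  moreover have "{..0} \<union> {0..} = (UNIV :: real set)" by auto
  moreover have w0: "\<omega> 0 = \<gamma>" using \<omega>0 by (simp add: \<omega>_def)
  moreover have "\<omega> t \<in> configs_N N" if "t \<in> {0..\<tau>}" for t
    using that \<tau> \<gamma>(1) w0 \<omega>1(3)[of t] by (cases "t = 0") (auto simp: \<omega>_def \<omega>p_def)
  moreover have "\<omega> t \<in> configs_N (N + 2)" if "t \<in> {\<tau><..\<tau> + \<epsilon>}" for t
    using that \<tau> \<omega>2(3)[of "t - \<tau>"] by (auto simp: \<omega>_def \<omega>p_def \<omega>23_def)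
  ultimately show ?thesis using \<epsilon> by (intro exI[of _ \<omega>]) auto
qed

theorem theorem4p6:
  fixes N :: nat and \<xi> :: "nat \<Rightarrow> real" and z :: "nat \<Rightarrow> real^2"
  assumes "N \<ge> 1"
    and "\<forall>j\<in>{1..N}. \<xi> j \<noteq> 0"
    and "inj_on z {1..N}"
  shows "infinite {\<omega>. point_vortices_solution UNIV \<omega> \<and> \<omega> 0 = vortex_config N \<xi> z}"
proof -
  let ?\<gamma> = "vortex_config N \<xi> z"
  have \<gamma>: "?\<gamma> \<in> configs_N N" by (rule vortex_config_in_configs_N[OF assms(2,3)])
  obtain T \<omega>1 where T: "T > 0" and \<omega>1: "weak_solution {0..T} \<omega>1" "\<omega>1 0 = ?\<gamma>" "\<And>t. t \<in> {0..T} \<Longrightarrow> \<omega>1 t \<in> configs_N N"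
    using regular_segment[OF \<gamma>] by blast
  have "\<forall>\<tau>\<in>{0..T}. \<exists>\<omega>. weak_solution UNIV \<omega> \<and> \<omega> 0 = ?\<gamma> \<and> (\<forall>t\<in>{0..\<tau>}. \<omega> t \<in> configs_N N) \<and>
    (\<exists>\<epsilon>>0. \<forall>t\<in>{\<tau><..\<tau> + \<epsilon>}. \<omega> t \<in> configs_N (N + 2))"
    using solution_bursting_at[OF \<gamma> assms(1) \<omega>1] by blast
  from bchoice[OF this] obtain \<Omega> where \<Omega>: "\<And>\<tau>. \<tau> \<in> {0..T} \<Longrightarrow> weak_solution UNIV (\<Omega> \<tau>) \<and> \<Omega> \<tau> 0 = ?\<gamma> \<and>
    (\<forall>t\<in>{0..\<tau>}. \<Omega> \<tau> t \<in> configs_N N) \<and> (\<exists>\<epsilon>>0. \<forall>t\<in>{\<tau><..\<tau> + \<epsilon>}. \<Omega> \<tau> t \<in> configs_N (N + 2))" by blast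
  have ne: "\<Omega> \<tau> \<noteq> \<Omega> \<tau>'" if \<tau>: "\<tau> \<in> {0..T}" "\<tau>' \<in> {0..T}" "\<tau> < \<tau>'" for \<tau> \<tau>'
  proof
    assume eq: "\<Omega> \<tau> = \<Omega> \<tau>'"
    obtain \<epsilon> where \<epsilon>: "\<epsilon> > 0" "\<And>t. t \<in> {\<tau><..\<tau> + \<epsilon>} \<Longrightarrow> \<Omega> \<tau> t \<in> configs_N (N + 2)" using \<Omega>[OF \<tau>(1)] by blast
    \<comment> \<open>A time after the earlier burst and not after the later one: one solution has N
      + 2 vortices there, the other still has N.\<close>
    define t where "t = min (\<tau> + \<epsilon>) \<tau>'"
    have "\<Omega> \<tau> t \<in> configs_N (N + 2)" using \<epsilon> \<tau> by (intro \<epsilon>) (auto simp: t_def)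
    moreover have "\<Omega> \<tau>' t \<in> configs_N N" using \<Omega>[OF \<tau>(2)] \<tau> \<epsilon> by (auto simp: t_def)
    ultimately show False using card_atoms[of "\<Omega> \<tau> t" "N + 2"] card_atoms[of "\<Omega> \<tau> t" N] eq by simp
  qed
  have "inj_on \<Omega> {0..T}"
    by (rule inj_onI) (metis ne linorder_neqE)
  hence "infinite (\<Omega> ` {0..T})" using T by (simp add: finite_image_iff)
  moreover have "\<Omega> ` {0..T} \<subseteq> {\<omega>. point_vortices_solution UNIV \<omega> \<and> \<omega> 0 = ?\<gamma>}"
    using \<Omega> weak_solution_imp_point_vortices_solution by blast
  ultimately show ?thesis using infinite_super by blast
qed

end
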